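(* For a von Neumann algebra $\mathscr{A}$ the following are equivalent: (1) there is a duplicator on $\mathscr{A}$, that is, a normal positive unital linear map $\mu\colon\mathscr{A}\otimes\mathscr{A}\to\mathscr{A}$ such that $\mu(1\otimes a)=a=\mu(a\otimes 1)$ and $\mu(a\otimes\mu(b\otimes c))=\mu(\mu(a\otimes b)\otimes c)$ for all $a,b,c\in\mathscr{A}$; (2) $\mathscr{A}$ is isomorphic to $\ell^{\infty}(X)$ for some set $X$. Moreover, there is at most one duplicator on $\mathscr{A}$.
   Context: $\mathscr{A}\otimes\mathscr{A}$ denotes the spatial tensor product of von Neumann algebras. A linear map is positive if it maps positive elements to positive elements, unital if it preserves $1$, and normal if it is positive and preserves suprema of bounded directed sets of self-adjoint elements. $\ell^{\infty}(X)$ is the von Neumann algebra of bounded functions $X\to\mathbb{C}$ with pointwise operations; isomorphism means isomorphism of von Neumann algebras (normal unital $*$-isomorphism). *)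

theory Defs
  imports "HOL-Analysis.Analysis"
begin

section \<open>Complex Hilbert spaces\<close>

text \<open>The inner product is linear in its second argument. Positive definiteness is contained in
  \<open>cinner_self_eq\<close>, and completeness comes from the superclass of Banach spaces.\<close>

class complex_hilbert = banach +
  fixes scaleC :: "complex \<Rightarrow> 'a \<Rightarrow> 'a"  (infixr "*\<^sub>C" 75)
    and cinner :: "'a \<Rightarrow> 'a \<Rightarrow> complex"
  assumes scaleC_add_right: "c *\<^sub>C (x + y) = c *\<^sub>C x + c *\<^sub>C y"
    and scaleC_add_left: "(c + d) *\<^sub>C x = c *\<^sub>C x + d *\<^sub>C x"
    and scaleC_scaleC: "c *\<^sub>C d *\<^sub>C x = (c * d) *\<^sub>C x"
    and scaleR_eq_scaleC: "r *\<^sub>R x = complex_of_real r *\<^sub>C x"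
    and cinner_commute: "cinner x y = cnj (cinner y x)"
    and cinner_add_right: "cinner x (y + z) = cinner x y + cinner x z"
    and cinner_scaleC_right: "cinner x (c *\<^sub>C y) = c * cinner x y"
    and cinner_self_eq: "cinner x x = complex_of_real ((norm x)\<^sup>2)"

instantiation complex :: complex_hilbert
begin

definition scaleC_complex :: "complex \<Rightarrow> complex \<Rightarrow> complex"
  where "scaleC_complex c x = c * x"

definition cinner_complex :: "complex \<Rightarrow> complex \<Rightarrow> complex"
  where "cinner_complex x y = cnj x * y"

instance
proof
  fix x :: complex
  show "cinner x x = complex_of_real ((norm x)\<^sup>2)"
    unfolding cinner_complex_def by (metis complex_norm_square mult.commute)
qed (simp_all add: scaleC_complex_def cinner_complex_def algebra_simps scaleR_conv_of_real)

end

text \<open>A Hilbert space tensor product of two Hilbert spaces is a third one together with a bilinear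
  map into it that multiplies inner products and has total range; these data are unique up to a
  unique unitary. The real span below is the complex span, since the set of simple
  tensors is closed under complex scalars.\<close>

definition hilbert_tensor_product ::
    "('a::complex_hilbert \<Rightarrow> 'b::complex_hilbert \<Rightarrow> 'k::complex_hilbert) \<Rightarrow> bool"
  where "hilbert_tensor_product t \<longleftrightarrow>
    (\<forall>x x' y. t (x + x') y = t x y + t x' y) \<and>
    (\<forall>x y y'. t x (y + y') = t x y + t x y') \<and>
    (\<forall>c x y. t (c *\<^sub>C x) y = c *\<^sub>C t x y) \<and>
    (\<forall>c x y. t x (c *\<^sub>C y) = c *\<^sub>C t x y) \<and>
    (\<forall>x y x' y'. cinner (t x y) (t x' y') = cinner x x' * cinner y y') \<and>
    closure (span {t x y |x y. True}) = UNIV"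

lemma hilbert_tensor_product_complex:
  "hilbert_tensor_product ((*) :: complex \<Rightarrow> complex \<Rightarrow> complex)"
proof -
  have "{x * y |x y :: complex. True} = UNIV"
    by (auto intro: exI[of _ 1])
  then show ?thesis
    by (simp add: hilbert_tensor_product_def scaleC_complex_def cinner_complex_def algebra_simps)
qed


section \<open>Bounded operators and von Neumann algebras\<close>

text \<open>The type of bounded linear functions of the library consists of the real-linear ones.\<close>

definition bounded_ops :: "('h::complex_hilbert \<Rightarrow>\<^sub>L 'h) set"
  where "bounded_ops = {T. \<forall>c x. blinfun_apply T (c *\<^sub>C x) = c *\<^sub>C blinfun_apply T x}"

definition scale_op :: "complex \<Rightarrow> ('h::complex_hilbert \<Rightarrow>\<^sub>L 'h) \<Rightarrow> ('h \<Rightarrow>\<^sub>L 'h)"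
  where "scale_op c T = Blinfun (\<lambda>x. c *\<^sub>C blinfun_apply T x)"

definition adj_op :: "('h::complex_hilbert \<Rightarrow>\<^sub>L 'h) \<Rightarrow> ('h \<Rightarrow>\<^sub>L 'h)"
  where "adj_op T = (THE S. S \<in> bounded_ops \<and>
    (\<forall>x y. cinner (blinfun_apply S x) y = cinner x (blinfun_apply T y)))"

definition commutant :: "('h::complex_hilbert \<Rightarrow>\<^sub>L 'h) set \<Rightarrow> ('h \<Rightarrow>\<^sub>L 'h) set"
  where "commutant S = {T \<in> bounded_ops. \<forall>s\<in>S. T o\<^sub>L s = s o\<^sub>L T}"

text \<open>A bicommutant is automatically a unital subalgebra.\<close>

definition von_neumann_algebra :: "('h::complex_hilbert \<Rightarrow>\<^sub>L 'h) set \<Rightarrow> bool"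
  where "von_neumann_algebra A \<longleftrightarrow>
    A \<subseteq> bounded_ops \<and> (\<forall>a\<in>A. adj_op a \<in> A) \<and> commutant (commutant A) = A"

definition tensor_op ::
    "('a::complex_hilbert \<Rightarrow> 'b::complex_hilbert \<Rightarrow> 'k::complex_hilbert) \<Rightarrow>
     ('a \<Rightarrow>\<^sub>L 'a) \<Rightarrow> ('b \<Rightarrow>\<^sub>L 'b) \<Rightarrow> ('k \<Rightarrow>\<^sub>L 'k)"
  where "tensor_op t a b = (THE T. T \<in> bounded_ops \<and>
    (\<forall>x y. blinfun_apply T (t x y) = t (blinfun_apply a x) (blinfun_apply b y)))"

text \<open>The von Neumann algebra generated by the operators \<open>a \<otimes> b\<close>, as a bicommutant; the set of
  these operators is closed under adjoints.\<close>

definition spatial_tensor ::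
    "('a::complex_hilbert \<Rightarrow> 'b::complex_hilbert \<Rightarrow> 'k::complex_hilbert) \<Rightarrow>
     ('a \<Rightarrow>\<^sub>L 'a) set \<Rightarrow> ('b \<Rightarrow>\<^sub>L 'b) set \<Rightarrow> ('k \<Rightarrow>\<^sub>L 'k) set"
  where "spatial_tensor t A B =
    commutant (commutant {tensor_op t a b |a b. a \<in> A \<and> b \<in> B})"


section \<open>Ordered star-algebras and their maps\<close>

text \<open>A common signature for algebras of operators and algebras of functions; \<open>pos\<close> is the
  cone of positive elements.\<close>

record 'a star_algebra =
  carr :: "'a set"
  add :: "'a \<Rightarrow> 'a \<Rightarrow> 'a"
  mul :: "'a \<Rightarrow> 'a \<Rightarrow> 'a"
  unit :: 'a
  scale :: "complex \<Rightarrow> 'a \<Rightarrow> 'a"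
  star :: "'a \<Rightarrow> 'a"
  pos :: "'a set"

definition op_algebra :: "('h::complex_hilbert \<Rightarrow>\<^sub>L 'h) set \<Rightarrow> ('h \<Rightarrow>\<^sub>L 'h) star_algebra"
  where "op_algebra A =
    \<lparr>carr = A, add = (+), mul = (o\<^sub>L), unit = id_blinfun, scale = scale_op, star = adj_op,
     pos = {a \<in> A. \<forall>x. cinner x (blinfun_apply a x) \<in> \<real>\<^sub>\<ge>\<^sub>0}\<rparr>"

text \<open>Bounded functions on \<open>X\<close> are represented by total functions that vanish off \<open>X\<close>.\<close>

definition linf :: "'x set \<Rightarrow> ('x \<Rightarrow> complex) star_algebra"
  where "linf X =
    (let F = {f. bounded (f ` X) \<and> (\<forall>x. x \<notin> X \<longrightarrow> f x = 0)} in
     \<lparr>carr = F, add = (\<lambda>f g x. f x + g x), mul = (\<lambda>f g x. f x * g x),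
      unit = (\<lambda>x. if x \<in> X then 1 else 0), scale = (\<lambda>c f x. c * f x), star = (\<lambda>f x. cnj (f x)),
      pos = {f \<in> F. \<forall>x\<in>X. f x \<in> \<real>\<^sub>\<ge>\<^sub>0}\<rparr>)"

definition self_adj :: "'a star_algebra \<Rightarrow> 'a set"
  where "self_adj M = {a \<in> carr M. star M a = a}"

definition le_alg :: "'a star_algebra \<Rightarrow> 'a \<Rightarrow> 'a \<Rightarrow> bool"
  where "le_alg M a b \<longleftrightarrow> (\<exists>p\<in>pos M. b = add M a p)"

definition directed_alg :: "'a star_algebra \<Rightarrow> 'a set \<Rightarrow> bool"
  where "directed_alg M D \<longleftrightarrow>
    D \<noteq> {} \<and> (\<forall>a\<in>D. \<forall>b\<in>D. \<exists>c\<in>D. le_alg M a c \<and> le_alg M b c)"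

definition upper_bound_alg :: "'a star_algebra \<Rightarrow> 'a set \<Rightarrow> 'a \<Rightarrow> bool"
  where "upper_bound_alg M D u \<longleftrightarrow> u \<in> self_adj M \<and> (\<forall>d\<in>D. le_alg M d u)"

definition sup_alg :: "'a star_algebra \<Rightarrow> 'a set \<Rightarrow> 'a \<Rightarrow> bool"
  where "sup_alg M D s \<longleftrightarrow>
    upper_bound_alg M D s \<and> (\<forall>u. upper_bound_alg M D u \<longrightarrow> le_alg M s u)"

definition linear_alg :: "'a star_algebra \<Rightarrow> 'b star_algebra \<Rightarrow> ('a \<Rightarrow> 'b) \<Rightarrow> bool"
  where "linear_alg M N f \<longleftrightarrow> f \<in> carr M \<rightarrow> carr N \<and>
    (\<forall>a\<in>carr M. \<forall>b\<in>carr M. f (add M a b) = add N (f a) (f b)) \<and>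
    (\<forall>c. \<forall>a\<in>carr M. f (scale M c a) = scale N c (f a))"

definition positive_alg :: "'a star_algebra \<Rightarrow> 'b star_algebra \<Rightarrow> ('a \<Rightarrow> 'b) \<Rightarrow> bool"
  where "positive_alg M N f \<longleftrightarrow> f ` pos M \<subseteq> pos N"

definition unital_alg :: "'a star_algebra \<Rightarrow> 'b star_algebra \<Rightarrow> ('a \<Rightarrow> 'b) \<Rightarrow> bool"
  where "unital_alg M N f \<longleftrightarrow> f (unit M) = unit N"

definition normal_alg :: "'a star_algebra \<Rightarrow> 'b star_algebra \<Rightarrow> ('a \<Rightarrow> 'b) \<Rightarrow> bool"
  where "normal_alg M N f \<longleftrightarrow> positive_alg M N f \<and>
    (\<forall>D s. D \<subseteq> self_adj M \<and> directed_alg M D \<and> (\<exists>u. upper_bound_alg M D u) \<and> sup_alg M D s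
      \<longrightarrow> sup_alg N (f ` D) (f s))"

definition vn_iso :: "'a star_algebra \<Rightarrow> 'b star_algebra \<Rightarrow> ('a \<Rightarrow> 'b) \<Rightarrow> bool"
  where "vn_iso M N f \<longleftrightarrow> bij_betw f (carr M) (carr N) \<and> linear_alg M N f \<and>
    (\<forall>a\<in>carr M. \<forall>b\<in>carr M. f (mul M a b) = mul N (f a) (f b)) \<and>
    (\<forall>a\<in>carr M. f (star M a) = star N (f a)) \<and>
    unital_alg M N f \<and> normal_alg M N f"

definition isomorphic_alg :: "'a star_algebra \<Rightarrow> 'b star_algebra \<Rightarrow> bool"
  where "isomorphic_alg M N \<longleftrightarrow> (\<exists>f. vn_iso M N f)"


section \<open>Duplicators\<close>

definition duplicator ::
    "('h::complex_hilbert \<Rightarrow> 'h \<Rightarrow> 'k::complex_hilbert) \<Rightarrow> ('h \<Rightarrow>\<^sub>L 'h) set \<Rightarrow>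
     (('k \<Rightarrow>\<^sub>L 'k) \<Rightarrow> ('h \<Rightarrow>\<^sub>L 'h)) \<Rightarrow> bool"
  where "duplicator t A \<mu> \<longleftrightarrow>
    (let M = op_algebra (spatial_tensor t A A); N = op_algebra A in
      linear_alg M N \<mu> \<and> positive_alg M N \<mu> \<and> unital_alg M N \<mu> \<and> normal_alg M N \<mu>) \<and>
    (\<forall>a\<in>A. \<mu> (tensor_op t id_blinfun a) = a \<and> \<mu> (tensor_op t a id_blinfun) = a) \<and>
    (\<forall>a\<in>A. \<forall>b\<in>A. \<forall>c\<in>A.
      \<mu> (tensor_op t a (\<mu> (tensor_op t b c))) = \<mu> (tensor_op t (\<mu> (tensor_op t a b)) c))"

end

theory Submission
  imports Defs
begin

text \<open>Let \<open>\<mu>\<close> be a duplicator on \<open>A\<close>. For a projection \<open>p\<close> and \<open>0 \<le> b \<le> 1\<close>, positivity gives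
  \<open>\<mu> (p \<otimes> b) \<le> \<mu> (p \<otimes> 1) = p\<close> and \<open>\<mu> (p\<^sup>\<bottom> \<otimes> b) \<le> p\<^sup>\<bottom>\<close>; since the two add up to \<open>b\<close>, we get
  \<open>\<mu> (p \<otimes> b) = p b = b p\<close>. The span of the projections is dense, so \<open>A\<close> is commutative.

  By normality there is a largest projection annihilated by \<open>\<mu>\<close>; its complement \<open>E\<close> is a diagonal:
  \<open>\<mu> E = 1\<close> and \<open>E (p \<otimes> p\<^sup>\<bottom>) = 0\<close>. On a diffuse algebra the diagonal would be a null set, but
  \<open>E (x \<otimes> x) \<noteq> 0\<close> for every \<open>x \<noteq> 0\<close>; hence every \<open>x \<noteq> 0\<close> is seen by a minimal projection, and \<open>A\<close>
  consists of the bounded functions on the set of minimal projections.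

  Every \<open>T\<close> in the tensor square is a scalar multiple \<open>c q \<otimes> q\<close> on the range of \<open>q \<otimes> q\<close>, for \<open>q\<close>
  minimal, and positivity forces \<open>\<mu> T q = \<mu> (T (q \<otimes> q)) q = c q\<close>, which determines \<open>\<mu>\<close>.
  Conversely, on \<open>\<ell>\<^sup>\<infinity>(X)\<close> the restriction of functions on \<open>X \<times> X\<close> to the diagonal is a
  duplicator.\<close>

text \<open>Away from tensors \<open>p \<otimes> b\<close> with \<open>p\<close> a projection,
  nothing like multiplicativity of \<open>\<mu>\<close> is available. Statements about other
  elements of the tensor square are squeezed out of the order: \<open>0 \<le> m \<le> k p\<close>
  forces \<open>m = m p = p m\<close>. The null-set heuristic is made quantitative. Fix a vector
  \<open>x\<close> and let the mass of a projection \<open>r\<close> be the squared norm of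
  \<open>r x\<close>. As \<open>E\<close> kills \<open>r \<otimes> (1 - r)\<close>, the weight that
  \<open>E\<close> gives to \<open>r x \<otimes> r x\<close> is additive in \<open>r\<close>, yet it
  is at most the square of the mass. Cutting a unit mass into \<open>n\<close> equal pieces would
  bound the total weight by \<open>1 / n\<close>. A positive lower bound on the ratio of weight to
  mass therefore stops the subdivision, and this ratio is what Zorn's lemma is applied to. Normality
  speaks of suprema in the order, whereas the estimates are about vectors. The link is that a
  bounded directed family of self-adjoint operators converges strongly to its supremum.\<close>

lemma scaleC_one [simp]: "1 *\<^sub>C x = (x::'a::complex_hilbert)"
  using scaleR_eq_scaleC[of 1 x] by simp

lemma scaleC_minus1 [simp]: "(-1) *\<^sub>C x = - (x::'a::complex_hilbert)"
  using scaleR_eq_scaleC[of "-1" x] by simp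

section \<open>Calculus of the inner product and of complex scalars\<close>

lemma cinner_add_left: "cinner (x + y) z = cinner x z + cinner y (z::'a::complex_hilbert)"
  by (metis cinner_commute cinner_add_right complex_cnj_add)

lemma cinner_scaleC_left: "cinner (c *\<^sub>C x) y = cnj c * cinner x (y::'a::complex_hilbert)"
  by (metis cinner_commute cinner_scaleC_right complex_cnj_mult)

lemma cinner_minus_right [simp]: "cinner x (- y) = - cinner x (y::'a::complex_hilbert)"
  using cinner_scaleC_right[of x "-1" y] by simp

lemma cinner_minus_left [simp]: "cinner (- x) y = - cinner x (y::'a::complex_hilbert)"
  using cinner_scaleC_left[of "-1" x y] by simp

lemma cinner_diff_right: "cinner x (y - z) = cinner x y - cinner x (z::'a::complex_hilbert)"
  using cinner_add_right[of x y "-z"] by simp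

lemma cinner_diff_left: "cinner (x - y) z = cinner x z - cinner y (z::'a::complex_hilbert)"
  using cinner_add_left[of x "-y" z] by simp

lemma cinner_zero_right [simp]: "cinner x 0 = (0::complex)" for x :: "'a::complex_hilbert"
  using cinner_diff_right[of x 0 0] by simp

lemma cinner_zero_left [simp]: "cinner 0 x = (0::complex)" for x :: "'a::complex_hilbert"
  using cinner_diff_left[of 0 0 x] by simp

lemma cinner_scaleR_right: "cinner x (r *\<^sub>R y) = r *\<^sub>R cinner x (y::'a::complex_hilbert)"
  by (simp add: scaleR_eq_scaleC[of r y] cinner_scaleC_right scaleR_conv_of_real)

lemma cinner_scaleR_left: "cinner (r *\<^sub>R x) y = r *\<^sub>R cinner x (y::'a::complex_hilbert)"
  by (simp add: scaleR_eq_scaleC[of r x] cinner_scaleC_left scaleR_conv_of_real)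

lemmas cinner_simps = cinner_add_left cinner_add_right cinner_diff_left cinner_diff_right
  cinner_scaleC_left cinner_scaleC_right cinner_scaleR_left cinner_scaleR_right

lemma cinner_eq_zero_iff [simp]: "cinner x x = 0 \<longleftrightarrow> x = (0::'a::complex_hilbert)"
  by (simp add: cinner_self_eq)

lemma Re_cinner_self: "Re (cinner x x) = (norm (x::'a::complex_hilbert))\<^sup>2"
  by (simp add: cinner_self_eq)

lemma cinner_ext:
  assumes "\<And>z. cinner z x = cinner z (y::'a::complex_hilbert)"
  shows "x = y"
proof -
  have "cinner (x - y) (x - y) = 0"
    using assms by (simp add: cinner_diff_right)
  then show ?thesis by simp
qed

lemma norm_scaleC: "norm (c *\<^sub>C x) = cmod c * norm (x::'a::complex_hilbert)"
proof -
  have "complex_of_real ((norm (c *\<^sub>C x))\<^sup>2) = cinner (c *\<^sub>C x) (c *\<^sub>C x)"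
    by (simp add: cinner_self_eq)
  also have "\<dots> = (cnj c * c) * cinner x x"
    by (simp add: cinner_simps mult.assoc)
  also have "\<dots> = complex_of_real ((cmod c * norm x)\<^sup>2)"
    by (simp add: cinner_self_eq power_mult_distrib mult.commute flip: complex_norm_square)
  finally have "(norm (c *\<^sub>C x))\<^sup>2 = (cmod c * norm x)\<^sup>2"
    using of_real_eq_iff by blast
  then show ?thesis by (simp add: power2_eq_iff_nonneg)
qed

lemma scaleC_zero [simp]: "c *\<^sub>C 0 = (0::'a::complex_hilbert)"
  using norm_scaleC[of c "0::'a"] by simp

lemma zero_scaleC [simp]: "0 *\<^sub>C x = (0::'a::complex_hilbert)"
  using norm_scaleC[of 0 x] by simp

lemma scaleC_minus_right: "c *\<^sub>C (- x) = - (c *\<^sub>C (x::'a::complex_hilbert))"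
  using scaleC_add_right[of c x "-x"] by (simp add: eq_neg_iff_add_eq_0 add.commute)

lemma scaleC_diff_right: "c *\<^sub>C (x - y) = c *\<^sub>C x - c *\<^sub>C (y::'a::complex_hilbert)"
  using scaleC_add_right[of c x "-y"] by (simp add: scaleC_minus_right)

lemma scaleC_scaleR: "c *\<^sub>C (r *\<^sub>R x) = r *\<^sub>R (c *\<^sub>C (x::'a::complex_hilbert))"
  by (simp add: scaleR_eq_scaleC scaleC_scaleC mult.commute)

lemma bounded_linear_scaleC: "bounded_linear (\<lambda>x::'a::complex_hilbert. c *\<^sub>C x)"
  by (rule bounded_linear_intro[where K = "cmod c"])
    (simp_all add: scaleC_add_right scaleC_scaleR norm_scaleC mult.commute)


subsection \<open>Bounded operators\<close>

lemma bounded_opsD: "T \<in> bounded_ops \<Longrightarrow> blinfun_apply T (c *\<^sub>C x) = c *\<^sub>C blinfun_apply T x"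
  by (simp add: bounded_ops_def)

lemma scale_op_apply [simp]: "blinfun_apply (scale_op c T) x = c *\<^sub>C blinfun_apply T x"
  unfolding scale_op_def
  using bounded_linear_compose[OF bounded_linear_scaleC blinfun.bounded_linear_right[of T], of c]
  by (simp add: bounded_linear_Blinfun_apply)

lemma bounded_ops_zero [simp]: "0 \<in> bounded_ops"
  and bounded_ops_id [simp]: "id_blinfun \<in> bounded_ops"
  and bounded_ops_add: "S \<in> bounded_ops \<Longrightarrow> T \<in> bounded_ops \<Longrightarrow> S + T \<in> bounded_ops"
  and bounded_ops_diff: "S \<in> bounded_ops \<Longrightarrow> T \<in> bounded_ops \<Longrightarrow> S - T \<in> bounded_ops"
  and bounded_ops_scaleR: "T \<in> bounded_ops \<Longrightarrow> r *\<^sub>R T \<in> bounded_ops"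
  and bounded_ops_compose: "S \<in> bounded_ops \<Longrightarrow> T \<in> bounded_ops \<Longrightarrow> S o\<^sub>L T \<in> bounded_ops"
  and bounded_ops_scale: "T \<in> bounded_ops \<Longrightarrow> scale_op c T \<in> bounded_ops"
  by (simp_all add: bounded_ops_def blinfun.bilinear_simps scaleC_add_right scaleC_diff_right
      scaleC_scaleR scaleC_scaleC mult.commute)

lemmas bounded_ops_intros = bounded_ops_zero bounded_ops_id bounded_ops_add bounded_ops_diff
  bounded_ops_scaleR bounded_ops_compose bounded_ops_scale

section \<open>Positive and self-adjoint operators and their quadratic forms\<close>

definition pos_op :: "('h::complex_hilbert \<Rightarrow>\<^sub>L 'h) \<Rightarrow> bool"
  where "pos_op T \<longleftrightarrow> T \<in> bounded_ops \<and> (\<forall>x. cinner x (blinfun_apply T x) \<in> \<real>\<^sub>\<ge>\<^sub>0)"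

definition selfadj_op :: "('h::complex_hilbert \<Rightarrow>\<^sub>L 'h) \<Rightarrow> bool"
  where "selfadj_op T \<longleftrightarrow> T \<in> bounded_ops \<and>
    (\<forall>x y. cinner (blinfun_apply T x) y = cinner x (blinfun_apply T y))"

definition proj_op :: "('h::complex_hilbert \<Rightarrow>\<^sub>L 'h) \<Rightarrow> bool"
  where "proj_op p \<longleftrightarrow> selfadj_op p \<and> p o\<^sub>L p = p"

text \<open>A real-valued form turns operator inequalities into inequalities between reals. On
  self-adjoint operators nothing is lost, by \<open>selfadj_qform\<close> and
  \<open>selfadj_eqI\<close>.\<close>

definition qform :: "('h::complex_hilbert \<Rightarrow>\<^sub>L 'h) \<Rightarrow> 'h \<Rightarrow> real"
  where "qform T x = Re (cinner x (blinfun_apply T x))"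

lemma selfadjD: "selfadj_op T \<Longrightarrow> cinner (blinfun_apply T x) y = cinner x (blinfun_apply T y)"
  by (simp add: selfadj_op_def)

lemma selfadj_bounded: "selfadj_op T \<Longrightarrow> T \<in> bounded_ops"
  by (simp add: selfadj_op_def)

lemma selfadj_qform:
  assumes "selfadj_op T"
  shows "cinner x (blinfun_apply T x) = complex_of_real (qform T x)"
proof -
  have "cnj (cinner x (T x)) = cinner x (T x)"
    using assms by (metis cinner_commute selfadj_op_def)
  then show ?thesis
    unfolding qform_def by (metis Reals_cnj_iff of_real_Re)
qed

text \<open>Complex polarisation: reality of the form at \<open>x + y\<close> gives the imaginary
  part of the symmetry, reality at \<open>x + \<i> *\<^sub>C y\<close> the real part.\<close>

lemma pos_selfadj:
  assumes "pos_op T"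
  shows "selfadj_op T"
  unfolding selfadj_op_def
proof (intro conjI allI)
  show T: "T \<in> bounded_ops" using assms by (simp add: pos_op_def)
  fix x y
  have im: "Im (cinner z (T z)) = 0" for z
    using assms by (metis Im_complex_of_real nonneg_Reals_cases pos_op_def)
  have "Im (cinner x (T y)) + Im (cinner y (T x)) = 0"
    using im[of "x + y"] im[of x] im[of y] by (simp add: blinfun.add_right cinner_simps)
  moreover have "Re (cinner x (T y)) - Re (cinner y (T x)) = 0"
    using im[of "x + \<i> *\<^sub>C y"] im[of x] im[of y]
    by (simp add: blinfun.add_right bounded_opsD[OF T] cinner_simps)
  ultimately have "cinner x (T y) = cnj (cinner y (T x))"
    by (simp add: complex_eq_iff)
  then show "cinner (T x) y = cinner x (T y)"
    by (metis cinner_commute)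
qed

lemma pos_op_iff: "pos_op T \<longleftrightarrow> selfadj_op T \<and> (\<forall>x. 0 \<le> qform T x)"
proof
  assume "pos_op T"
  then show "selfadj_op T \<and> (\<forall>x. 0 \<le> qform T x)"
    by (auto simp: pos_selfadj pos_op_def qform_def complex_nonneg_Reals_iff)
next
  assume *: "selfadj_op T \<and> (\<forall>x. 0 \<le> qform T x)"
  then show "pos_op T"
    by (auto simp: pos_op_def selfadj_bounded selfadj_qform)
qed

lemma pos_qform: "pos_op T \<Longrightarrow> 0 \<le> qform T x"
  by (simp add: pos_op_iff)

lemma selfadj_zero [simp]: "selfadj_op 0"
  and selfadj_id [simp]: "selfadj_op id_blinfun"
  and selfadj_add: "selfadj_op S \<Longrightarrow> selfadj_op T \<Longrightarrow> selfadj_op (S + T)"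
  and selfadj_diff: "selfadj_op S \<Longrightarrow> selfadj_op T \<Longrightarrow> selfadj_op (S - T)"
  and selfadj_scaleR: "selfadj_op T \<Longrightarrow> selfadj_op (r *\<^sub>R T)"
  by (auto simp: selfadj_op_def bounded_ops_intros blinfun.bilinear_simps cinner_simps)

lemma qform_zero [simp]: "qform 0 x = 0"
  and qform_id [simp]: "qform id_blinfun x = (norm x)\<^sup>2"
  and qform_add: "qform (S + T) x = qform S x + qform T x"
  and qform_diff: "qform (S - T) x = qform S x - qform T x"
  and qform_scaleR: "qform (r *\<^sub>R T) x = r * qform T x"
  by (simp_all add: qform_def blinfun.bilinear_simps cinner_simps Re_cinner_self)

lemma pos_zero [simp]: "pos_op 0"
  and pos_id [simp]: "pos_op id_blinfun"
  and pos_add: "pos_op S \<Longrightarrow> pos_op T \<Longrightarrow> pos_op (S + T)"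
  and pos_scaleR: "pos_op T \<Longrightarrow> 0 \<le> r \<Longrightarrow> pos_op (r *\<^sub>R T)"
  by (simp_all add: pos_op_iff selfadj_add selfadj_scaleR qform_add qform_scaleR)

lemma pos_diff_iff:
  "selfadj_op S \<Longrightarrow> selfadj_op T \<Longrightarrow> pos_op (T - S) \<longleftrightarrow> (\<forall>x. qform S x \<le> qform T x)"
  by (simp add: pos_op_iff selfadj_diff qform_diff)

section \<open>Cauchy-Schwarz for positive operators and the norm estimates drawn from it\<close>

lemma pos_Cauchy_Schwarz:
  assumes P: "pos_op P"
  shows "(cmod (cinner x (blinfun_apply P y)))\<^sup>2 \<le> qform P x * qform P y"
proof -
  define w where "w = cinner x (P y)"
  have sa: "selfadj_op P" and B: "P \<in> bounded_ops"
    using P by (auto simp: pos_selfadj pos_op_def)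
  have yx: "cinner y (P x) = cnj w"
    unfolding w_def by (metis cinner_commute sa selfadjD)
  \<comment> \<open>The factor \<open>cnj w\<close> rotates the second vector so that each cross
    term equals \<open>- t * (cmod w)\<^sup>2\<close>; what remains is a real polynomial in
    \<open>t\<close>.\<close>
  have key: "0 \<le> qform P x - 2 * t * (cmod w)\<^sup>2 + t\<^sup>2 * (cmod w)\<^sup>2 * qform P y" for t :: real
  proof -
    let ?l = "- (complex_of_real t) * cnj w"
    have "0 \<le> Re (cinner (x + ?l *\<^sub>C y) (P (x + ?l *\<^sub>C y)))"
      using pos_qform[OF P] by (simp add: qform_def)
    also have "cinner (x + ?l *\<^sub>C y) (P (x + ?l *\<^sub>C y)) =
        complex_of_real (qform P x) + ?l * w + cnj ?l * cnj w
        + cnj ?l * ?l * complex_of_real (qform P y)"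
      unfolding blinfun.add_right bounded_opsD[OF B] cinner_simps yx selfadj_qform[OF sa]
        w_def[symmetric] by (simp add: algebra_simps)
    also have "Re \<dots> = qform P x - 2 * t * (cmod w)\<^sup>2 + t\<^sup>2 * (cmod w)\<^sup>2 * qform P y"
      unfolding cmod_power2 by (simp add: power2_eq_square algebra_simps)
    finally show ?thesis .
  qed
  show ?thesis
  proof (cases "qform P y = 0")
    case True
    have "(cmod w)\<^sup>2 = 0"
    proof (rule ccontr)
      assume nz: "(cmod w)\<^sup>2 \<noteq> 0"
      \<comment> \<open>Here the polynomial is linear in \<open>t\<close>, and this \<open>t\<close>
        is large enough to make it negative.\<close>
      have "0 \<le> qform P x - 2 * ((qform P x + 1) / (cmod w)\<^sup>2) * (cmod w)\<^sup>2"
        using key[of "(qform P x + 1) / (cmod w)\<^sup>2"] True by simp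
      also have "\<dots> = - qform P x - 2"
        using nz by simp
      finally show False using pos_qform[OF P, of x] by simp
    qed
    then show ?thesis using True by (simp add: w_def)
  next
    case False
    then have pos: "qform P y > 0"
      using pos_qform[OF P, of y] by simp
    have "0 \<le> qform P x - (cmod w)\<^sup>2 / qform P y"
      using key[of "1 / qform P y"] pos by (simp add: field_simps power2_eq_square)
    then show ?thesis
      using pos by (simp add: field_simps w_def)
  qed
qed

lemma cinner_Cauchy_Schwarz: "cmod (cinner x y) \<le> norm x * norm (y::'h::complex_hilbert)"
proof -
  have "(cmod (cinner x y))\<^sup>2 \<le> (norm x * norm y)\<^sup>2"
    using pos_Cauchy_Schwarz[OF pos_id, of x y] by (simp add: power_mult_distrib)
  then show ?thesis
    by (rule power2_le_imp_le) simp
qed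

lemma bounded_bilinear_cinner: "bounded_bilinear (cinner :: 'h::complex_hilbert \<Rightarrow> 'h \<Rightarrow> complex)"
proof
  show "\<exists>K. \<forall>a b :: 'h. norm (cinner a b) \<le> norm a * norm b * K"
    using cinner_Cauchy_Schwarz by (metis mult.right_neutral)
qed (simp_all add: cinner_simps)

lemmas tendsto_cinner = bounded_bilinear.tendsto[OF bounded_bilinear_cinner]
lemmas continuous_on_cinner = bounded_bilinear.continuous_on[OF bounded_bilinear_cinner]

lemma pos_qform_zero:
  assumes "pos_op P" "qform P x = 0"
  shows "blinfun_apply P x = 0"
proof -
  have "(cmod (cinner (P x) (P x)))\<^sup>2 \<le> 0"
    using pos_Cauchy_Schwarz[OF assms(1), of "P x" x] assms(2) by simp
  then show ?thesis by simp
qed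

lemma selfadj_eqI:
  assumes "selfadj_op S" "selfadj_op T" "\<And>x. qform S x = qform T x"
  shows "S = T"
proof (rule blinfun_eqI)
  fix x
  have "pos_op (S - T)" "qform (S - T) x = 0"
    using assms by (auto simp: pos_op_iff selfadj_diff qform_diff)
  then have "(S - T) x = 0" by (rule pos_qform_zero)
  then show "S x = T x" by (simp add: blinfun.diff_left)
qed

lemma pos_antisym:
  assumes "pos_op T" "pos_op (- T)"
  shows "T = 0"
proof (rule selfadj_eqI)
  show "selfadj_op T" "selfadj_op 0" using assms pos_selfadj by auto
  fix x
  show "qform T x = qform 0 x"
    using pos_qform[OF assms(1), of x] pos_qform[OF assms(2), of x] qform_diff[of 0 T x] by simp
qed

text \<open>Cauchy-Schwarz for the form of \<open>P\<close>, applied to \<open>P x\<close> and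
  \<open>x\<close>; in operator terms, \<open>P \<le> C\<close> implies
  \<open>P\<^sup>2 \<le> C P\<close>. It turns small values of the form into short vectors, on which
  the strong convergence of directed families rests.\<close>

lemma pos_norm_le:
  assumes P: "pos_op P" and C: "\<And>x. qform P x \<le> C * (norm x)\<^sup>2"
  shows "(norm (blinfun_apply P x))\<^sup>2 \<le> C * qform P x"
proof (cases "P x = 0")
  case True
  then show ?thesis by (simp add: qform_def)
next
  case False
  have "((norm (P x))\<^sup>2)\<^sup>2 = (cmod (cinner (P x) (P x)))\<^sup>2"
    unfolding cinner_self_eq norm_of_real by simp
  also have "\<dots> \<le> qform P (P x) * qform P x"
    by (rule pos_Cauchy_Schwarz[OF P])
  also have "\<dots> \<le> C * (norm (P x))\<^sup>2 * qform P x"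
    by (intro mult_right_mono C pos_qform[OF P])
  finally have "(norm (P x))\<^sup>2 * (norm (P x))\<^sup>2 \<le> (norm (P x))\<^sup>2 * (C * qform P x)"
    by (simp add: power2_eq_square algebra_simps)
  then show ?thesis
    by (rule mult_left_le_imp_le) (use False in simp)
qed

lemma qform_le_norm: "\<bar>qform T x\<bar> \<le> norm T * (norm x)\<^sup>2"
proof -
  have "\<bar>qform T x\<bar> \<le> cmod (cinner x (T x))"
    unfolding qform_def by (rule abs_Re_le_cmod)
  also have "\<dots> \<le> norm x * norm (T x)"
    by (rule cinner_Cauchy_Schwarz)
  also have "\<dots> \<le> norm x * (norm T * norm x)"
    by (intro mult_left_mono norm_blinfun) simp
  finally show ?thesis by (simp add: power2_eq_square algebra_simps)
qed

text \<open>The operator \<open>C + T\<close> lies between 0 and \<open>2 C\<close>, so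
  \<open>pos_norm_le\<close> applies to it. After expanding both sides the terms in
  \<open>qform T x\<close> cancel.\<close>

lemma selfadj_norm_le:
  assumes T: "selfadj_op T" and C: "\<And>x. \<bar>qform T x\<bar> \<le> C * (norm x)\<^sup>2" and "0 \<le> C"
  shows "norm T \<le> C"
proof (rule norm_blinfun_bound[OF \<open>0 \<le> C\<close>])
  fix x
  let ?P = "C *\<^sub>R id_blinfun + T"
  have "qform ?P y = C * (norm y)\<^sup>2 + qform T y" for y
    by (simp add: qform_add qform_scaleR)
  moreover have "- (C * (norm y)\<^sup>2) \<le> qform T y" "qform T y \<le> C * (norm y)\<^sup>2" for y
    using C[of y] by auto
  ultimately have "0 \<le> qform ?P y" and le: "qform ?P y \<le> (2 * C) * (norm y)\<^sup>2" for y
    by (smt (verit) distrib_right mult_2)+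
  then have P: "pos_op ?P"
    using T by (simp add: pos_op_iff selfadj_add selfadj_scaleR)
  have "(norm (?P x))\<^sup>2 \<le> 2 * C * qform ?P x"
    by (rule pos_norm_le[OF P le])
  moreover have "(norm (?P x))\<^sup>2 = C\<^sup>2 * (norm x)\<^sup>2 + 2 * C * qform T x + (norm (T x))\<^sup>2"
  proof -
    have "(norm (?P x))\<^sup>2 = Re (cinner (C *\<^sub>R x + T x) (C *\<^sub>R x + T x))"
      by (simp add: Re_cinner_self blinfun.bilinear_simps)
    also have "\<dots> = C * (C * (norm x)\<^sup>2) + C * Re (cinner x (T x)) + C * Re (cinner (T x) x)
        + (norm (T x))\<^sup>2"
      by (simp add: cinner_simps Re_cinner_self algebra_simps)
    also have "Re (cinner (T x) x) = qform T x"
      using selfadjD[OF T] by (simp add: qform_def)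
    finally show ?thesis
      by (simp add: qform_def power2_eq_square)
  qed
  moreover have "2 * C * qform ?P x = 2 * (C\<^sup>2 * (norm x)\<^sup>2) + 2 * C * qform T x"
    by (simp add: qform_add qform_scaleR power2_eq_square distrib_left)
  ultimately have "(norm (T x))\<^sup>2 \<le> (C * norm x)\<^sup>2"
    unfolding power_mult_distrib by linarith
  then show "norm (T x) \<le> C * norm x"
    by (rule power2_le_imp_le) (use \<open>0 \<le> C\<close> in simp)
qed

subsection \<open>Orthogonal projections and adjoints\<close>

definition csubspace :: "'h::complex_hilbert set \<Rightarrow> bool"
  where "csubspace V \<longleftrightarrow> subspace V \<and> (\<forall>c. \<forall>x\<in>V. c *\<^sub>C x \<in> V)"

lemma parallelogram:
  "(norm (x + y))\<^sup>2 + (norm (x - y))\<^sup>2 = 2 * (norm x)\<^sup>2 + 2 * (norm (y::'h::complex_hilbert))\<^sup>2"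
  unfolding Re_cinner_self[symmetric] by (simp add: cinner_simps)

lemma exists_nearest_point:
  fixes V :: "'h::complex_hilbert set"
  assumes "subspace V" "closed V"
  shows "\<exists>v\<in>V. \<forall>w\<in>V. (norm (x - v))\<^sup>2 \<le> (norm (x - w))\<^sup>2"
proof -
  define d where "d = (INF v\<in>V. (norm (x - v))\<^sup>2)"
  have bdd: "bdd_below ((\<lambda>v. (norm (x - v))\<^sup>2) ` V)"
    by (rule bdd_belowI[of _ 0]) auto
  have ne: "V \<noteq> {}" using subspace_0[OF assms(1)] by auto
  have d_le: "d \<le> (norm (x - v))\<^sup>2" if "v \<in> V" for v
    unfolding d_def by (rule cINF_lower[OF bdd that])
  have "\<exists>v\<in>V. (norm (x - v))\<^sup>2 < d + 1 / real (Suc n)" for n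
    using cINF_less_iff[OF ne bdd, of "d + 1 / real (Suc n)"] by (simp add: d_def)
  then obtain v where v: "\<And>n. v n \<in> V" "\<And>n. (norm (x - v n))\<^sup>2 < d + 1 / real (Suc n)"
    by metis
  have est: "(norm (v m - v n))\<^sup>2 \<le> 2 / real (Suc m) + 2 / real (Suc n)" for m n
  proof -
    \<comment> \<open>The midpoint is again in \<open>V\<close>, so its squared distance to
      \<open>x\<close> is at least \<open>d\<close>; the parallelogram law then bounds the gap
      between two nearly optimal points.\<close>
    let ?h = "(1/2) *\<^sub>R (v m + v n)"
    have "?h \<in> V"
      using v(1) assms(1) by (simp add: subspace_add subspace_scale)
    then have "4 * d \<le> 4 * (norm (x - ?h))\<^sup>2"
      using d_le by simp
    also have "\<dots> = (norm (2 *\<^sub>R (x - ?h)))\<^sup>2"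
      by (simp add: power_mult_distrib)
    also have "2 *\<^sub>R (x - ?h) = (x - v n) + (x - v m)"
      by (simp add: algebra_simps scaleR_2)
    finally have "4 * d \<le> (norm ((x - v n) + (x - v m)))\<^sup>2" .
    moreover have "(norm ((x - v n) + (x - v m)))\<^sup>2 + (norm (v m - v n))\<^sup>2 =
        2 * (norm (x - v n))\<^sup>2 + 2 * (norm (x - v m))\<^sup>2"
      using parallelogram[of "x - v n" "x - v m"] by simp
    ultimately show ?thesis
      using v(2)[of m] v(2)[of n] by simp
  qed
  have "Cauchy v"
  proof (rule metric_CauchyI)
    fix e :: real assume e: "0 < e"
    obtain N where N: "4 / e\<^sup>2 < real N" using reals_Archimedean2 by blast
    have "norm (v m - v n) < e" if "m \<ge> N" "n \<ge> N" for m n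
    proof -
      have N0: "0 < real N"
        using N e by (smt (verit) divide_nonneg_nonneg zero_le_power2)
      have "2 / real (Suc k) < 2 / real N" if "k \<ge> N" for k
        using that N0 by (intro divide_strict_left_mono) auto
      then have "(norm (v m - v n))\<^sup>2 < 2 / real N + 2 / real N"
        using est[of m n] that by (smt (verit))
      also have "\<dots> = 4 / real N" by simp
      also have "\<dots> < e\<^sup>2" using N N0 e by (simp add: field_simps)
      finally show ?thesis using e by (simp add: power_less_imp_less_base)
    qed
    then show "\<exists>M. \<forall>m\<ge>M. \<forall>n\<ge>M. dist (v m) (v n) < e"
      by (auto simp: dist_norm)
  qed
  then obtain l where l: "v \<longlonglongrightarrow> l"
    using Cauchy_convergent_iff convergent_def by blast
  have "l \<in> V" using closed_sequentially[OF assms(2)] v(1) l by blast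
  have "(\<lambda>n. (norm (x - v n))\<^sup>2) \<longlonglongrightarrow> (norm (x - l))\<^sup>2"
    by (intro tendsto_intros l)
  moreover have "(\<lambda>n. d + 1 / real (Suc n)) \<longlonglongrightarrow> d + 0"
    by (intro tendsto_intros LIMSEQ_Suc lim_1_over_n)
  ultimately have "(norm (x - l))\<^sup>2 \<le> d + 0"
    using v(2) by (intro LIMSEQ_le) (auto intro: less_imp_le)
  then show ?thesis
    using d_le \<open>l \<in> V\<close> by (intro bexI[of _ l] ballI) (simp_all add: order_trans[of _ d])
qed

lemma exists_orthogonal_decomposition:
  fixes V :: "'h::complex_hilbert set"
  assumes "csubspace V" "closed V"
  shows "\<exists>v\<in>V. \<forall>w\<in>V. cinner w (x - v) = 0"
proof -
  have V: "subspace V" "\<And>c y. y \<in> V \<Longrightarrow> c *\<^sub>C y \<in> V"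
    using assms(1) by (auto simp: csubspace_def)
  obtain v where v: "v \<in> V" "\<And>w. w \<in> V \<Longrightarrow> (norm (x - v))\<^sup>2 \<le> (norm (x - w))\<^sup>2"
    using exists_nearest_point[OF V(1) assms(2)] by blast
  have "cinner w (x - v) = 0" if w: "w \<in> V" for w
  proof (rule ccontr)
    define u c where "u = x - v" and "c = cinner w (x - v)"
    assume "cinner w (x - v) \<noteq> 0"
    then have c: "c \<noteq> 0" and w0: "w \<noteq> 0" by (auto simp: c_def)
    \<comment> \<open>Moving \<open>v\<close> by the component of \<open>u\<close> along
      \<open>w\<close> would lower the squared distance by \<open>s * (cmod c)\<^sup>2\<close>,
      contradicting minimality.\<close>
    define s where "s = 1 / (norm w)\<^sup>2"
    have s: "s > 0" "s * (norm w)\<^sup>2 = 1" using w0 by (auto simp: s_def)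
    let ?l = "complex_of_real s * c"
    have uc: "cinner w u = c" "cinner u w = cnj c"
      by (simp_all add: u_def c_def) (metis cinner_commute)
    have "v + ?l *\<^sub>C w \<in> V" using V w v(1) by (simp add: subspace_add)
    from v(2)[OF this] have "(norm u)\<^sup>2 \<le> (norm (u - ?l *\<^sub>C w))\<^sup>2"
      by (simp add: u_def algebra_simps)
    also have "\<dots> = Re (cinner u u - ?l * cnj c - cnj ?l * c + cnj ?l * ?l * cinner w w)"
      unfolding Re_cinner_self[symmetric] by (simp add: cinner_simps uc algebra_simps)
    also have "\<dots> = (norm u)\<^sup>2 - 2 * s * (cmod c)\<^sup>2 + s * (cmod c)\<^sup>2 * (s * (norm w)\<^sup>2)"
      unfolding cmod_power2 cinner_self_eq by (simp add: power2_eq_square algebra_simps)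
    finally have "s * (cmod c)\<^sup>2 \<le> 0"
      by (simp add: s(2))
    then show False using s(1) c by (simp add: mult_le_0_iff)
  qed
  then show ?thesis using v(1) by blast
qed

lemma exists_projection:
  fixes V :: "'h::complex_hilbert set"
  assumes cV: "csubspace V" and "closed V"
  shows "\<exists>p. proj_op p \<and> (\<forall>x. blinfun_apply p x \<in> V) \<and> (\<forall>x\<in>V. blinfun_apply p x = x)"
proof -
  have V: "subspace V" "\<And>c y. y \<in> V \<Longrightarrow> c *\<^sub>C y \<in> V"
    using cV by (auto simp: csubspace_def)
  obtain P where P: "\<And>x. P x \<in> V" "\<And>x w. w \<in> V \<Longrightarrow> cinner w (x - P x) = 0"
    using exists_orthogonal_decomposition[OF assms] by metis
  \<comment> \<open>Orthogonality of the residual determines the value, so linearity and the fixed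
    points of \<open>P\<close> can be read off from uniqueness.\<close>
  have uniq: "P x = v" if "v \<in> V" "\<And>w. w \<in> V \<Longrightarrow> cinner w (x - v) = 0" for x v
  proof -
    have "P x - v \<in> V" using P(1) that(1) V(1) by (simp add: subspace_diff)
    then have "cinner (P x - v) (x - v) - cinner (P x - v) (x - P x) = 0"
      using P(2) that(2) by simp
    then have "cinner (P x - v) (P x - v) = 0" unfolding cinner_diff_right[symmetric] by simp
    then show ?thesis by (metis cinner_eq_zero_iff right_minus_eq)
  qed
  have add: "P (x + y) = P x + P y" for x y
    by (rule uniq)
      (use P V(1) in \<open>simp_all add: subspace_add add_diff_add cinner_add_right\<close>)
  have scale: "P (c *\<^sub>C x) = c *\<^sub>C P x" for c x
    by (rule uniq)
      (use P V(2) in \<open>simp_all add: cinner_scaleC_right flip: scaleC_diff_right\<close>)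
  have "norm (P x) \<le> norm x * 1" for x
  proof -
    have "cinner (P x) (x - P x) = 0" using P by simp
    then have "(norm x)\<^sup>2 = (norm (P x))\<^sup>2 + (norm (x - P x))\<^sup>2"
    proof -
      have "(norm x)\<^sup>2 = Re (cinner (P x + (x - P x)) (P x + (x - P x)))"
        by (simp add: Re_cinner_self)
      also have "\<dots> = (norm (P x))\<^sup>2 + Re (cinner (P x) (x - P x)) + Re (cinner (x - P x) (P x))
          + (norm (x - P x))\<^sup>2"
        by (simp only: cinner_add_left cinner_add_right Re_cinner_self plus_complex.sel)
      also have "cinner (x - P x) (P x) = cnj (cinner (P x) (x - P x))"
        by (rule cinner_commute)
      finally show ?thesis using \<open>cinner (P x) (x - P x) = 0\<close> by simp
    qed
    then show ?thesis by (simp add: power2_le_imp_le)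
  qed
  then have bl: "bounded_linear P"
    using add scale by (intro bounded_linear_intro[where K = 1]) (auto simp: scaleR_eq_scaleC)
  define p where "p = Blinfun P"
  have p: "blinfun_apply p x = P x" for x
    by (simp add: p_def bounded_linear_Blinfun_apply[OF bl])
  have id: "P x = x" if "x \<in> V" for x by (rule uniq) (use that in auto)
  have "cinner (P x) y = cinner (P x) (P y)" for x y
    using P(2)[of "P x" y] P(1)[of x] by (simp add: cinner_diff_right)
  then have "cinner (P x) y = cinner x (P y)" for x y
    by (metis cinner_commute)
  then have "proj_op p"
    using P(1) id by (auto simp: proj_op_def selfadj_op_def bounded_ops_def p scale intro!: blinfun_eqI)
  then show ?thesis using P(1) id p by auto
qed

section \<open>Riesz representation and existence of adjoints\<close>

lemma Riesz_representation:
  fixes f :: "'h::complex_hilbert \<Rightarrow> complex"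
  assumes "bounded_linear f" and sc: "\<And>c x. f (c *\<^sub>C x) = c * f x"
  shows "\<exists>z. \<forall>x. f x = cinner z x"
proof (cases "\<forall>x. f x = 0")
  case True
  then show ?thesis by (intro exI[of _ 0]) simp
next
  case False
  interpret f: bounded_linear f by fact
  obtain u where u: "f u \<noteq> 0" using False by auto
  define V where "V = {x. f x = 0}"
  have "csubspace V"
    by (auto simp: V_def csubspace_def subspace_def f.zero f.add f.scaleR sc)
  moreover have "closed V"
    unfolding V_def by (intro closed_Collect_eq continuous_intros f.continuous_on)
  ultimately obtain v where v: "v \<in> V" "\<And>w. w \<in> V \<Longrightarrow> cinner w (u - v) = 0"
    using exists_orthogonal_decomposition by blast
  define w where "w = u - v"
  have fw: "f w \<noteq> 0" using u v(1) by (simp add: w_def V_def f.diff)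
  then have w0: "cinner w w \<noteq> 0" using f.zero by auto
  have "f x = cinner ((cnj (f w) / cinner w w) *\<^sub>C w) x" for x
  proof -
    \<comment> \<open>This combination is in the kernel by design; \<open>w\<close> is orthogonal to
      the kernel, and pairing the two solves for \<open>f x\<close>.\<close>
    have "f w *\<^sub>C x - f x *\<^sub>C w \<in> V" by (simp add: V_def f.diff sc)
    then have "cinner (f w *\<^sub>C x - f x *\<^sub>C w) w = 0" using v(2) by (simp add: w_def)
    then have "cinner w (f w *\<^sub>C x - f x *\<^sub>C w) = 0" by (metis cinner_commute complex_cnj_zero)
    then have "f w * cinner w x = f x * cinner w w" by (simp add: cinner_simps)
    then show ?thesis
      using w0 by (simp add: cinner_simps cinner_self_eq field_simps)
  qed
  then show ?thesis by blast
qed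

lemma exists_adjoint:
  fixes T :: "'h::complex_hilbert \<Rightarrow>\<^sub>L 'h"
  assumes T: "T \<in> bounded_ops"
  shows "\<exists>S\<in>bounded_ops. \<forall>x y. cinner (blinfun_apply S x) y = cinner x (blinfun_apply T y)"
proof -
  have "\<exists>z. \<forall>y. cinner x (T y) = cinner z y" for x
  proof (rule Riesz_representation)
    show "bounded_linear (\<lambda>y. cinner x (T y))"
      by (rule bounded_linear_compose[OF bounded_bilinear.bounded_linear_right
            [OF bounded_bilinear_cinner] blinfun.bounded_linear_right])
  qed (simp add: bounded_opsD[OF T] cinner_simps)
  then obtain S where S: "\<And>x y. cinner x (T y) = cinner (S x) y" by metis
  have ext: "u = v" if "\<And>y. cinner u y = cinner v y" for u v :: 'h
    using that by (metis cinner_commute cinner_ext)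
  have add: "S (x + y) = S x + S y" for x y
    by (rule ext) (simp add: cinner_simps flip: S)
  have scale: "S (c *\<^sub>C x) = c *\<^sub>C S x" for c x
    by (rule ext) (simp add: cinner_simps flip: S)
  have "norm (S x) \<le> norm x * norm T" for x
  proof (cases "S x = 0")
    case False
    have "norm (S x) * norm (S x) = cmod (cinner (S x) (S x))"
      by (simp add: cinner_self_eq power2_eq_square norm_mult)
    also have "\<dots> \<le> norm x * norm (T (S x))"
      unfolding S[symmetric] by (rule cinner_Cauchy_Schwarz)
    also have "\<dots> \<le> norm x * (norm T * norm (S x))"
      by (intro mult_left_mono norm_blinfun) simp
    finally show ?thesis using False by simp
  qed simp
  then have bl: "bounded_linear S"
    using add scale by (intro bounded_linear_intro[where K = "norm T"]) (auto simp: scaleR_eq_scaleC)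
  show ?thesis
    by (intro bexI[of _ "Blinfun S"])
      (simp_all add: bounded_linear_Blinfun_apply[OF bl] S bounded_ops_def scale)
qed

text \<open>Since \<open>adj_op\<close> is a definite description, adjoints are computed by
  exhibiting a candidate.\<close>

lemma adj_op_eqI:
  assumes "S \<in> bounded_ops"
    and "\<And>x y. cinner (blinfun_apply S x) y = cinner x (blinfun_apply T y)"
  shows "adj_op T = S"
  unfolding adj_op_def
proof (rule the_equality)
  fix S' assume S': "S' \<in> bounded_ops \<and> (\<forall>x y. cinner (S' x) y = cinner x (T y))"
  show "S' = S"
  proof (rule blinfun_eqI, rule cinner_ext)
    fix z x
    have "cinner (S' x) z = cinner (S x) z" using S' assms by simp
    then show "cinner z (S' x) = cinner z (S x)" by (metis cinner_commute)
  qed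
qed (use assms in simp)

lemma adj_op_props:
  assumes "T \<in> bounded_ops"
  shows adj_op_bounded: "adj_op T \<in> bounded_ops"
    and cinner_adj_left: "cinner (blinfun_apply (adj_op T) x) y = cinner x (blinfun_apply T y)"
    and cinner_adj_right: "cinner x (blinfun_apply (adj_op T) y) = cinner (blinfun_apply T x) y"
proof -
  obtain S where S: "S \<in> bounded_ops" "\<And>x y. cinner (S x) y = cinner x (T y)"
    using exists_adjoint[OF assms] by blast
  have eq: "adj_op T = S" by (rule adj_op_eqI) (use S in auto)
  show "adj_op T \<in> bounded_ops" "cinner (adj_op T x) y = cinner x (T y)"
    using S by (simp_all add: eq)
  show "cinner x (adj_op T y) = cinner (T x) y"
    unfolding eq by (metis S(2) cinner_commute)
qed

lemma adj_op_compose: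
  "S \<in> bounded_ops \<Longrightarrow> T \<in> bounded_ops \<Longrightarrow> adj_op (S o\<^sub>L T) = adj_op T o\<^sub>L adj_op S"
  by (rule adj_op_eqI) (simp_all add: bounded_ops_compose adj_op_props)

lemma adj_op_adj_op: "T \<in> bounded_ops \<Longrightarrow> adj_op (adj_op T) = T"
  by (rule adj_op_eqI) (simp_all add: adj_op_props)

lemma selfadj_iff_adj: "selfadj_op T \<longleftrightarrow> T \<in> bounded_ops \<and> adj_op T = T"
  by (metis adj_op_eqI cinner_adj_left selfadj_op_def)

lemma selfadj_compose:
  assumes "selfadj_op S" "selfadj_op T" "S o\<^sub>L T = T o\<^sub>L S"
  shows "selfadj_op (S o\<^sub>L T)"
  using assms by (simp add: selfadj_iff_adj bounded_ops_compose adj_op_compose)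

lemma pos_adj_compose:
  assumes "T \<in> bounded_ops"
  shows "pos_op (adj_op T o\<^sub>L T)"
  using assms
  by (simp add: pos_op_def bounded_ops_compose adj_op_props cinner_self_eq)

lemma pos_sandwich:
  assumes "pos_op P" "T \<in> bounded_ops"
  shows "pos_op (adj_op T o\<^sub>L P o\<^sub>L T)"
  using assms by (auto simp: pos_op_def bounded_ops_compose adj_op_props)


subsection \<open>Projections\<close>

lemma proj_selfadj: "proj_op p \<Longrightarrow> selfadj_op p"
  and proj_idem: "proj_op p \<Longrightarrow> p o\<^sub>L p = p"
  and proj_bounded: "proj_op p \<Longrightarrow> p \<in> bounded_ops"
  by (simp_all add: proj_op_def selfadj_op_def)

lemma proj_apply_idem [simp]:
  "proj_op p \<Longrightarrow> blinfun_apply p (blinfun_apply p x) = blinfun_apply p x"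
  by (metis blinfun_apply_blinfun_compose proj_idem)

lemma proj_qform: "proj_op p \<Longrightarrow> qform p x = (norm (blinfun_apply p x))\<^sup>2"
  unfolding qform_def Re_cinner_self[symmetric]
  by (metis proj_apply_idem proj_selfadj selfadjD)

lemma proj_pos: "proj_op p \<Longrightarrow> pos_op p"
  by (simp add: pos_op_iff proj_selfadj proj_qform)

lemma proj_zero [simp]: "proj_op 0" and proj_id [simp]: "proj_op id_blinfun"
  by (auto simp: proj_op_def intro!: blinfun_eqI)

lemma proj_compl: "proj_op p \<Longrightarrow> proj_op (id_blinfun - p)"
  by (auto simp: proj_op_def selfadj_diff blinfun.bilinear_simps
      intro!: blinfun_eqI)

lemma proj_compose:
  assumes "proj_op p" "proj_op q" and c: "p o\<^sub>L q = q o\<^sub>L p"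
  shows "proj_op (p o\<^sub>L q)"
  unfolding proj_op_def
proof
  show "selfadj_op (p o\<^sub>L q)" using assms by (simp add: selfadj_compose proj_selfadj)
  have c': "p (q x) = q (p x)" for x using c by (metis blinfun_apply_blinfun_compose)
  show "(p o\<^sub>L q) o\<^sub>L (p o\<^sub>L q) = p o\<^sub>L q"
    using assms by (intro blinfun_eqI) (simp add: c')
qed

lemma blinfun_compose_assoc: "(R o\<^sub>L S) o\<^sub>L T = R o\<^sub>L (S o\<^sub>L T)"
  by (rule blinfun_eqI) simp

subsection \<open>Commutants and von Neumann algebras\<close>

lemma commutant_bounded: "commutant S \<subseteq> bounded_ops"
  by (auto simp: commutant_def)

lemma commutantD:
  "T \<in> commutant S \<Longrightarrow> s \<in> S \<Longrightarrow> blinfun_apply T (blinfun_apply s x) = blinfun_apply s (blinfun_apply T x)"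
  unfolding commutant_def by (metis (mono_tags, lifting) blinfun_apply_blinfun_compose mem_Collect_eq)

lemma commutantI:
  assumes "T \<in> bounded_ops"
    and "\<And>s x. s \<in> S \<Longrightarrow> blinfun_apply T (blinfun_apply s x) = blinfun_apply s (blinfun_apply T x)"
  shows "T \<in> commutant S"
  using assms by (auto simp: commutant_def intro!: blinfun_eqI)

lemma commutant_antimono: "S \<subseteq> S' \<Longrightarrow> commutant S' \<subseteq> commutant S"
  by (auto simp: commutant_def)

lemma subset_bicommutant: "S \<subseteq> bounded_ops \<Longrightarrow> S \<subseteq> commutant (commutant S)"
  by (auto simp: commutant_def)

lemma commutant_bicommutant:
  "S \<subseteq> bounded_ops \<Longrightarrow> commutant (commutant (commutant S)) = commutant S"
  by (simp add: commutant_antimono commutant_bounded subset_antisym subset_bicommutant)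

lemma commutant_adj:
  assumes S: "S \<subseteq> bounded_ops" "\<And>s. s \<in> S \<Longrightarrow> adj_op s \<in> S" and T: "T \<in> commutant S"
  shows "adj_op T \<in> commutant S"
proof -
  have TB: "T \<in> bounded_ops" using T commutant_bounded by auto
  have "adj_op T o\<^sub>L s = s o\<^sub>L adj_op T" if s: "s \<in> S" for s
  proof -
    have "T o\<^sub>L adj_op s = adj_op s o\<^sub>L T"
      using T S(2)[OF s] by (simp add: commutant_def)
    then have "adj_op (T o\<^sub>L adj_op s) = adj_op (adj_op s o\<^sub>L T)" by simp
    then show ?thesis
      using s S(1) TB by (auto simp: adj_op_compose adj_op_bounded adj_op_adj_op subset_iff)
  qed
  then show ?thesis by (simp add: commutant_def adj_op_bounded[OF TB])
qed

lemma closed_bounded_ops: "closed (bounded_ops :: ('h::complex_hilbert \<Rightarrow>\<^sub>L 'h) set)"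
proof -
  have "closed {T :: 'h \<Rightarrow>\<^sub>L 'h. T (c *\<^sub>C x) = c *\<^sub>C T x}" for c x
    by (intro closed_Collect_eq continuous_intros
        bounded_linear.continuous_on[OF bounded_linear_scaleC])
  then show ?thesis
    unfolding bounded_ops_def by (intro closed_Collect_all)
qed

lemma von_neumann_bicommutant:
  assumes S: "S \<subseteq> bounded_ops" "\<And>s. s \<in> S \<Longrightarrow> adj_op s \<in> S"
  shows "von_neumann_algebra (commutant (commutant S))"
  unfolding von_neumann_algebra_def
  using commutant_adj[OF commutant_bounded commutant_adj[OF S]]
  by (simp add: commutant_bounded commutant_bicommutant)

context
  fixes A :: "('h::complex_hilbert \<Rightarrow>\<^sub>L 'h) set"
  assumes vn: "von_neumann_algebra A"
begin

lemma vn_bounded: "a \<in> A \<Longrightarrow> a \<in> bounded_ops"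
  and vn_adj: "a \<in> A \<Longrightarrow> adj_op a \<in> A"
  and vn_bicommutant: "commutant (commutant A) = A"
  using vn by (auto simp: von_neumann_algebra_def)

lemma vn_memI:
  assumes "T \<in> bounded_ops"
    and "\<And>s x. s \<in> commutant A \<Longrightarrow> blinfun_apply T (blinfun_apply s x) = blinfun_apply s (blinfun_apply T x)"
  shows "T \<in> A"
  using commutantI[of T "commutant A"] assms by (simp add: vn_bicommutant)

lemma vn_commute:
  assumes "a \<in> A" "s \<in> commutant A"
  shows "blinfun_apply s (blinfun_apply a x) = blinfun_apply a (blinfun_apply s x)"
  using commutantD[OF assms(2,1)] .

lemma vn_zero: "0 \<in> A" and vn_id: "id_blinfun \<in> A"
  by (auto intro!: vn_memI simp: blinfun.bilinear_simps)

lemma vn_scaleR: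
  assumes a: "a \<in> A"
  shows "r *\<^sub>R a \<in> A"
  by (rule vn_memI)
    (simp_all add: bounded_ops_scaleR vn_bounded a vn_commute[OF a] blinfun.bilinear_simps)

lemma vn_scale:
  assumes a: "a \<in> A"
  shows "scale_op c a \<in> A"
proof (rule vn_memI)
  fix s x assume s: "s \<in> commutant A"
  then have "s \<in> bounded_ops" using commutant_bounded by auto
  then show "scale_op c a (s x) = s (scale_op c a x)"
    by (simp add: bounded_opsD vn_commute[OF a s])
qed (simp add: bounded_ops_scale vn_bounded a)

lemma
  assumes a: "a \<in> A" and b: "b \<in> A"
  shows vn_add: "a + b \<in> A" and vn_diff: "a - b \<in> A" and vn_compose: "a o\<^sub>L b \<in> A"
  by (rule vn_memI; simp add: bounded_ops_intros vn_bounded a b vn_commute[OF a] vn_commute[OF b]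
      blinfun.bilinear_simps)+

lemma vn_commutant_adj: "s \<in> commutant A \<Longrightarrow> adj_op s \<in> commutant A"
  by (rule commutant_adj) (auto simp: vn_bounded vn_adj)

text \<open>Invariance of the range gives \<open>p s p = s p\<close>. The commutant is closed under
  adjoints, so the same holds for \<open>adj_op s\<close>, and taking adjoints yields
  \<open>p s p = p s\<close>. Hence a closed subspace that is invariant under the commutant gives a
  projection in \<open>A\<close>.\<close>

lemma vn_proj_memI:
  assumes p: "proj_op p"
    and inv: "\<And>s x. s \<in> commutant A \<Longrightarrow> blinfun_apply p x = x \<Longrightarrow> blinfun_apply p (blinfun_apply s x) = blinfun_apply s x"
  shows "p \<in> A"
proof (rule vn_memI[OF proj_bounded[OF p]])
  fix s x assume s: "s \<in> commutant A"
  have pB: "p \<in> bounded_ops" and ap: "adj_op p = p"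
    using p by (simp_all add: proj_bounded proj_selfadj flip: selfadj_iff_adj)
      (metis proj_selfadj selfadj_iff_adj)
  have psp: "p o\<^sub>L r o\<^sub>L p = r o\<^sub>L p" if "r \<in> commutant A" for r
    using p inv[OF that] by (intro blinfun_eqI) simp
  have sB: "s \<in> bounded_ops" using s commutant_bounded by auto
  have "adj_op (p o\<^sub>L adj_op s o\<^sub>L p) = adj_op (adj_op s o\<^sub>L p)"
    using psp[OF vn_commutant_adj[OF s]] by simp
  then have "p o\<^sub>L s o\<^sub>L p = p o\<^sub>L s"
    using pB sB by (simp add: adj_op_compose bounded_ops_compose adj_op_bounded adj_op_adj_op ap
        blinfun_compose_assoc)
  then have "p o\<^sub>L s = s o\<^sub>L p" using psp[OF s] by simp
  then show "p (s x) = s (p x)" by (metis blinfun_apply_blinfun_compose)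
qed

end

subsection \<open>Square roots of positive operators\<close>

text \<open>A fixed point \<open>Y\<close> satisfies \<open>(1 - Y)\<^sup>2 = 1 - b\<close>, so for
  \<open>b = 1 - c\<close> the limit yields the square root \<open>1 - Y\<close> of
  \<open>c\<close>.\<close>

primrec sqrt_iter :: "('h::complex_hilbert \<Rightarrow>\<^sub>L 'h) \<Rightarrow> nat \<Rightarrow> ('h \<Rightarrow>\<^sub>L 'h)"
  where "sqrt_iter b 0 = 0"
  | "sqrt_iter b (Suc n) = (1/2) *\<^sub>R (b + (sqrt_iter b n o\<^sub>L sqrt_iter b n))"

text \<open>The same iteration for the scalar 1; it dominates the increments of the operator iteration.\<close>

primrec sqrt_majorant :: "nat \<Rightarrow> real"
  where "sqrt_majorant 0 = 0"
  | "sqrt_majorant (Suc n) = (1 + (sqrt_majorant n)\<^sup>2) / 2"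

lemma sqrt_majorant_bounds: "0 \<le> sqrt_majorant n" "sqrt_majorant n \<le> 1"
proof -
  have "0 \<le> sqrt_majorant n \<and> sqrt_majorant n \<le> 1"
  proof (induction n)
    case (Suc n)
    then have "(sqrt_majorant n)\<^sup>2 \<le> 1\<^sup>2" by (intro power_mono) auto
    then show ?case by (simp add: add_nonneg_nonneg)
  qed simp
  then show "0 \<le> sqrt_majorant n" "sqrt_majorant n \<le> 1" by auto
qed

lemma sqrt_majorant_convergent: "convergent sqrt_majorant"
proof (rule Bseq_mono_convergent)
  show "Bseq sqrt_majorant"
    by (rule BseqI[of 1]) (use sqrt_majorant_bounds in auto)
  have "sqrt_majorant n \<le> sqrt_majorant (Suc n)" for n
  proof -
    have "0 \<le> (1 - sqrt_majorant n)\<^sup>2" by simp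
    then show ?thesis by (simp add: power2_eq_square algebra_simps)
  qed
  then show "\<forall>m n. m \<le> n \<longrightarrow> sqrt_majorant m \<le> sqrt_majorant n"
    by (simp add: lift_Suc_mono_le)
qed

lemma compose_left_diff: "(R - S) o\<^sub>L T = (R o\<^sub>L T) - (S o\<^sub>L T)"
  and compose_right_diff: "R o\<^sub>L (S' - T') = (R o\<^sub>L S') - (R o\<^sub>L T')"
  and compose_left_add: "(R + S) o\<^sub>L T = (R o\<^sub>L T) + (S o\<^sub>L T)"
  and compose_right_add: "R o\<^sub>L (S' + T') = (R o\<^sub>L S') + (R o\<^sub>L T')"
  and compose_left_scaleR: "(r *\<^sub>R R) o\<^sub>L T = r *\<^sub>R (R o\<^sub>L T)"
  and compose_right_scaleR: "R o\<^sub>L (r *\<^sub>R T) = r *\<^sub>R (R o\<^sub>L T)"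
  by (rule blinfun_eqI; simp add: blinfun.bilinear_simps)+

lemmas compose_simps = compose_left_diff compose_right_diff compose_left_add compose_right_add
  compose_left_scaleR compose_right_scaleR

lemma sqrt_iter_commute:
  assumes "T o\<^sub>L b = b o\<^sub>L T"
  shows "T o\<^sub>L sqrt_iter b n = sqrt_iter b n o\<^sub>L T"
proof (induction n)
  case (Suc n)
  then have "T o\<^sub>L (sqrt_iter b n o\<^sub>L sqrt_iter b n) = (sqrt_iter b n o\<^sub>L sqrt_iter b n) o\<^sub>L T"
    by (metis blinfun_compose_assoc)
  then show ?case using assms by (simp add: compose_simps)
qed (auto intro!: blinfun_eqI)

lemma sqrt_iter_selfadj:
  assumes "selfadj_op b"
  shows "selfadj_op (sqrt_iter b n)"
proof (induction n)
  case (Suc n)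
  then show ?case using assms by (simp add: selfadj_scaleR selfadj_add selfadj_compose)
qed simp

lemma sqrt_iter_norm:
  assumes "norm b \<le> 1"
  shows "norm (sqrt_iter b n) \<le> sqrt_majorant n"
proof (induction n)
  case (Suc n)
  have "norm (sqrt_iter b n o\<^sub>L sqrt_iter b n) \<le> norm (sqrt_iter b n) * norm (sqrt_iter b n)"
    by (rule norm_blinfun_compose)
  also have "\<dots> \<le> (sqrt_majorant n)\<^sup>2"
    unfolding power2_eq_square by (intro mult_mono Suc sqrt_majorant_bounds) auto
  finally show ?case
    using assms norm_triangle_ineq[of b "sqrt_iter b n o\<^sub>L sqrt_iter b n"] by simp
qed simp

text \<open>The iterates commute, so each increment is half the product of the sum and the
  difference of the two preceding iterates. The scalar sequence obeys the same identity exactly, and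
  the estimate propagates by induction.\<close>

lemma sqrt_iter_norm_diff:
  assumes "norm b \<le> 1"
  shows "norm (sqrt_iter b (Suc n) - sqrt_iter b n) \<le> sqrt_majorant (Suc n) - sqrt_majorant n"
proof (induction n)
  case (Suc n)
  let ?Y = "sqrt_iter b" and ?r = sqrt_majorant
  have c: "?Y (Suc n) o\<^sub>L ?Y n = ?Y n o\<^sub>L ?Y (Suc n)"
    by (rule sqrt_iter_commute, rule sqrt_iter_commute[symmetric]) simp
  have "?Y (Suc (Suc n)) - ?Y (Suc n) =
      (1/2) *\<^sub>R ((?Y (Suc n) + ?Y n) o\<^sub>L (?Y (Suc n) - ?Y n))"
  proof -
    have "?Y (Suc (Suc n)) - ?Y (Suc n) =
        (1/2) *\<^sub>R ((?Y (Suc n) o\<^sub>L ?Y (Suc n)) - (?Y n o\<^sub>L ?Y n))"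
      unfolding sqrt_iter.simps(2)[of b "Suc n"]
      using sqrt_iter.simps(2)[of b n] by (metis add_diff_cancel_left scaleR_diff_right)
    then show ?thesis
      using c by (simp add: compose_simps del: sqrt_iter.simps)
  qed
  then have "norm (?Y (Suc (Suc n)) - ?Y (Suc n)) \<le>
      (norm (?Y (Suc n) + ?Y n) * norm (?Y (Suc n) - ?Y n)) / 2"
    by (simp add: norm_blinfun_compose del: sqrt_iter.simps)
  also have "\<dots> \<le> ((?r (Suc n) + ?r n) * (?r (Suc n) - ?r n)) / 2"
    using sqrt_majorant_bounds Suc
    by (intro divide_right_mono mult_mono norm_triangle_le add_mono sqrt_iter_norm assms)
      (auto simp del: sqrt_majorant.simps sqrt_iter.simps)
  also have "\<dots> = ?r (Suc (Suc n)) - ?r (Suc n)"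
  proof -
    have "?r (Suc (Suc n)) - ?r (Suc n) = (1 + (?r (Suc n))\<^sup>2) / 2 - (1 + (?r n)\<^sup>2) / 2"
      using sqrt_majorant.simps(2)[of "Suc n"] sqrt_majorant.simps(2)[of n] by metis
    also have "\<dots> = ((?r (Suc n) + ?r n) * (?r (Suc n) - ?r n)) / 2"
      by (simp add: power2_eq_square field_simps del: sqrt_majorant.simps)
    finally show ?thesis by simp
  qed
  finally show ?case .
qed (use assms in simp)

text \<open>Telescoping bounds distances between iterates by distances in the convergent scalar
  sequence; its limit never has to be computed.\<close>

lemma sqrt_iter_convergent:
  assumes "norm b \<le> 1"
  shows "convergent (sqrt_iter b)"
proof -
  have le: "norm (sqrt_iter b (n + k) - sqrt_iter b n) \<le> sqrt_majorant (n + k) - sqrt_majorant n" for n k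
  proof (induction k)
    case (Suc k)
    have "norm (sqrt_iter b (n + Suc k) - sqrt_iter b n) \<le>
        norm (sqrt_iter b (Suc (n + k)) - sqrt_iter b (n + k)) + norm (sqrt_iter b (n + k) - sqrt_iter b n)"
      using norm_triangle_ineq[of "sqrt_iter b (Suc (n + k)) - sqrt_iter b (n + k)"
          "sqrt_iter b (n + k) - sqrt_iter b n"]
      by (simp del: sqrt_iter.simps)
    then show ?case using Suc sqrt_iter_norm_diff[OF assms, of "n + k"]
      by (simp del: sqrt_iter.simps sqrt_majorant.simps)
  qed simp
  have "Cauchy sqrt_majorant"
    using sqrt_majorant_convergent by (simp add: Cauchy_convergent_iff)
  have "Cauchy (sqrt_iter b)"
    unfolding Cauchy_altdef2
  proof (intro allI impI)
    fix e :: real assume "0 < e"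
    then obtain N where N: "\<And>n. n \<ge> N \<Longrightarrow> \<bar>sqrt_majorant n - sqrt_majorant N\<bar> < e"
      using \<open>Cauchy sqrt_majorant\<close> unfolding Cauchy_altdef2 dist_real_def by blast
    have "dist (sqrt_iter b n) (sqrt_iter b N) < e" if "n \<ge> N" for n
      using le[of N "n - N"] N[OF that] that by (simp add: dist_norm)
    then show "\<exists>N. \<forall>n\<ge>N. dist (sqrt_iter b n) (sqrt_iter b N) < e" by blast
  qed
  then show ?thesis by (simp add: Cauchy_convergent_iff)
qed

lemma closed_selfadj: "closed {T :: 'h::complex_hilbert \<Rightarrow>\<^sub>L 'h. selfadj_op T}"
proof -
  have "{T :: 'h \<Rightarrow>\<^sub>L 'h. selfadj_op T} =
      bounded_ops \<inter> (\<Inter>x. \<Inter>y. {T. cinner (blinfun_apply T x) y = cinner x (blinfun_apply T y)})"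
    by (auto simp: selfadj_op_def)
  moreover have "closed {T. cinner (blinfun_apply T x) y = cinner x (blinfun_apply T y)}" for x y :: 'h
    by (intro closed_Collect_eq continuous_on_cinner continuous_intros)
  ultimately show ?thesis
    by (simp add: closed_bounded_ops closed_INT closed_Int)
qed

text \<open>The bounds \<open>0 \<le> c \<le> 1\<close> give \<open>norm (1 - c) \<le> 1\<close>, as
  the iteration requires. Whatever commutes with \<open>c\<close> commutes with every iterate and
  hence with the limit; \<open>spectral_split\<close> needs this to see that its subspace is
  invariant under the commutant.\<close>

lemma exists_sqrt_contraction:
  assumes c: "pos_op c" and le: "\<And>x. qform c x \<le> (norm x)\<^sup>2"
  shows "\<exists>s. pos_op s \<and> s o\<^sub>L s = c \<and> (\<forall>T. T o\<^sub>L c = c o\<^sub>L T \<longrightarrow> T o\<^sub>L s = s o\<^sub>L T)"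
proof -
  define b where "b = id_blinfun - c"
  have id_comp [simp]: "T o\<^sub>L id_blinfun = T" "id_blinfun o\<^sub>L T = T" for T :: "'a \<Rightarrow>\<^sub>L 'a"
    by (auto intro!: blinfun_eqI)
  have b: "selfadj_op b" using c by (simp add: b_def selfadj_diff pos_selfadj)
  have nb: "norm b \<le> 1"
    using le pos_qform[OF c] by (intro selfadj_norm_le[OF b]) (simp_all add: b_def qform_diff abs_le_iff)
  obtain Y where Y: "sqrt_iter b \<longlonglongrightarrow> Y"
    using sqrt_iter_convergent[OF nb] by (auto simp: convergent_def)
  have saY: "selfadj_op Y"
    using closed_sequentially[OF closed_selfadj _ Y] sqrt_iter_selfadj[OF b] by simp
  have "(\<lambda>n. norm (sqrt_iter b n)) \<longlonglongrightarrow> norm Y" by (intro tendsto_norm Y)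
  then have nY: "norm Y \<le> 1"
    by (rule LIMSEQ_le_const2)
      (use sqrt_iter_norm[OF nb] sqrt_majorant_bounds(2) order_trans in blast)
  have comp_lim: "(\<lambda>n. F n o\<^sub>L G n) \<longlonglongrightarrow> (F' o\<^sub>L G')" if "F \<longlonglongrightarrow> F'" "G \<longlonglongrightarrow> G'"
    for F G :: "nat \<Rightarrow> 'a \<Rightarrow>\<^sub>L 'a" and F' G'
    by (rule bounded_bilinear.tendsto[OF bounded_bilinear_blinfun_compose that])
  have "(\<lambda>n. sqrt_iter b (Suc n)) \<longlonglongrightarrow> (1/2) *\<^sub>R (b + (Y o\<^sub>L Y))"
    unfolding sqrt_iter.simps by (intro tendsto_intros comp_lim Y)
  then have fixed_point: "Y = (1/2) *\<^sub>R (b + (Y o\<^sub>L Y))"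
    using LIMSEQ_Suc[OF Y] LIMSEQ_unique by blast
  define s where "s = id_blinfun - Y"
  have "pos_op s"
    unfolding s_def pos_op_iff using saY qform_le_norm[of Y] nY
    by (auto simp: selfadj_diff qform_diff abs_le_iff)
      (meson mult_left_le_one_le norm_ge_zero order_trans zero_le_power2)
  moreover have "s o\<^sub>L s = c"
  proof -
    have "Y o\<^sub>L Y = 2 *\<^sub>R Y - b"
      by (subst (3) fixed_point) simp
    then show ?thesis
      by (simp add: s_def compose_simps) (simp add: b_def scaleR_2)
  qed
  moreover have "T o\<^sub>L s = s o\<^sub>L T" if T: "T o\<^sub>L c = c o\<^sub>L T" for T
  proof -
    have "T o\<^sub>L b = b o\<^sub>L T" using T by (simp add: b_def compose_simps)
    then have "(\<lambda>n. T o\<^sub>L sqrt_iter b n) = (\<lambda>n. sqrt_iter b n o\<^sub>L T)"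
      using sqrt_iter_commute by blast
    moreover have "(\<lambda>n. T o\<^sub>L sqrt_iter b n) \<longlonglongrightarrow> (T o\<^sub>L Y)" "(\<lambda>n. sqrt_iter b n o\<^sub>L T) \<longlonglongrightarrow> (Y o\<^sub>L T)"
      by (intro comp_lim Y tendsto_const)+
    ultimately have "T o\<^sub>L Y = Y o\<^sub>L T" using LIMSEQ_unique by metis
    then show ?thesis by (simp add: s_def compose_simps)
  qed
  ultimately show ?thesis by blast
qed

lemma exists_sqrt:
  assumes c: "pos_op c"
  shows "\<exists>s. pos_op s \<and> s o\<^sub>L s = c \<and> (\<forall>T. T o\<^sub>L c = c o\<^sub>L T \<longrightarrow> T o\<^sub>L s = s o\<^sub>L T)"
proof -
  \<comment> \<open>The summand 1 keeps the scaling factor positive when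
    \<open>c = 0\<close>.\<close>
  define k where "k = norm c + 1"
  have k: "k > 0" by (simp add: k_def add_nonneg_pos)
  have "pos_op ((1/k) *\<^sub>R c)" using k c by (intro pos_scaleR) auto
  moreover have "qform ((1/k) *\<^sub>R c) x \<le> (norm x)\<^sup>2" for x
  proof -
    have "qform c x \<le> norm c * (norm x)\<^sup>2" using qform_le_norm[of c x] by simp
    also have "\<dots> \<le> k * (norm x)\<^sup>2" by (intro mult_right_mono) (auto simp: k_def)
    finally show ?thesis using k by (simp add: qform_scaleR field_simps)
  qed
  ultimately obtain s where s: "pos_op s" "s o\<^sub>L s = (1/k) *\<^sub>R c"
    "\<And>T. T o\<^sub>L ((1/k) *\<^sub>R c) = ((1/k) *\<^sub>R c) o\<^sub>L T \<Longrightarrow> T o\<^sub>L s = s o\<^sub>L T"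
    using exists_sqrt_contraction by blast
  show ?thesis
  proof (intro exI[of _ "sqrt k *\<^sub>R s"] conjI allI impI)
    show "pos_op (sqrt k *\<^sub>R s)" using s(1) k by (intro pos_scaleR) auto
    show "(sqrt k *\<^sub>R s) o\<^sub>L (sqrt k *\<^sub>R s) = c"
      using s(2) k by (simp add: compose_simps)
    fix T assume "T o\<^sub>L c = c o\<^sub>L T"
    then show "T o\<^sub>L (sqrt k *\<^sub>R s) = (sqrt k *\<^sub>R s) o\<^sub>L T"
      using s(3)[of T] by (simp add: compose_simps)
  qed
qed


subsection \<open>Spectral approximation by projections\<close>

lemma proj_commute_selfadj:
  assumes p: "proj_op p" and a: "selfadj_op a"
    and inv: "\<And>x. blinfun_apply p x = x \<Longrightarrow> blinfun_apply p (blinfun_apply a x) = blinfun_apply a x"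
  shows "p o\<^sub>L a = a o\<^sub>L p"
proof -
  have B: "p \<in> bounded_ops" "a \<in> bounded_ops" and adj: "adj_op p = p" "adj_op a = a"
    using proj_selfadj[OF p] a by (auto simp: selfadj_iff_adj)
  have pap: "p o\<^sub>L (a o\<^sub>L p) = a o\<^sub>L p"
    using p inv by (intro blinfun_eqI) simp
  then have "adj_op (p o\<^sub>L (a o\<^sub>L p)) = adj_op (a o\<^sub>L p)" by simp
  then have "(p o\<^sub>L a) o\<^sub>L p = p o\<^sub>L a"
    using B by (simp add: adj_op_compose bounded_ops_compose adj)
  then show ?thesis using pap by (simp add: blinfun_compose_assoc)
qed

lemma selfadj_shift_pos:
  assumes "selfadj_op a"
  shows "pos_op (norm a *\<^sub>R id_blinfun + a)" "pos_op (norm a *\<^sub>R id_blinfun - a)"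
  using assms qform_le_norm[of a]
  by (auto simp: pos_op_iff selfadj_add selfadj_diff selfadj_scaleR qform_add qform_diff
      qform_scaleR abs_le_iff) (metis add.commute diff_ge_0_iff_ge diff_minus_eq_add)

lemma scale_op_of_real: "scale_op (complex_of_real r) T = r *\<^sub>R T"
  by (rule blinfun_eqI) (simp add: blinfun.scaleR_left scaleR_eq_scaleC)

context
  fixes A :: "('h::complex_hilbert \<Rightarrow>\<^sub>L 'h) set"
  assumes vn: "von_neumann_algebra A"
begin

text \<open>The projection onto the kernel of \<open>\<bar>a\<bar> - a\<close> separates the positive from the negative part.\<close>

lemma spectral_split:
  assumes a: "a \<in> A" and sa: "selfadj_op a"
  shows "\<exists>p\<in>A. proj_op p \<and> p o\<^sub>L a = a o\<^sub>L p \<and>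
    (\<forall>x. blinfun_apply p x = x \<longrightarrow> 0 \<le> qform a x) \<and> (\<forall>x. blinfun_apply p x = 0 \<longrightarrow> qform a x \<le> 0)"
proof -
  have aB: "a \<in> bounded_ops" and "adj_op a = a" using sa by (auto simp: selfadj_iff_adj)
  then have "pos_op (a o\<^sub>L a)" using pos_adj_compose[of a] by simp
  then obtain s where s: "pos_op s" "s o\<^sub>L s = a o\<^sub>L a"
    and sc: "\<And>T. T o\<^sub>L (a o\<^sub>L a) = (a o\<^sub>L a) o\<^sub>L T \<Longrightarrow> T o\<^sub>L s = s o\<^sub>L T"
    using exists_sqrt by blast
  have sB: "s \<in> bounded_ops" using s(1) by (simp add: pos_op_def)
  have sa_comm: "s (a x) = a (s x)" for x
    using sc[of a] by (metis blinfun_apply_blinfun_compose blinfun_compose_assoc)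
  have ss: "s (s x) = a (a x)" for x using s(2) by (metis blinfun_apply_blinfun_compose)
  define V where "V = {x. s x = a x}"
  have cV: "csubspace V"
    using aB sB by (auto simp: V_def csubspace_def subspace_def blinfun.bilinear_simps bounded_opsD)
  have clV: "closed V"
    unfolding V_def by (intro closed_Collect_eq continuous_intros)
  obtain p where p: "proj_op p" "\<And>x. p x \<in> V" "\<And>x. x \<in> V \<Longrightarrow> p x = x"
    using exists_projection[OF cV clV] by blast
  have pV: "p x = x \<longleftrightarrow> x \<in> V" for x using p by metis
  have "p \<in> A"
  proof (rule vn_proj_memI[OF vn p(1)])
    fix t x assume t: "t \<in> commutant A" and x: "p x = x"
    have ta: "t (a y) = a (t y)" for y by (rule vn_commute[OF vn a t])
    have "t o\<^sub>L s = s o\<^sub>L t" by (rule sc) (auto intro!: blinfun_eqI simp: ta)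
    then have "s (t x) = t (s x)" by (metis blinfun_apply_blinfun_compose)
    then have "s (t x) = a (t x)" using x by (simp add: pV V_def ta)
    then show "p (t x) = t x" by (simp add: pV V_def)
  qed
  moreover have "p o\<^sub>L a = a o\<^sub>L p"
    by (rule proj_commute_selfadj[OF p(1) sa]) (simp add: pV V_def sa_comm)
  moreover have "0 \<le> qform a x" if "p x = x" for x
    using that pos_qform[OF s(1), of x] by (simp add: pV V_def qform_def)
  moreover have "qform a x \<le> 0" if x: "p x = 0" for x
  proof -
    \<comment> \<open>As \<open>s\<close> and \<open>a\<close> commute and have equal squares,
      \<open>(s - a) (s + a) = 0\<close>. The range of \<open>s + a\<close> thus lies in
      \<open>V\<close>, and \<open>s + a\<close> vanishes on the orthogonal complement.\<close>
    have "s x + a x = 0"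
    proof (rule cinner_ext)
      fix y
      have "s y + a y \<in> V" by (simp add: V_def blinfun.add_right ss sa_comm)
      then have "cinner (s y + a y) x = cinner (p (s y + a y)) x" by (simp add: p(3))
      also have "\<dots> = 0" using x by (simp add: selfadjD[OF proj_selfadj[OF p(1)]])
      finally show "cinner y (s x + a x) = cinner y 0"
        by (simp add: cinner_simps selfadjD[OF sa] selfadjD[OF pos_selfadj[OF s(1)]])
    qed
    then have "a x = - s x" by (simp add: eq_neg_iff_add_eq_0 add.commute)
    then have "qform a x = - qform s x" by (simp add: qform_def)
    then show ?thesis using pos_qform[OF s(1), of x] by simp
  qed
  ultimately show ?thesis using p(1) by blast
qed

text \<open>On the range of \<open>p\<close> the form of \<open>a\<close> lies between 0 and 1, on
  its complement between -1 and 0. The operator \<open>p - 1/2\<close> takes the midpoints 1/2 and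
  -1/2 of these intervals, so the error is at most 1/2.\<close>

lemma spectral_step:
  assumes a: "a \<in> A" and sa: "selfadj_op a" and na: "norm a \<le> 1"
  shows "\<exists>p\<in>A. proj_op p \<and> norm (a - (p - (1/2) *\<^sub>R id_blinfun)) \<le> 1/2"
proof -
  obtain p where pA: "p \<in> A" and p: "proj_op p" and comm: "p o\<^sub>L a = a o\<^sub>L p"
    and ge: "\<And>x. p x = x \<Longrightarrow> 0 \<le> qform a x" and le: "\<And>x. p x = 0 \<Longrightarrow> qform a x \<le> 0"
    using spectral_split[OF a sa] by blast
  have pa: "p (a x) = a (p x)" for x using comm by (metis blinfun_apply_blinfun_compose)
  have "norm (a - (p - (1/2) *\<^sub>R id_blinfun)) \<le> 1/2"
  proof (rule selfadj_norm_le)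
    show "selfadj_op (a - (p - (1/2) *\<^sub>R id_blinfun))"
      using sa p by (simp add: selfadj_diff selfadj_scaleR proj_selfadj)
    fix x
    define y z where "y = p x" and "z = x - p x"
    have x: "x = y + z" by (simp add: y_def z_def)
    have py: "p y = y" and pz: "p z = 0"
      using p by (simp_all add: y_def z_def blinfun.diff_right)
    have orth: "cinner u v = 0" "cinner v u = 0" if "p u = u" "p v = 0" for u v
    proof -
      show "cinner u v = 0" using selfadjD[OF proj_selfadj[OF p], of u v] that by simp
      then show "cinner v u = 0" by (metis cinner_commute complex_cnj_zero)
    qed
    have "qform a x = qform a y + qform a z"
      unfolding x qform_def using orth[of y "a z"] orth(2)[of "a y" z] py pz
      by (simp add: blinfun.add_right cinner_simps pa)
    moreover have nx: "(norm x)\<^sup>2 = (norm y)\<^sup>2 + (norm z)\<^sup>2"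
      unfolding x Re_cinner_self[symmetric] using orth[of y z] py pz by (simp add: cinner_simps)
    moreover have "qform p x = (norm y)\<^sup>2"
      by (simp add: proj_qform[OF p] y_def)
    moreover have bd: "\<bar>qform a v\<bar> \<le> (norm v)\<^sup>2" for v
      using qform_le_norm[of a v] mult_right_mono[OF na, of "(norm v)\<^sup>2"] by simp
    moreover have "qform (a - (p - (1/2) *\<^sub>R id_blinfun)) x = qform a x - qform p x + 1/2 * (norm x)\<^sup>2"
      by (simp add: qform_diff qform_scaleR)
    ultimately show "\<bar>qform (a - (p - (1/2) *\<^sub>R id_blinfun)) x\<bar> \<le> 1/2 * (norm x)\<^sup>2"
      using ge[OF py] le[OF pz] bd[of y] bd[of z] unfolding abs_le_iff by linarith
  qed simp
  then show ?thesis using pA p by blast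
qed

text \<open>Binary expansion in place of a spectral integral: doubling the remainder left by
  \<open>spectral_step\<close> restores norm at most 1, and each further step halves the error. This
  density statement is how claims about projections reach all self-adjoint elements.\<close>

theorem spectral_induct:
  assumes W: "closed W" "subspace W" and proj: "\<And>p. p \<in> A \<Longrightarrow> proj_op p \<Longrightarrow> p \<in> W"
    and a: "a \<in> A" "selfadj_op a"
  shows "a \<in> W"
proof -
  have approx: "\<exists>w\<in>W. norm (b - w) \<le> (1/2) ^ n" if "b \<in> A" "selfadj_op b" "norm b \<le> 1" for b n
    using that
  proof (induction n arbitrary: b)
    case 0
    then show ?case using subspace_0[OF W(2)] by (intro bexI[of _ 0]) auto
  next
    case (Suc n)
    then obtain p where p: "p \<in> A" "proj_op p" "norm (b - (p - (1/2) *\<^sub>R id_blinfun)) \<le> 1/2"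
      using spectral_step by blast
    let ?q = "p - (1/2) *\<^sub>R id_blinfun"
    have "2 *\<^sub>R (b - ?q) \<in> A"
      using Suc.prems p by (intro vn_scaleR vn_diff vn_id vn)
    moreover have "selfadj_op (2 *\<^sub>R (b - ?q))"
      using Suc.prems p by (simp add: selfadj_diff selfadj_scaleR proj_selfadj)
    moreover have "norm (2 *\<^sub>R (b - ?q)) \<le> 1" using p(3) by simp
    ultimately obtain w where w: "w \<in> W" "norm (2 *\<^sub>R (b - ?q) - w) \<le> (1/2) ^ n"
      using Suc.IH by blast
    have "?q + (1/2) *\<^sub>R w \<in> W"
      using w(1) proj[OF p(1,2)] proj[OF vn_id[OF vn] proj_id] W(2)
      by (simp add: subspace_add subspace_diff subspace_scale)
    moreover have "b - (?q + (1/2) *\<^sub>R w) = (1/2) *\<^sub>R (2 *\<^sub>R (b - ?q) - w)"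
      by (simp add: scaleR_diff_right)
    then have "norm (b - (?q + (1/2) *\<^sub>R w)) \<le> (1/2) ^ Suc n"
      using w(2) by (simp only: norm_scaleR) simp
    ultimately show ?case by blast
  qed
  have unit: "b \<in> W" if b: "b \<in> A" "selfadj_op b" "norm b \<le> 1" for b
  proof -
    obtain w where w: "\<And>n. w n \<in> W" "\<And>n. norm (b - w n) \<le> (1/2) ^ n"
      using approx[OF b] by metis
    have "(\<lambda>n. w n - b) \<longlonglongrightarrow> 0"
      by (rule Lim_null_comparison[where g = "\<lambda>n. (1/2) ^ n"])
        (use w(2) in \<open>auto simp: norm_minus_commute LIMSEQ_realpow_zero\<close>)
    then have "w \<longlonglongrightarrow> b" by (simp add: LIM_zero_iff)
    then show ?thesis using closed_sequentially[OF W(1)] w(1) by blast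
  qed
  define k where "k = norm a + 1"
  have k: "k > 0" by (simp add: k_def add_nonneg_pos)
  have "norm ((1/k) *\<^sub>R a) \<le> 1" using k by (simp add: k_def)
  then have "(1/k) *\<^sub>R a \<in> W" using a vn by (intro unit vn_scaleR selfadj_scaleR)
  then have "k *\<^sub>R (1/k) *\<^sub>R a \<in> W" by (rule subspace_scale[OF W(2)])
  then show ?thesis using k by simp
qed

lemma vn_selfadj_induct [consumes 1, case_names selfadj add scale]:
  assumes a: "a \<in> A" and sa: "\<And>b. b \<in> A \<Longrightarrow> selfadj_op b \<Longrightarrow> P b"
    and add: "\<And>b c. b \<in> A \<Longrightarrow> c \<in> A \<Longrightarrow> P b \<Longrightarrow> P c \<Longrightarrow> P (b + c)"
    and scale: "\<And>z b. b \<in> A \<Longrightarrow> P b \<Longrightarrow> P (scale_op z b)"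
  shows "P a"
proof -
  have aB: "a \<in> bounded_ops" using vn_bounded[OF vn a] .
  define h k where "h = (1/2) *\<^sub>R (a + adj_op a)" and "k = scale_op (- \<i> / 2) (a - adj_op a)"
  have hA: "h \<in> A" and kA: "k \<in> A"
    unfolding h_def k_def using a vn by (intro vn_scaleR vn_scale vn_add vn_diff vn_adj; simp)+
  have "selfadj_op h" "selfadj_op k"
    using vn_bounded[OF vn hA] vn_bounded[OF vn kA]
    by (auto simp: selfadj_op_def h_def k_def blinfun.bilinear_simps cinner_simps adj_op_props[OF aB]
        algebra_simps)
  then have "P h" "P k" using sa hA kA by auto
  then have "P (h + scale_op \<i> k)" by (intro add scale vn_scale[OF vn] hA kA)
  also have "h + scale_op \<i> k = a"
    by (rule blinfun_eqI)
      (simp add: h_def k_def blinfun.bilinear_simps scaleC_diff_right scaleR_eq_scaleC scaleC_scaleC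
        scaleC_add_right flip: scaleC_add_left)
  finally show ?thesis .
qed

text \<open>A self-adjoint \<open>b\<close> is the difference of the positive operators
  \<open>norm b + b\<close> and \<open>norm b\<close>. The rule reduces linear statements to
  positive elements, where positivity of \<open>\<mu>\<close> can act.\<close>

lemma vn_pos_induct [consumes 1, case_names pos add scale]:
  assumes a: "a \<in> A" and pos: "\<And>b. b \<in> A \<Longrightarrow> pos_op b \<Longrightarrow> P b"
    and add: "\<And>b c. b \<in> A \<Longrightarrow> c \<in> A \<Longrightarrow> P b \<Longrightarrow> P c \<Longrightarrow> P (b + c)"
    and scale: "\<And>z b. b \<in> A \<Longrightarrow> P b \<Longrightarrow> P (scale_op z b)"
  shows "P a"
  using a
proof (induction rule: vn_selfadj_induct)
  case (selfadj b)
  let ?n = "norm b *\<^sub>R id_blinfun :: 'h \<Rightarrow>\<^sub>L 'h"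
  have n: "?n \<in> A" "pos_op ?n" by (auto intro: vn_scaleR vn_id vn pos_scaleR)
  have "P (?n + b)" using selfadj n by (intro pos selfadj_shift_pos vn_add vn)
  moreover have "P (scale_op (-1) ?n)" using n by (intro scale pos)
  ultimately have "P ((?n + b) + scale_op (-1) ?n)"
    using add[of "?n + b" "scale_op (-1) ?n"] selfadj n vn by (auto intro: vn_add vn_scale)
  also have "(?n + b) + scale_op (-1) ?n = b"
    by (rule blinfun_eqI) (simp add: blinfun.bilinear_simps)
  finally show ?case .
qed (use add scale in auto)

end

subsection \<open>Suprema of directed families of operators\<close>

lemma pos_diff_trans: "pos_op (b - a) \<Longrightarrow> pos_op (c - b) \<Longrightarrow> pos_op (c - a)"
  using pos_add[of "b - a" "c - b"] by simp

lemma pos_diff_qform: "pos_op (b - a) \<Longrightarrow> qform a x \<le> qform b x"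
  using pos_qform[of "b - a" x] by (simp add: qform_diff)

text \<open>\<open>F\<close> is the section filter of the directed set \<open>D\<close>.\<close>

lemma directed_strong_limit:
  fixes D :: "('h::complex_hilbert \<Rightarrow>\<^sub>L 'h) set"
  assumes ne: "D \<noteq> {}" and sa: "\<And>d. d \<in> D \<Longrightarrow> selfadj_op d"
    and dir: "\<And>a b. a \<in> D \<Longrightarrow> b \<in> D \<Longrightarrow> \<exists>c\<in>D. pos_op (c - a) \<and> pos_op (c - b)"
    and ub: "\<And>d. d \<in> D \<Longrightarrow> pos_op (u - d)"
  obtains F S where "F \<noteq> bot" and "\<And>d. d \<in> D \<Longrightarrow> \<forall>\<^sub>F d' in F. d' \<in> D \<and> pos_op (d' - d)"
    and "\<And>x. ((\<lambda>d. blinfun_apply d x) \<longlongrightarrow> blinfun_apply S x) F" and "selfadj_op S"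
proof -
  define U where "U d = {d' \<in> D. pos_op (d' - d)}" for d
  define F where "F = (INF d\<in>D. principal (U d))"
  have ev: "eventually P F \<longleftrightarrow> (\<exists>d\<in>D. \<forall>d'\<in>U d. P d')" for P
    unfolding F_def
  proof (subst eventually_INF_base[OF ne])
    fix a b assume "a \<in> D" "b \<in> D"
    then obtain c where "c \<in> D" "pos_op (c - a)" "pos_op (c - b)" using dir by blast
    then show "\<exists>c\<in>D. principal (U c) \<le> inf (principal (U a)) (principal (U b))"
      by (intro bexI[of _ c]) (auto simp: U_def intro: pos_diff_trans)
  qed (simp add: eventually_principal)
  have self: "d \<in> U d" if "d \<in> D" for d using that by (simp add: U_def)
  have F: "F \<noteq> bot"
    unfolding trivial_limit_def ev using self by blast
  have evD: "\<forall>\<^sub>F d' in F. d' \<in> D \<and> pos_op (d' - d)" if "d \<in> D" for d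
    unfolding ev using that by (auto simp: U_def)
  obtain d0 where d0: "d0 \<in> D" using ne by blast
  define C where "C = norm (u - d0) + 1"
  have C: "C > 0" by (simp add: C_def add_nonneg_pos)
  \<comment> \<open>All increments beyond \<open>d0\<close> are bounded by \<open>u - d0\<close>, so
    one constant serves the whole tail. By \<open>pos_norm_le\<close>, convergence of the bounded
    increasing numbers \<open>qform d x\<close> makes the vectors \<open>d x\<close> Cauchy.\<close>
  have diff: "(norm (d' x - d x))\<^sup>2 \<le> C * (qform d' x - qform d x)"
    if "d \<in> U d0" "d' \<in> U d" for d d' x
  proof -
    have "qform (d' - d) y \<le> C * (norm y)\<^sup>2" for y
    proof -
      have "pos_op (u - d')" "pos_op (d - d0)" using that ub by (auto simp: U_def)
      then have "qform (d' - d) y \<le> qform (u - d0) y"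
        using pos_diff_qform[of u d' y] pos_diff_qform[of d d0 y] by (simp add: qform_diff)
      also have "\<dots> \<le> norm (u - d0) * (norm y)\<^sup>2"
        using qform_le_norm[of "u - d0" y] by simp
      also have "\<dots> \<le> C * (norm y)\<^sup>2"
        by (intro mult_right_mono) (auto simp: C_def)
      finally show ?thesis .
    qed
    then have "(norm ((d' - d) x))\<^sup>2 \<le> C * qform (d' - d) x"
      using that by (intro pos_norm_le) (auto simp: U_def)
    then show ?thesis by (simp add: blinfun.diff_left qform_diff)
  qed
  have "\<exists>l. ((\<lambda>d. blinfun_apply d x) \<longlongrightarrow> l) F" for x
  proof -
    define q where "q = (SUP d\<in>D. qform d x)"
    have bdd: "bdd_above ((\<lambda>d. qform d x) ` D)"
      by (rule bdd_aboveI[of _ "qform u x"]) (auto intro: pos_diff_qform ub)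
    have "cauchy_filter (filtermap (\<lambda>d. blinfun_apply d x) F)"
      unfolding cauchy_filter_metric_filtermap
    proof (intro allI impI)
      fix e :: real assume e: "e > 0"
      \<comment> \<open>Chosen so that \<open>C * \<delta>\<close> is half of
        \<open>(e/2)\<^sup>2\<close>, which leaves a strict inequality.\<close>
      define \<delta> where "\<delta> = (e/2)\<^sup>2 / (2 * C)"
      have \<delta>: "\<delta> > 0" using e C by (simp add: \<delta>_def)
      have "\<exists>d\<in>D. q - \<delta> < qform d x"
        using less_cSUP_iff[OF ne bdd, of "q - \<delta>"] \<delta> by (simp add: q_def)
      then obtain d1 where d1: "d1 \<in> D" "q - \<delta> < qform d1 x" by blast
      obtain d2 where d2: "d2 \<in> D" "pos_op (d2 - d0)" "pos_op (d2 - d1)"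
        using dir[OF d0 d1(1)] by blast
      have near: "norm (d' x - d2 x) < e/2" if d': "d' \<in> U d2" for d'
      proof -
        have "qform d' x \<le> q"
          unfolding q_def using d' by (intro cSUP_upper bdd) (auto simp: U_def)
        moreover have "qform d1 x \<le> qform d2 x" using d2 by (intro pos_diff_qform)
        ultimately have "qform d' x - qform d2 x \<le> \<delta>" using d1(2) by simp
        then have "C * (qform d' x - qform d2 x) \<le> C * \<delta>" using C by simp
        moreover have "(norm (d' x - d2 x))\<^sup>2 \<le> C * (qform d' x - qform d2 x)"
          using d2 d' by (intro diff) (auto simp: U_def)
        moreover have "C * \<delta> < (e/2)\<^sup>2" using C e by (simp add: \<delta>_def)
        ultimately have "(norm (d' x - d2 x))\<^sup>2 < (e/2)\<^sup>2" by linarith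
        then show ?thesis by (rule power_less_imp_less_base) (use e in simp)
      qed
      have "dist (d x) (d' x) < e" if "d \<in> U d2" "d' \<in> U d2" for d d'
        using near[OF that(1)] near[OF that(2)] dist_triangle_half_r[of "d2 x" "d x" e "d' x"]
        by (simp add: dist_norm norm_minus_commute)
      then show "\<exists>P. eventually P F \<and> (\<forall>d d'. P d \<and> P d' \<longrightarrow> dist (blinfun_apply d x) (blinfun_apply d' x) < e)"
        using d2(1) unfolding ev by (intro exI[of _ "\<lambda>d. d \<in> U d2"]) blast
    qed
    then have "\<exists>c. filtermap (\<lambda>d. blinfun_apply d x) F \<le> nhds c"
      by (rule cauchy_filter_complete_converges[OF _ complete_UNIV])
        (use F in \<open>auto simp: filtermap_bot_iff\<close>)
    then show ?thesis by (simp add: filterlim_def)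
  qed
  then obtain S where S: "\<And>x. ((\<lambda>d. blinfun_apply d x) \<longlongrightarrow> S x) F" by metis
  have uniq: "l = l'" if "((\<lambda>d. f d) \<longlongrightarrow> l) F" "((\<lambda>d. f d) \<longlongrightarrow> l') F"
    for f :: "('h \<Rightarrow>\<^sub>L 'h) \<Rightarrow> 'c::t2_space" and l l'
    using tendsto_unique[OF F that] .
  have Dlin: "\<forall>\<^sub>F d in F. d \<in> bounded_ops"
    using evD[OF d0] by eventually_elim (auto simp: sa selfadj_bounded)
  have add: "S (x + y) = S x + S y" for x y
    by (rule uniq[OF S]) (simp add: blinfun.add_right tendsto_add S)
  have scale: "S (c *\<^sub>C x) = c *\<^sub>C S x" for c x
  proof (rule uniq[OF S])
    have "((\<lambda>d. c *\<^sub>C blinfun_apply d x) \<longlongrightarrow> c *\<^sub>C S x) F"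
      by (rule bounded_linear.tendsto[OF bounded_linear_scaleC S])
    moreover have "\<forall>\<^sub>F d in F. blinfun_apply d (c *\<^sub>C x) = c *\<^sub>C blinfun_apply d x"
      using Dlin by eventually_elim (simp add: bounded_opsD)
    ultimately show "((\<lambda>d. blinfun_apply d (c *\<^sub>C x)) \<longlongrightarrow> c *\<^sub>C S x) F"
      by (simp add: tendsto_cong)
  qed
  have bound: "norm (S x) \<le> norm x * (norm d0 + C)" for x
  proof (rule tendsto_upperbound[OF tendsto_norm[OF S] _ F])
    show "\<forall>\<^sub>F d in F. norm (blinfun_apply d x) \<le> norm x * (norm d0 + C)"
      using evD[OF d0]
    proof eventually_elim
      case (elim d)
      have "(norm (d x - d0 x))\<^sup>2 \<le> C * (qform d x - qform d0 x)"
        using elim d0 self by (intro diff) (auto simp: U_def)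
      also have "\<dots> \<le> C * (C * (norm x)\<^sup>2)"
      proof (intro mult_left_mono)
        have "qform d x - qform d0 x \<le> qform (u - d0) x"
          using pos_diff_qform[OF ub, of d x] elim by (simp add: qform_diff)
        also have "\<dots> \<le> norm (u - d0) * (norm x)\<^sup>2"
          using qform_le_norm[of "u - d0" x] by simp
        also have "\<dots> \<le> C * (norm x)\<^sup>2"
          by (intro mult_right_mono) (auto simp: C_def)
        finally show "qform d x - qform d0 x \<le> C * (norm x)\<^sup>2" .
      qed (use C in simp)
      also have "\<dots> = (C * norm x)\<^sup>2" by (simp add: power2_eq_square)
      finally have "norm (d x - d0 x) \<le> C * norm x"
        by (rule power2_le_imp_le) (use C in simp)
      moreover have "norm (d0 x) \<le> norm d0 * norm x" by (rule norm_blinfun)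
      moreover have "norm (d x) \<le> norm (d0 x) + norm (d x - d0 x)" by (rule norm_triangle_sub)
      ultimately show ?case by (simp add: algebra_simps)
    qed
  qed
  have bl: "bounded_linear S"
    using add scale bound
    by (intro bounded_linear_intro[where K = "norm d0 + C"]) (auto simp: scaleR_eq_scaleC)
  define T where "T = Blinfun S"
  have T: "blinfun_apply T x = S x" for x
    by (simp add: T_def bounded_linear_Blinfun_apply[OF bl])
  have "cinner (S x) y = cinner x (S y)" for x y
  proof (rule uniq)
    show "((\<lambda>d. cinner (blinfun_apply d x) y) \<longlongrightarrow> cinner (S x) y) F"
      by (intro tendsto_cinner S tendsto_const)
    have "((\<lambda>d. cinner x (blinfun_apply d y)) \<longlongrightarrow> cinner x (S y)) F"
      by (intro tendsto_cinner S tendsto_const)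
    moreover have "\<forall>\<^sub>F d in F. cinner (blinfun_apply d x) y = cinner x (blinfun_apply d y)"
      using evD[OF d0] by eventually_elim (simp add: sa selfadjD)
    ultimately show "((\<lambda>d. cinner (blinfun_apply d x) y) \<longlongrightarrow> cinner x (S y)) F"
      by (simp add: tendsto_cong)
  qed
  then have "selfadj_op T"
    by (simp add: selfadj_op_def bounded_ops_def T scale)
  then show ?thesis
    using that[of F T] F evD S by (simp add: T)
qed

lemma tendsto_qform:
  assumes "((\<lambda>d. blinfun_apply d x) \<longlongrightarrow> blinfun_apply S x) F"
  shows "((\<lambda>d. qform d x) \<longlongrightarrow> qform S x) F"
  unfolding qform_def by (intro tendsto_Re tendsto_cinner tendsto_const assms)

section \<open>Order and suprema in the algebra of operators\<close>

lemma op_algebra_sel: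
  "carr (op_algebra A) = A" "add (op_algebra A) = (+)" "mul (op_algebra A) = (o\<^sub>L)"
  "unit (op_algebra A) = id_blinfun" "scale (op_algebra A) = scale_op" "star (op_algebra A) = adj_op"
  by (simp_all add: op_algebra_def)

context
  fixes A :: "('h::complex_hilbert \<Rightarrow>\<^sub>L 'h) set"
  assumes vn: "von_neumann_algebra A"
begin

lemma pos_op_algebra: "pos (op_algebra A) = {a \<in> A. pos_op a}"
  using vn_bounded[OF vn] by (auto simp: op_algebra_def pos_op_def)

lemma self_adj_op_algebra: "self_adj (op_algebra A) = {a \<in> A. selfadj_op a}"
  using vn_bounded[OF vn] by (auto simp: op_algebra_sel self_adj_def selfadj_iff_adj)

lemma le_op_algebra: "a \<in> A \<Longrightarrow> b \<in> A \<Longrightarrow> le_alg (op_algebra A) a b \<longleftrightarrow> pos_op (b - a)"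
  by (auto simp: le_alg_def pos_op_algebra op_algebra_sel vn_diff[OF vn]
      intro!: exI[of _ "b - a"])

lemma upper_bound_op_algebra:
  "D \<subseteq> A \<Longrightarrow> upper_bound_alg (op_algebra A) D u \<longleftrightarrow>
    u \<in> A \<and> selfadj_op u \<and> (\<forall>d\<in>D. pos_op (u - d))"
  by (auto simp: upper_bound_alg_def self_adj_op_algebra le_op_algebra subset_iff)

lemma directed_op_algebra:
  "D \<subseteq> A \<Longrightarrow> directed_alg (op_algebra A) D \<longleftrightarrow>
    D \<noteq> {} \<and> (\<forall>a\<in>D. \<forall>b\<in>D. \<exists>c\<in>D. pos_op (c - a) \<and> pos_op (c - b))"
  unfolding directed_alg_def by (auto simp: le_op_algebra subset_iff)

text \<open>Strong limits of elements of \<open>A\<close> still commute with the commutant, so the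
  limit is in \<open>A\<close>; inequalities between quadratic forms pass to the limit, so it is the
  least upper bound.\<close>

lemma vn_directed_sup:
  assumes D: "D \<subseteq> A" "\<And>d. d \<in> D \<Longrightarrow> selfadj_op d" "D \<noteq> {}"
    and dir: "\<And>a b. a \<in> D \<Longrightarrow> b \<in> D \<Longrightarrow> \<exists>c\<in>D. pos_op (c - a) \<and> pos_op (c - b)"
    and ub: "\<And>d. d \<in> D \<Longrightarrow> pos_op (u - d)"
  obtains F S where "F \<noteq> bot" and "\<And>d. d \<in> D \<Longrightarrow> \<forall>\<^sub>F d' in F. d' \<in> D \<and> pos_op (d' - d)"
    and "\<And>x. ((\<lambda>d. blinfun_apply d x) \<longlongrightarrow> blinfun_apply S x) F"
    and "S \<in> A" "selfadj_op S" "sup_alg (op_algebra A) D S"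
proof -
  obtain F S where F: "F \<noteq> bot" and ev: "\<And>d. d \<in> D \<Longrightarrow> \<forall>\<^sub>F d' in F. d' \<in> D \<and> pos_op (d' - d)"
    and lim: "\<And>x. ((\<lambda>d. blinfun_apply d x) \<longlongrightarrow> blinfun_apply S x) F" and saS: "selfadj_op S"
    using directed_strong_limit[OF D(3) D(2) dir ub] by blast
  obtain d0 where d0: "d0 \<in> D" using D(3) by blast
  have SA: "S \<in> A"
  proof (rule vn_memI[OF vn selfadj_bounded[OF saS]])
    fix s x assume s: "s \<in> commutant A"
    have "((\<lambda>d. s (blinfun_apply d x)) \<longlongrightarrow> s (S x)) F"
      by (intro blinfun.tendsto tendsto_const lim)
    moreover have "\<forall>\<^sub>F d in F. blinfun_apply s (blinfun_apply d x) = blinfun_apply d (blinfun_apply s x)"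
      using ev[OF d0] by eventually_elim (use s D(1) vn_commute[OF vn] in blast)
    ultimately have "((\<lambda>d. blinfun_apply d (blinfun_apply s x)) \<longlongrightarrow> s (S x)) F"
      by (simp add: tendsto_cong)
    then show "S (s x) = s (S x)"
      using tendsto_unique[OF F lim] by blast
  qed
  have upper: "pos_op (S - d)" if d: "d \<in> D" for d
  proof -
    have "qform d x \<le> qform S x" for x
    proof (rule tendsto_lowerbound[OF tendsto_qform[OF lim] _ F])
      show "\<forall>\<^sub>F d' in F. qform d x \<le> qform d' x"
        using ev[OF d] by eventually_elim (auto intro: pos_diff_qform)
    qed
    then show ?thesis using D(2)[OF d] saS by (simp add: pos_diff_iff)
  qed
  have least: "pos_op (v - S)" if v: "selfadj_op v" "\<And>d. d \<in> D \<Longrightarrow> pos_op (v - d)" for v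
  proof -
    have "qform S x \<le> qform v x" for x
    proof (rule tendsto_upperbound[OF tendsto_qform[OF lim] _ F])
      show "\<forall>\<^sub>F d' in F. qform d' x \<le> qform v x"
        using ev[OF d0] by eventually_elim (auto intro: pos_diff_qform v)
    qed
    then show ?thesis using v saS by (simp add: pos_diff_iff)
  qed
  have "sup_alg (op_algebra A) D S"
    unfolding sup_alg_def using SA saS upper least D(1)
    by (auto simp: upper_bound_op_algebra le_op_algebra)
  then show ?thesis using that F ev lim SA saS by blast
qed

lemma sup_op_algebra_unique:
  assumes D: "D \<subseteq> A" and s: "sup_alg (op_algebra A) D s" "sup_alg (op_algebra A) D s'"
  shows "s = s'"
proof -
  have m: "s \<in> A" "s' \<in> A" "selfadj_op s" "selfadj_op s'"
    using s D by (auto simp: sup_alg_def upper_bound_op_algebra)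
  have "pos_op (s - s')" "pos_op (s' - s)"
    using s m by (auto simp: sup_alg_def le_op_algebra)
  then have "s - s' = 0" using pos_antisym[of "s - s'"] by simp
  then show ?thesis by simp
qed

text \<open>Suprema in the order are unique, so a given one coincides with the strong limit just
  constructed. Normality can then be checked on vectors.\<close>

lemma sup_op_algebra_strong_limit:
  assumes D: "D \<subseteq> self_adj (op_algebra A)" "directed_alg (op_algebra A) D"
    and s: "sup_alg (op_algebra A) D s"
  obtains F where "F \<noteq> bot" and "\<And>d. d \<in> D \<Longrightarrow> \<forall>\<^sub>F d' in F. d' \<in> D \<and> pos_op (d' - d)"
    and "\<And>x. ((\<lambda>d. blinfun_apply d x) \<longlongrightarrow> blinfun_apply s x) F"
proof -
  have DA: "D \<subseteq> A" "\<And>d. d \<in> D \<Longrightarrow> selfadj_op d" using D(1) by (auto simp: self_adj_op_algebra)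
  have ub: "\<And>d. d \<in> D \<Longrightarrow> pos_op (s - d)"
    using s DA by (auto simp: sup_alg_def upper_bound_op_algebra)
  have ne: "D \<noteq> {}"
    and dir: "\<And>a b. a \<in> D \<Longrightarrow> b \<in> D \<Longrightarrow> \<exists>c\<in>D. pos_op (c - a) \<and> pos_op (c - b)"
    using D(2) unfolding directed_op_algebra[OF DA(1)] by auto
  show thesis
  proof (rule vn_directed_sup[of D s])
    fix F S
    assume "sup_alg (op_algebra A) D S"
    then have "S = s" using sup_op_algebra_unique[OF DA(1)] s by blast
    moreover assume "F \<noteq> bot" "\<And>d. d \<in> D \<Longrightarrow> \<forall>\<^sub>F d' in F. d' \<in> D \<and> pos_op (d' - d)"
      "\<And>x. ((\<lambda>d. blinfun_apply d x) \<longlongrightarrow> blinfun_apply S x) F"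
    ultimately show thesis using that by blast
  qed (use DA ne dir ub in auto)
qed

end

subsection \<open>Tensor products of operators\<close>

context
  fixes t :: "'a::complex_hilbert \<Rightarrow> 'b::complex_hilbert \<Rightarrow> 'k::complex_hilbert"
  assumes t: "hilbert_tensor_product t"
begin

lemma tensor_add_left: "t (x + x') y = t x y + t x' y"
  and tensor_add_right: "t x (y + y') = t x y + t x y'"
  and tensor_scaleC_left: "t (c *\<^sub>C x) y = c *\<^sub>C t x y"
  and tensor_scaleC_right: "t x (c *\<^sub>C y) = c *\<^sub>C t x y"
  and cinner_tensor: "cinner (t x y) (t x' y') = cinner x x' * cinner y y'"
  and tensor_total: "closure (span {t x y |x y. True}) = UNIV"
  using t unfolding hilbert_tensor_product_def by blast+

lemma tensor_scaleR_left: "t (r *\<^sub>R x) y = r *\<^sub>R t x y"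
  by (simp add: scaleR_eq_scaleC tensor_scaleC_left)

lemma tensor_scaleR_right: "t x (r *\<^sub>R y) = r *\<^sub>R t x y"
  by (simp add: scaleR_eq_scaleC tensor_scaleC_right)

lemma tensor_diff_left: "t (x - x') y = t x y - t x' y"
  using tensor_add_left[of "x - x'" x' y] by simp

lemma tensor_diff_right: "t x (y - y') = t x y - t x y'"
  using tensor_add_right[of x "y - y'" y'] by simp

lemma tensor_zero_left [simp]: "t 0 y = 0"
  using tensor_diff_left[of 0 0 y] by simp

lemma tensor_zero_right [simp]: "t x 0 = 0"
  using tensor_diff_right[of x 0 0] by simp

lemma norm_tensor: "norm (t x y) = norm x * norm y"
proof -
  have "complex_of_real ((norm (t x y))\<^sup>2) = complex_of_real ((norm x * norm y)\<^sup>2)"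
    using cinner_tensor[of x y x y] by (simp add: cinner_self_eq power_mult_distrib)
  then have "(norm (t x y))\<^sup>2 = (norm x * norm y)\<^sup>2"
    using of_real_eq_iff by blast
  then show ?thesis by (simp add: power2_eq_iff_nonneg)
qed

lemma bounded_bilinear_tensor: "bounded_bilinear t"
proof
  show "\<exists>K. \<forall>x y. norm (t x y) \<le> norm x * norm y * K"
    by (intro exI[of _ 1]) (simp add: norm_tensor)
qed (simp_all add: tensor_add_left tensor_add_right tensor_scaleR_left tensor_scaleR_right)

lemma tensor_closed_subspace_UNIV:
  assumes "closed V" "subspace V" "\<And>x y. t x y \<in> V"
  shows "V = UNIV"
proof -
  have "span {t x y |x y. True} \<subseteq> V"
    using assms(2,3) by (intro span_minimal) auto
  then have "closure (span {t x y |x y. True}) \<subseteq> V"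
    using assms(1) by (rule closure_minimal)
  then show ?thesis using tensor_total by auto
qed

lemma tensor_linear_eqI:
  fixes f g :: "'k \<Rightarrow> 'l::real_normed_vector"
  assumes "bounded_linear f" "bounded_linear g" "\<And>x y. f (t x y) = g (t x y)"
  shows "f = g"
proof -
  interpret f: bounded_linear f by fact
  interpret g: bounded_linear g by fact
  have "{z. f z = g z} = UNIV"
  proof (rule tensor_closed_subspace_UNIV)
    show "closed {z. f z = g z}"
      by (intro closed_Collect_eq f.continuous_on g.continuous_on continuous_intros)
    show "subspace {z. f z = g z}"
      by (auto simp: subspace_def f.zero g.zero f.add g.add f.scaleR g.scaleR)
  qed (use assms in simp)
  then show ?thesis by auto
qed

lemma tensor_op_ext:
  assumes "\<And>x y. blinfun_apply S (t x y) = blinfun_apply T (t x y)"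
  shows "S = T"
  using tensor_linear_eqI[OF blinfun.bounded_linear_right[of S] blinfun.bounded_linear_right[of T] assms]
  by (intro blinfun_eqI) (rule fun_cong)

text \<open>Boundedness of \<open>a \<otimes> 1\<close> on sums of simple tensors: if \<open>c\<close> is the square root of
  \<open>M\<^sup>2 - a\<^sup>* a\<close>, then \<open>M\<^sup>2 \<parallel>z\<parallel>\<^sup>2 - \<parallel>(a \<otimes> 1) z\<parallel>\<^sup>2 = \<parallel>(c \<otimes> 1) z\<parallel>\<^sup>2\<close>.\<close>

lemma exists_tensor_left:
  assumes a: "a \<in> bounded_ops"
  shows "\<exists>T\<in>bounded_ops. \<forall>x y. blinfun_apply T (t x y) = t (blinfun_apply a x) y"
proof -
  define M where "M = norm a"
  have "qform (adj_op a o\<^sub>L a) x = (norm (a x))\<^sup>2" for x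
    by (simp add: qform_def cinner_adj_right[OF a] Re_cinner_self)
  moreover have "(norm (a x))\<^sup>2 \<le> M\<^sup>2 * (norm x)\<^sup>2" for x
    using power_mono[OF norm_blinfun[of a x] norm_ge_zero, of 2] by (simp add: M_def power_mult_distrib)
  ultimately have "pos_op (M\<^sup>2 *\<^sub>R id_blinfun - (adj_op a o\<^sub>L a))"
    using pos_adj_compose[OF a] by (simp add: pos_op_iff selfadj_diff selfadj_scaleR qform_diff qform_scaleR)
  then obtain c where c: "pos_op c" "c o\<^sub>L c = M\<^sup>2 *\<^sub>R id_blinfun - (adj_op a o\<^sub>L a)"
    using exists_sqrt by blast
  have cc: "M\<^sup>2 *\<^sub>R cinner x x' - cinner (a x) (a x') = cinner (c x) (c x')" for x x'
  proof -
    have "cinner (c x) (c x') = cinner x ((c o\<^sub>L c) x')"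
      by (simp add: selfadjD[OF pos_selfadj[OF c(1)]])
    also have "\<dots> = M\<^sup>2 *\<^sub>R cinner x x' - cinner (a x) (a x')"
      unfolding c(2) by (simp add: blinfun.bilinear_simps cinner_simps cinner_adj_right[OF a])
    finally show ?thesis ..
  qed
  define S where "S = {(t x y, t (a x) y, t (c x) y) |x y. True}"
  define G where "G = span S"
  have Gs: "subspace G" by (simp add: G_def)
  \<comment> \<open>The components of a triple stand for \<open>z\<close>,
    \<open>(a \<otimes> 1) z\<close> and \<open>(c \<otimes> 1) z\<close>. The form \<open>L\<close>
    is the polarised norm identity; it vanishes on pairs of simple tensors, hence on the
    span.\<close>
  define L where "L g h = M\<^sup>2 *\<^sub>R cinner (fst g) (fst h) - cinner (fst (snd g)) (fst (snd h))
      - cinner (snd (snd g)) (snd (snd h))" for g h :: "'k \<times> 'k \<times> 'k"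
  have L_add: "L g (h + h') = L g h + L g h'" "L (g + g') h = L g h + L g' h" for g g' h h'
    by (simp_all add: L_def cinner_simps scaleR_add_right)
  have L_scale: "L g (r *\<^sub>R h) = r *\<^sub>R L g h" "L (r *\<^sub>R g) h = r *\<^sub>R L g h" for r g h
    by (simp_all add: L_def cinner_simps scaleR_diff_right mult.commute)
  define I where "I g h \<longleftrightarrow> L g h = 0" for g h
  have L_zero: "L g 0 = 0" "L 0 h = 0" for g h by (simp_all add: L_def)
  have sub1: "subspace {h. I g h}" and sub2: "subspace {h. I h g}" for g
    by (auto simp: subspace_def I_def L_add L_scale L_zero)
  have "I g h" if "g \<in> S" "h \<in> S" for g h
    using that by (auto simp: S_def I_def L_def cinner_tensor simp flip: cc) (simp add: left_diff_distrib)
  then have "G \<subseteq> {h. I g h}" if "g \<in> S" for g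
    unfolding G_def using that by (intro span_minimal sub1 subsetI) simp
  then have "G \<subseteq> {g. I g h}" if "h \<in> G" for h
    unfolding G_def using that by (intro span_minimal sub2) (auto simp: G_def)
  then have I: "I g g" if "g \<in> G" for g using that by blast
  have bound: "norm (fst (snd g)) \<le> M * norm (fst g)" if "g \<in> G" for g
  proof -
    have "Re (M\<^sup>2 *\<^sub>R cinner (fst g) (fst g) - cinner (fst (snd g)) (fst (snd g)))
        = Re (cinner (snd (snd g)) (snd (snd g)))"
      using I[OF that] by (simp add: I_def L_def)
    then have "M\<^sup>2 * (norm (fst g))\<^sup>2 - (norm (fst (snd g)))\<^sup>2 = (norm (snd (snd g)))\<^sup>2"
      by (simp add: Re_cinner_self)
    then have "(norm (fst (snd g)))\<^sup>2 \<le> (M * norm (fst g))\<^sup>2"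
      unfolding power_mult_distrib by (smt (verit) zero_le_power2)
    then show ?thesis by (rule power2_le_imp_le) (simp add: M_def)
  qed
  have fstG: "fst ` G = span {t x y |x y. True}"
  proof -
    have "fst ` S = {t x y |x y. True}" by (force simp: S_def)
    then show ?thesis
      unfolding G_def using linear_span_image[OF bounded_linear.linear[OF bounded_linear_fst], of S]
      by simp
  qed
  \<comment> \<open>The closure of the graph of \<open>a \<otimes> 1\<close>. Working with a
    relation postpones well-definedness: single-valuedness follows from the bound by
    \<open>M\<close>, applied to differences.\<close>
  define R where "R z w \<longleftrightarrow> (\<exists>g. (\<forall>n. g n \<in> G) \<and> (\<lambda>n. fst (g n)) \<longlonglongrightarrow> z \<and> (\<lambda>n. fst (snd (g n))) \<longlonglongrightarrow> w)"
    for z w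
  have R_ex: "\<exists>w. R z w" for z
  proof -
    have "z \<in> closure (fst ` G)" using tensor_total fstG by simp
    then obtain u where u: "\<And>n. u n \<in> fst ` G" "u \<longlonglongrightarrow> z"
      unfolding closure_sequential by blast
    then have "\<forall>n. \<exists>g\<in>G. u n = fst g" by blast
    then obtain g where g: "\<And>n. g n \<in> G" "\<And>n. u n = fst (g n)" by metis
    have "Cauchy (\<lambda>n. fst (snd (g n)))"
    proof (rule metric_CauchyI)
      fix e :: real assume e: "e > 0"
      have M1: "M + 1 > 0" by (simp add: M_def add_nonneg_pos)
      have "Cauchy u" using u(2) by (rule LIMSEQ_imp_Cauchy)
      then obtain N where N: "\<And>m n. m \<ge> N \<Longrightarrow> n \<ge> N \<Longrightarrow> dist (u m) (u n) < e / (M + 1)"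
        using metric_CauchyD[of u "e / (M + 1)"] e M1 by auto
      have "dist (fst (snd (g m))) (fst (snd (g n))) < e" if "m \<ge> N" "n \<ge> N" for m n
      proof -
        have "dist (fst (snd (g m))) (fst (snd (g n))) \<le> M * norm (fst (g m - g n))"
          using bound[of "g m - g n"] g(1) Gs by (simp add: subspace_diff dist_norm)
        also have "\<dots> \<le> (M + 1) * norm (fst (g m - g n))" by (intro mult_right_mono) auto
        also have "\<dots> < (M + 1) * (e / (M + 1))"
          using N[OF that] M1 by (intro mult_strict_left_mono) (simp_all add: g(2) dist_norm)
        finally show ?thesis using M1 by simp
      qed
      then show "\<exists>N. \<forall>m\<ge>N. \<forall>n\<ge>N. dist (fst (snd (g m))) (fst (snd (g n))) < e" by blast
    qed
    then obtain w where "(\<lambda>n. fst (snd (g n))) \<longlonglongrightarrow> w"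
      by (auto simp: Cauchy_convergent_iff convergent_def)
    moreover have "(\<lambda>n. fst (g n)) \<longlonglongrightarrow> z"
      using u(2) unfolding g(2)[symmetric] .
    ultimately show ?thesis unfolding R_def using g(1) by blast
  qed
  have R_add: "R (z + z') (w + w')" if R: "R z w" "R z' w'" for z w z' w'
  proof -
    obtain g g' where g: "\<And>n. g n \<in> G" "(\<lambda>n. fst (g n)) \<longlonglongrightarrow> z" "(\<lambda>n. fst (snd (g n))) \<longlonglongrightarrow> w"
      and g': "\<And>n. g' n \<in> G" "(\<lambda>n. fst (g' n)) \<longlonglongrightarrow> z'" "(\<lambda>n. fst (snd (g' n))) \<longlonglongrightarrow> w'"
      using R unfolding R_def by blast
    have "(\<lambda>n. fst (g n + g' n)) \<longlonglongrightarrow> z + z'" "(\<lambda>n. fst (snd (g n + g' n))) \<longlonglongrightarrow> w + w'"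
      using tendsto_add[OF g(2) g'(2)] tendsto_add[OF g(3) g'(3)] by simp_all
    then show ?thesis
      unfolding R_def using g(1) g'(1) Gs by (intro exI[of _ "\<lambda>n. g n + g' n"]) (simp add: subspace_add)
  qed
  have R_scale: "R (r *\<^sub>R z) (r *\<^sub>R w)" if R: "R z w" for r z w
  proof -
    obtain g where g: "\<And>n. g n \<in> G" "(\<lambda>n. fst (g n)) \<longlonglongrightarrow> z" "(\<lambda>n. fst (snd (g n))) \<longlonglongrightarrow> w"
      using R unfolding R_def by blast
    have "(\<lambda>n. fst (r *\<^sub>R g n)) \<longlonglongrightarrow> r *\<^sub>R z" "(\<lambda>n. fst (snd (r *\<^sub>R g n))) \<longlonglongrightarrow> r *\<^sub>R w"
      using tendsto_scaleR[OF tendsto_const g(2)] tendsto_scaleR[OF tendsto_const g(3)] by simp_all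
    then show ?thesis
      unfolding R_def using g(1) Gs by (intro exI[of _ "\<lambda>n. r *\<^sub>R g n"]) (simp add: subspace_scale)
  qed
  have R_bound: "norm w \<le> M * norm z" if R: "R z w" for z w
  proof -
    obtain g where g: "\<And>n. g n \<in> G" "(\<lambda>n. fst (g n)) \<longlonglongrightarrow> z" "(\<lambda>n. fst (snd (g n))) \<longlonglongrightarrow> w"
      using R unfolding R_def by blast
    show ?thesis
      by (rule LIMSEQ_le[OF tendsto_norm[OF g(3)] tendsto_mult[OF tendsto_const tendsto_norm[OF g(2)]]])
        (use bound g(1) in auto)
  qed
  have R_unique: "w = w'" if "R z w" "R z w'" for z w w'
  proof -
    have "R (z + (-1) *\<^sub>R z) (w + (-1) *\<^sub>R w')" using that by (intro R_add R_scale)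
    then have "norm (w - w') \<le> 0" using R_bound by fastforce
    then show ?thesis by simp
  qed
  obtain f where f: "\<And>z. R z (f z)" using R_ex by metis
  have bl: "bounded_linear f"
  proof (rule bounded_linear_intro[where K = M])
    show "f (z + z') = f z + f z'" for z z' by (rule R_unique[OF f R_add[OF f f]])
    show "f (r *\<^sub>R z) = r *\<^sub>R f z" for r z by (rule R_unique[OF f R_scale[OF f]])
    show "norm (f z) \<le> norm z * M" for z using R_bound[OF f] by (simp add: mult.commute)
  qed
  have f_tensor: "f (t x y) = t (a x) y" for x y
  proof (rule R_unique[OF f])
    have "(t x y, t (a x) y, t (c x) y) \<in> G" unfolding G_def by (rule span_base) (auto simp: S_def)
    then show "R (t x y) (t (a x) y)"
      unfolding R_def by (intro exI[of _ "\<lambda>_. (t x y, t (a x) y, t (c x) y)"]) simp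
  qed
  have f_scaleC: "f (d *\<^sub>C z) = d *\<^sub>C f z" for d z
  proof -
    have "(\<lambda>z. f (d *\<^sub>C z)) = (\<lambda>z. d *\<^sub>C f z)"
    proof (rule tensor_linear_eqI)
      show "bounded_linear (\<lambda>z. f (d *\<^sub>C z))"
        by (rule bounded_linear_compose[OF bl bounded_linear_scaleC])
      show "bounded_linear (\<lambda>z. d *\<^sub>C f z)"
        by (rule bounded_linear_compose[OF bounded_linear_scaleC bl])
      show "f (d *\<^sub>C t x y) = d *\<^sub>C f (t x y)" for x y
        unfolding tensor_scaleC_left[symmetric] f_tensor
        by (simp add: bounded_opsD[OF a] tensor_scaleC_left)
    qed
    then show ?thesis by (rule fun_cong)
  qed
  show ?thesis
    by (intro bexI[of _ "Blinfun f"])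
      (simp_all add: bounded_linear_Blinfun_apply[OF bl] f_tensor bounded_ops_def f_scaleC)
qed

end

text \<open>Exchanging the factors makes the construction of \<open>a \<otimes> 1\<close> yield
  \<open>1 \<otimes> b\<close> as well; \<open>a \<otimes> b\<close> is their product.\<close>

lemma hilbert_tensor_product_flip:
  "hilbert_tensor_product t \<Longrightarrow> hilbert_tensor_product (\<lambda>y x. t x y)"
proof -
  have "{t x y |y x. True} = {t x y |x y. True}" by blast
  then show "hilbert_tensor_product t \<Longrightarrow> hilbert_tensor_product (\<lambda>y x. t x y)"
    unfolding hilbert_tensor_product_def by (simp add: mult.commute)
qed

section \<open>Tensor products of two operators and of two algebras\<close>

context
  fixes t :: "'a::complex_hilbert \<Rightarrow> 'b::complex_hilbert \<Rightarrow> 'k::complex_hilbert"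
  assumes t: "hilbert_tensor_product t"
begin

lemma
  assumes a: "a \<in> bounded_ops" and b: "b \<in> bounded_ops"
  shows tensor_op_bounded: "tensor_op t a b \<in> bounded_ops"
    and tensor_op_apply: "blinfun_apply (tensor_op t a b) (t x y) = t (blinfun_apply a x) (blinfun_apply b y)"
proof -
  obtain T where T: "T \<in> bounded_ops" "\<And>x y. T (t x y) = t (a x) y"
    using exists_tensor_left[OF t a] by blast
  obtain S where S: "S \<in> bounded_ops" "\<And>x y. S (t x y) = t x (b y)"
    using exists_tensor_left[OF hilbert_tensor_product_flip[OF t] b] by blast
  have "T o\<^sub>L S \<in> bounded_ops \<and> (\<forall>x y. (T o\<^sub>L S) (t x y) = t (a x) (b y))"
    using S T by (simp add: bounded_ops_compose)
  moreover have "R = T o\<^sub>L S" if "R \<in> bounded_ops \<and> (\<forall>x y. R (t x y) = t (a x) (b y))" for R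
    by (rule tensor_op_ext[OF t]) (use that S T in simp)
  ultimately have "tensor_op t a b \<in> bounded_ops \<and> (\<forall>x y. tensor_op t a b (t x y) = t (a x) (b y))"
    unfolding tensor_op_def by (rule theI)
  then show "tensor_op t a b \<in> bounded_ops" "tensor_op t a b (t x y) = t (a x) (b y)" by auto
qed

lemma tensor_op_compose:
  assumes "a \<in> bounded_ops" "b \<in> bounded_ops" "c \<in> bounded_ops" "d \<in> bounded_ops"
  shows "tensor_op t a b o\<^sub>L tensor_op t c d = tensor_op t (a o\<^sub>L c) (b o\<^sub>L d)"
  by (rule tensor_op_ext[OF t]) (use assms in \<open>simp add: tensor_op_apply bounded_ops_compose\<close>)

lemma tensor_op_id [simp]: "tensor_op t id_blinfun id_blinfun = id_blinfun"
  by (rule tensor_op_ext[OF t]) (simp add: tensor_op_apply)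

lemma tensor_op_add_left:
  assumes "a \<in> bounded_ops" "b \<in> bounded_ops" "c \<in> bounded_ops"
  shows "tensor_op t (a + b) c = tensor_op t a c + tensor_op t b c"
  by (rule tensor_op_ext[OF t])
    (use assms in \<open>simp add: tensor_op_apply bounded_ops_add blinfun.add_left tensor_add_left[OF t]\<close>)

lemma tensor_op_add_right:
  assumes "a \<in> bounded_ops" "b \<in> bounded_ops" "c \<in> bounded_ops"
  shows "tensor_op t c (a + b) = tensor_op t c a + tensor_op t c b"
  by (rule tensor_op_ext[OF t])
    (use assms in \<open>simp add: tensor_op_apply bounded_ops_add blinfun.add_left tensor_add_right[OF t]\<close>)

lemma tensor_op_scale_right:
  assumes "a \<in> bounded_ops" "c \<in> bounded_ops"
  shows "tensor_op t c (scale_op z a) = scale_op z (tensor_op t c a)"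
  by (rule tensor_op_ext[OF t])
    (use assms in \<open>simp add: tensor_op_apply bounded_ops_scale tensor_scaleC_right[OF t]\<close>)

text \<open>The identity is clear between simple tensors and is extended to arbitrary vectors in one
  argument at a time.\<close>

lemma adj_tensor_op:
  assumes a: "a \<in> bounded_ops" and b: "b \<in> bounded_ops"
  shows "adj_op (tensor_op t a b) = tensor_op t (adj_op a) (adj_op b)"
proof (rule adj_op_eqI)
  let ?T = "tensor_op t a b" and ?S = "tensor_op t (adj_op a) (adj_op b)"
  have ab: "adj_op a \<in> bounded_ops" "adj_op b \<in> bounded_ops" using a b by (auto simp: adj_op_bounded)
  show "?S \<in> bounded_ops" by (rule tensor_op_bounded[OF ab])
  have bl1: "bounded_linear (\<lambda>w. cinner z (U w))" for z and U :: "'k \<Rightarrow>\<^sub>L 'k"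
    by (rule bounded_linear_compose[OF bounded_bilinear.bounded_linear_right
            [OF bounded_bilinear_cinner] blinfun.bounded_linear_right])
  have bl2: "bounded_linear (\<lambda>w. cinner (U w) z)" for z and U :: "'k \<Rightarrow>\<^sub>L 'k"
    by (rule bounded_linear_compose[OF bounded_bilinear.bounded_linear_left
            [OF bounded_bilinear_cinner] blinfun.bounded_linear_right])
  have 1: "cinner (?S (t x y)) (t x' y') = cinner (t x y) (?T (t x' y'))" for x y x' y'
    by (simp add: tensor_op_apply a b ab cinner_tensor[OF t] cinner_adj_left)
  have 2: "(\<lambda>w. cinner (?S (t x y)) (id_blinfun w)) = (\<lambda>w. cinner (t x y) (?T w))" for x y
    by (rule tensor_linear_eqI[OF t bl1 bl1]) (simp add: 1)
  have eq: "(\<lambda>z. cinner (?S z) w) = (\<lambda>z. cinner (id_blinfun z) (?T w))" for w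
    by (rule tensor_linear_eqI[OF t bl2 bl2]) (use fun_cong[OF 2, of _ _ w] in simp)
  show "cinner (?S z) w = cinner z (?T w)" for z w
    using fun_cong[OF eq, of z w] by simp
qed

lemma selfadj_tensor_op: "selfadj_op a \<Longrightarrow> selfadj_op b \<Longrightarrow> selfadj_op (tensor_op t a b)"
  by (simp add: selfadj_iff_adj tensor_op_bounded adj_tensor_op)

lemma proj_tensor_op: "proj_op a \<Longrightarrow> proj_op b \<Longrightarrow> proj_op (tensor_op t a b)"
  by (simp add: proj_op_def selfadj_tensor_op tensor_op_compose selfadj_bounded)

text \<open>With square roots \<open>s\<close> of \<open>a\<close> and \<open>r\<close> of
  \<open>b\<close>, the operator \<open>a \<otimes> b\<close> is the adjoint of
  \<open>s \<otimes> r\<close> composed with \<open>s \<otimes> r\<close>.\<close>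

lemma pos_tensor_op:
  assumes "pos_op a" "pos_op b"
  shows "pos_op (tensor_op t a b)"
proof -
  obtain s r where s: "pos_op s" "s o\<^sub>L s = a" and r: "pos_op r" "r o\<^sub>L r = b"
    using exists_sqrt assms by metis
  have sr: "s \<in> bounded_ops" "r \<in> bounded_ops" "adj_op s = s" "adj_op r = r"
    using s(1) r(1) pos_selfadj by (auto simp: selfadj_iff_adj)
  have eq: "tensor_op t a b = adj_op (tensor_op t s r) o\<^sub>L tensor_op t s r"
    using s r sr by (simp add: adj_tensor_op tensor_op_compose)
  show ?thesis unfolding eq by (intro pos_adj_compose tensor_op_bounded sr)
qed

lemma von_neumann_spatial_tensor:
  assumes A: "von_neumann_algebra A" and B: "von_neumann_algebra B"
  shows "von_neumann_algebra (spatial_tensor t A B)"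
  unfolding spatial_tensor_def
proof (rule von_neumann_bicommutant)
  show "{tensor_op t a b |a b. a \<in> A \<and> b \<in> B} \<subseteq> bounded_ops"
    using vn_bounded[OF A] vn_bounded[OF B] by (auto intro: tensor_op_bounded)
  fix s assume "s \<in> {tensor_op t a b |a b. a \<in> A \<and> b \<in> B}"
  then show "adj_op s \<in> {tensor_op t a b |a b. a \<in> A \<and> b \<in> B}"
    using vn_bounded[OF A] vn_bounded[OF B] vn_adj[OF A] vn_adj[OF B]
    by (fastforce simp: adj_tensor_op)
qed

lemma tensor_op_mem:
  assumes A: "von_neumann_algebra A" and B: "von_neumann_algebra B" and "a \<in> A" "b \<in> B"
  shows "tensor_op t a b \<in> spatial_tensor t A B"
  unfolding spatial_tensor_def using assms vn_bounded[OF A] vn_bounded[OF B]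
  by (intro subsetD[OF subset_bicommutant]) (auto intro: tensor_op_bounded)

text \<open>The access to general elements of the tensor square: being in a bicommutant, they
  commute with whatever commutes with the generators, so each test operator \<open>s\<close> gives
  information about \<open>T\<close>.\<close>

lemma spatial_tensor_commute:
  assumes T: "T \<in> spatial_tensor t A B" and s: "s \<in> bounded_ops"
    and "\<And>a b z. a \<in> A \<Longrightarrow> b \<in> B \<Longrightarrow>
      blinfun_apply s (blinfun_apply (tensor_op t a b) z) = blinfun_apply (tensor_op t a b) (blinfun_apply s z)"
  shows "blinfun_apply T (blinfun_apply s z) = blinfun_apply s (blinfun_apply T z)"
proof -
  have "s \<in> commutant {tensor_op t a b |a b. a \<in> A \<and> b \<in> B}"
    by (rule commutantI[OF s]) (use assms in auto)
  then show ?thesis using T unfolding spatial_tensor_def by (rule commutantD[rotated])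
qed

end

subsection \<open>Duplicators multiply projections\<close>

lemma id_compose [simp]: "id_blinfun o\<^sub>L T = T" and compose_id [simp]: "T o\<^sub>L id_blinfun = T"
  by (rule blinfun_eqI; simp)+

lemma scale_compose: "scale_op c S o\<^sub>L T = scale_op c (S o\<^sub>L T)"
  by (rule blinfun_eqI) simp

lemma compose_scale: "S \<in> bounded_ops \<Longrightarrow> S o\<^sub>L scale_op c T = scale_op c (S o\<^sub>L T)"
  by (rule blinfun_eqI) (simp add: bounded_opsD)

text \<open>The form of \<open>m\<close> is caught between 0 and that of \<open>k p\<close>, which
  vanishes on the complement of \<open>p\<close>; a positive operator kills every vector on which
  its form is 0.\<close>

lemma pos_below_proj:
  assumes p: "proj_op p" and m: "pos_op m" and le: "pos_op (k *\<^sub>R p - m)"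
  shows "m o\<^sub>L p = m" "p o\<^sub>L m = m"
proof -
  have "m (x - p x) = 0" for x
  proof (rule pos_qform_zero[OF m])
    have "qform m (x - p x) \<le> qform (k *\<^sub>R p) (x - p x)"
      by (rule pos_diff_qform[OF le])
    also have "\<dots> = 0"
      using p by (simp add: qform_scaleR proj_qform blinfun.diff_right)
    finally show "qform m (x - p x) = 0"
      using pos_qform[OF m, of "x - p x"] by simp
  qed
  then show mp: "m o\<^sub>L p = m"
    by (intro blinfun_eqI) (simp add: blinfun.diff_right)
  have "adj_op (m o\<^sub>L p) = p o\<^sub>L m"
    using pos_selfadj[OF m] proj_selfadj[OF p] by (simp add: selfadj_iff_adj adj_op_compose)
  then show "p o\<^sub>L m = m"
    using mp pos_selfadj[OF m] by (simp add: selfadj_iff_adj)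
qed

lemma selfadj_sandwich_pos:
  assumes "pos_op P" "selfadj_op T"
  shows "pos_op (T o\<^sub>L (P o\<^sub>L T))"
  using pos_sandwich[OF assms(1), of T] assms(2) by (simp add: selfadj_iff_adj blinfun_compose_assoc)

lemma proj_commuting_cut_pos:
  assumes "pos_op P" "proj_op p" "p o\<^sub>L P = P o\<^sub>L p"
  shows "pos_op (P o\<^sub>L p)"
  using selfadj_sandwich_pos[OF assms(1) proj_selfadj[OF assms(2)]] assms(2,3)
  by (metis blinfun_compose_assoc proj_idem)

locale duplicated_algebra =
  fixes t :: "'h::complex_hilbert \<Rightarrow> 'h \<Rightarrow> 'k::complex_hilbert"
    and A :: "('h \<Rightarrow>\<^sub>L 'h) set" and \<mu> :: "('k \<Rightarrow>\<^sub>L 'k) \<Rightarrow> ('h \<Rightarrow>\<^sub>L 'h)"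
  assumes vn: "von_neumann_algebra A" and t: "hilbert_tensor_product t" and dup: "duplicator t A \<mu>"
begin

abbreviation "M \<equiv> spatial_tensor t A A"

lemmas vnM = von_neumann_spatial_tensor[OF t vn vn]
lemmas memA = vn_bounded[OF vn]
lemmas memM = vn_bounded[OF vnM]
lemmas tensor_memM = tensor_op_mem[OF t vn vn]

lemma mu_mem: "T \<in> M \<Longrightarrow> \<mu> T \<in> A"
  and mu_add: "S \<in> M \<Longrightarrow> T \<in> M \<Longrightarrow> \<mu> (S + T) = \<mu> S + \<mu> T"
  and mu_scale: "T \<in> M \<Longrightarrow> \<mu> (scale_op c T) = scale_op c (\<mu> T)"
  and mu_id: "\<mu> id_blinfun = id_blinfun"
  and mu_id_left: "a \<in> A \<Longrightarrow> \<mu> (tensor_op t id_blinfun a) = a"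
  and mu_id_right: "a \<in> A \<Longrightarrow> \<mu> (tensor_op t a id_blinfun) = a"
  using dup by (auto simp: duplicator_def Let_def linear_alg_def unital_alg_def op_algebra_sel)

lemma mu_pos: "T \<in> M \<Longrightarrow> pos_op T \<Longrightarrow> pos_op (\<mu> T)"
  using dup
  by (auto simp: duplicator_def Let_def positive_alg_def pos_op_algebra[OF vn] pos_op_algebra[OF vnM])

lemma mu_scaleR: "T \<in> M \<Longrightarrow> \<mu> (r *\<^sub>R T) = r *\<^sub>R \<mu> T"
  using mu_scale[of T "complex_of_real r"] by (simp add: scale_op_of_real)

lemma mu_diff: "S \<in> M \<Longrightarrow> T \<in> M \<Longrightarrow> \<mu> (S - T) = \<mu> S - \<mu> T"
  using mu_add[of S "(-1) *\<^sub>R T"] mu_scaleR[of T "-1"] vn_scaleR[OF vnM, of T "-1"] by simp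

lemma mu_zero [simp]: "\<mu> 0 = 0"
  using mu_diff[OF vn_zero[OF vnM] vn_zero[OF vnM]] by simp

lemma mu_proj:
  assumes p: "p \<in> A" "proj_op p" and b: "b \<in> A"
  shows "\<mu> (tensor_op t p b) = p o\<^sub>L b \<and> p o\<^sub>L b = b o\<^sub>L p"
  using b
proof (induction rule: vn_pos_induct[OF vn, consumes 1, case_names pos add scale])
  case (pos b)
  let ?k = "norm b" and ?k1 = "norm b *\<^sub>R id_blinfun :: 'h \<Rightarrow>\<^sub>L 'h"
  \<comment> \<open>Since \<open>b\<close> is not normalised, the squeeze reads
    \<open>0 \<le> \<mu> (q \<otimes> b) \<le> norm b * q\<close>. It is stated for any projection
    because both \<open>p\<close> and its complement are used.\<close>
  have sandwich: "pos_op (\<mu> (tensor_op t q b))" "pos_op (?k *\<^sub>R q - \<mu> (tensor_op t q b))"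
    if q: "q \<in> A" "proj_op q" for q
  proof -
    show "pos_op (\<mu> (tensor_op t q b))"
      using pos q proj_pos by (intro mu_pos tensor_memM pos_tensor_op[OF t]) auto
    have k1: "?k1 \<in> A" "?k1 - b \<in> A" using pos vn by (auto intro: vn_scaleR vn_diff vn_id)
    have "tensor_op t q (scale_op (complex_of_real ?k) id_blinfun) =
        scale_op (complex_of_real ?k) (tensor_op t q id_blinfun)"
      by (rule tensor_op_scale_right[OF t]) (use memA q in auto)
    then have "\<mu> (tensor_op t q ?k1) = ?k *\<^sub>R q"
      using q tensor_memM[OF q(1) vn_id[OF vn]] by (simp add: scale_op_of_real mu_scaleR mu_id_right)
    moreover have "tensor_op t q ?k1 = tensor_op t q (?k1 - b) + tensor_op t q b"
      using tensor_op_add_right[OF t, of "?k1 - b" b q] memA k1 pos q by simp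
    ultimately have "?k *\<^sub>R q - \<mu> (tensor_op t q b) = \<mu> (tensor_op t q (?k1 - b))"
      using mu_add[OF tensor_memM[OF q(1) k1(2)] tensor_memM[OF q(1) pos(1)]]
      by (simp add: eq_diff_eq[symmetric])
    also have "pos_op \<dots>"
      using q k1 selfadj_shift_pos(2)[OF pos_selfadj[OF pos(2)]]
        proj_pos
      by (intro mu_pos tensor_memM pos_tensor_op[OF t]) auto
    finally show "pos_op (?k *\<^sub>R q - \<mu> (tensor_op t q b))" .
  qed
  define q where "q = id_blinfun - p"
  have q: "q \<in> A" "proj_op q" using p vn by (auto simp: q_def proj_compl vn_diff vn_id)
  define m n where "m = \<mu> (tensor_op t p b)" and "n = \<mu> (tensor_op t q b)"
  have m: "m o\<^sub>L p = m" "p o\<^sub>L m = m"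
    unfolding m_def by (rule pos_below_proj[OF p(2) sandwich[OF p]])+
  have n: "n o\<^sub>L q = n" "q o\<^sub>L n = n"
    unfolding n_def by (rule pos_below_proj[OF q(2) sandwich[OF q]])+
  have pn: "p o\<^sub>L n = 0" "n o\<^sub>L p = 0"
    using n proj_idem[OF p(2)] unfolding q_def compose_simps by auto
  have "tensor_op t p b + tensor_op t q b = tensor_op t id_blinfun b"
    using tensor_op_add_left[OF t, of p q b] memA p q pos by (simp add: q_def)
  then have "m + n = b"
    using mu_add[OF tensor_memM[OF p(1) pos(1)] tensor_memM[OF q(1) pos(1)]] mu_id_left[OF pos(1)]
    by (simp add: m_def n_def)
  then have "p o\<^sub>L b = m" "b o\<^sub>L p = m"
    using m pn by (auto simp: compose_simps)
  then show ?case by (simp add: m_def)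
next
  case (add b c)
  have "tensor_op t p (b + c) = tensor_op t p b + tensor_op t p c"
    using add memA p by (intro tensor_op_add_right[OF t]) auto
  then show ?case
    using add p mu_add[OF tensor_memM tensor_memM] by (simp add: compose_simps)
next
  case (scale z b)
  have "tensor_op t p (scale_op z b) = scale_op z (tensor_op t p b)"
    using scale memA p by (intro tensor_op_scale_right[OF t]) auto
  then show ?case
    using scale p mu_scale[OF tensor_memM] memA by (simp add: scale_compose compose_scale)
qed

text \<open>The elements commuting with \<open>b\<close> form a closed subspace, which contains the
  projections of \<open>A\<close> by \<open>mu_proj\<close>.\<close>

lemma commutative:
  assumes a: "a \<in> A" and b: "b \<in> A"
  shows "a o\<^sub>L b = b o\<^sub>L a"
  using a
proof (induction rule: vn_selfadj_induct[OF vn, consumes 1, case_names selfadj add scale])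
  case (selfadj a)
  have "a \<in> {a. a o\<^sub>L b = b o\<^sub>L a}"
  proof (rule spectral_induct[OF vn])
    show "closed {a. a o\<^sub>L b = b o\<^sub>L a}"
      by (intro closed_Collect_eq bounded_bilinear.continuous_on[OF bounded_bilinear_blinfun_compose]
          continuous_intros)
    show "subspace {a. a o\<^sub>L b = b o\<^sub>L a}"
      by (auto simp: subspace_def compose_simps)
  qed (use selfadj mu_proj b in auto)
  then show ?case by simp
next
  case (scale z a)
  then show ?case using memA b by (simp add: scale_compose compose_scale)
qed (simp add: compose_simps)

lemma commutative_apply:
  "a \<in> A \<Longrightarrow> b \<in> A \<Longrightarrow> blinfun_apply a (blinfun_apply b x) = blinfun_apply b (blinfun_apply a x)"
  using commutative by (metis blinfun_apply_blinfun_compose)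

text \<open>Generators commute with each other, so \<open>S\<close> commutes with generators, so
  \<open>T\<close> commutes with \<open>S\<close>: the bicommutant property is used twice.\<close>

lemma commutativeM:
  assumes "S \<in> M" "T \<in> M"
  shows "S o\<^sub>L T = T o\<^sub>L S"
proof (rule blinfun_eqI)
  fix z
  have gen: "tensor_op t a b o\<^sub>L tensor_op t c d = tensor_op t c d o\<^sub>L tensor_op t a b"
    if "a \<in> A" "b \<in> A" "c \<in> A" "d \<in> A" for a b c d
    using that memA commutative by (simp add: tensor_op_compose[OF t])
  have gen': "tensor_op t a b (tensor_op t c d z) = tensor_op t c d (tensor_op t a b z)"
    if "a \<in> A" "b \<in> A" "c \<in> A" "d \<in> A" for a b c d z
    using gen[OF that] by (metis blinfun_apply_blinfun_compose)
  have "S (tensor_op t a b z) = tensor_op t a b (S z)" if "a \<in> A" "b \<in> A" for a b z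
    by (intro spatial_tensor_commute[OF t assms(1)] tensor_op_bounded[OF t] memA gen' that)
  then have "T (S z) = S (T z)"
    by (intro spatial_tensor_commute[OF t assms(2)] memM assms)
  then show "(S o\<^sub>L T) z = (T o\<^sub>L S) z" by simp
qed

text \<open>The part \<open>T (1 - q)\<close> lies between 0 and \<open>norm T * (1 - q)\<close>.
  Its image is therefore supported by \<open>1 - \<mu> q\<close> and disappears after multiplication
  by \<open>\<mu> q\<close>. In this way a corner of \<open>T\<close> determines the corresponding
  corner of \<open>\<mu> T\<close>.\<close>

lemma mu_cut:
  assumes T: "T \<in> M" "pos_op T" and q: "q \<in> M" "proj_op q" and e: "proj_op (\<mu> q)"
  shows "\<mu> T o\<^sub>L \<mu> q = \<mu> (T o\<^sub>L q) o\<^sub>L \<mu> q"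
proof -
  let ?r = "id_blinfun - q" and ?k = "norm T" and ?e' = "id_blinfun - \<mu> q"
  let ?R = "T o\<^sub>L ?r"
  have r: "?r \<in> M" "proj_op ?r" using q by (auto intro: vn_diff[OF vnM] vn_id[OF vnM] proj_compl)
  have k: "?k *\<^sub>R id_blinfun - T \<in> M"
    using T by (intro vn_diff[OF vnM] vn_scaleR[OF vnM] vn_id[OF vnM])
  have R: "?R \<in> M" using T r by (intro vn_compose[OF vnM])
  have "pos_op (\<mu> ?R)"
    using T r by (intro mu_pos R proj_commuting_cut_pos commutativeM)
  moreover have "pos_op (?k *\<^sub>R ?e' - \<mu> ?R)"
  proof -
    have "pos_op ((?k *\<^sub>R id_blinfun - T) o\<^sub>L ?r)"
      using selfadj_shift_pos(2)[OF pos_selfadj[OF T(2)]] r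
      by (intro proj_commuting_cut_pos commutativeM k)
    then have "pos_op (\<mu> ((?k *\<^sub>R id_blinfun - T) o\<^sub>L ?r))"
      using vn_compose[OF vnM k r(1)] mu_pos by blast
    also have "(?k *\<^sub>R id_blinfun - T) o\<^sub>L ?r = ?k *\<^sub>R ?r - ?R"
      by (simp add: compose_left_diff compose_left_scaleR)
    also have "\<mu> \<dots> = ?k *\<^sub>R ?e' - \<mu> ?R"
      using R r q by (simp add: mu_diff mu_scaleR mu_id vn_scaleR[OF vnM] vn_id[OF vnM])
    finally show ?thesis .
  qed
  ultimately have "\<mu> ?R o\<^sub>L ?e' = \<mu> ?R"
    by (intro pos_below_proj[OF proj_compl[OF e]])
  then have "\<mu> ?R o\<^sub>L \<mu> q = 0" by (simp add: compose_simps)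
  moreover have "\<mu> ?R = \<mu> T - \<mu> (T o\<^sub>L q)"
    using T q by (simp add: compose_right_diff mu_diff vn_compose[OF vnM])
  ultimately show ?thesis by (simp add: compose_simps)
qed

lemma mu_normal:
  assumes D: "D \<subseteq> M" "\<And>d. d \<in> D \<Longrightarrow> selfadj_op d" "D \<noteq> {}"
    and dir: "\<And>a b. a \<in> D \<Longrightarrow> b \<in> D \<Longrightarrow> \<exists>c\<in>D. pos_op (c - a) \<and> pos_op (c - b)"
    and s: "sup_alg (op_algebra M) D s"
  shows "sup_alg (op_algebra A) (\<mu> ` D) (\<mu> s)"
proof -
  have "D \<subseteq> self_adj (op_algebra M)" using D by (auto simp: self_adj_op_algebra[OF vnM])
  moreover have "directed_alg (op_algebra M) D"
    using D dir by (simp add: directed_op_algebra[OF vnM])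
  moreover have "upper_bound_alg (op_algebra M) D s" using s by (simp add: sup_alg_def)
  ultimately show ?thesis
    using dup s unfolding duplicator_def Let_def normal_alg_def by blast
qed

end

subsection \<open>The diagonal element and minimal projections\<close>

definition minimal_projection :: "('h::complex_hilbert \<Rightarrow>\<^sub>L 'h) set \<Rightarrow> ('h \<Rightarrow>\<^sub>L 'h) \<Rightarrow> bool"
  where "minimal_projection A q \<longleftrightarrow> q \<in> A \<and> proj_op q \<and> q \<noteq> 0 \<and>
    (\<forall>r\<in>A. proj_op r \<and> q o\<^sub>L r = r \<longrightarrow> r = 0 \<or> r = q)"

lemma proj_diff:
  assumes "proj_op p" "proj_op r" "p o\<^sub>L r = r" "r o\<^sub>L p = r"
  shows "proj_op (p - r)"
  using assms by (simp add: proj_op_def selfadj_diff compose_simps)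

lemma proj_sup:
  assumes v: "proj_op v" and w: "proj_op w" and c: "v o\<^sub>L w = w o\<^sub>L v"
  shows "proj_op (v + w - (v o\<^sub>L w))" "pos_op (v + w - (v o\<^sub>L w) - v)"
    "pos_op (v + w - (v o\<^sub>L w) - w)" "pos_op (v o\<^sub>L w)"
proof -
  have vw: "proj_op (v o\<^sub>L w)" by (rule proj_compose[OF v w c])
  have 1: "v o\<^sub>L (v o\<^sub>L w) = v o\<^sub>L w" "w o\<^sub>L (v o\<^sub>L w) = v o\<^sub>L w"
    "(v o\<^sub>L w) o\<^sub>L v = v o\<^sub>L w" "(v o\<^sub>L w) o\<^sub>L w = v o\<^sub>L w"
    using c proj_idem[OF v] proj_idem[OF w] by (metis blinfun_compose_assoc)+
  show "proj_op (v + w - (v o\<^sub>L w))"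
    unfolding proj_op_def
  proof
    show "selfadj_op (v + w - (v o\<^sub>L w))"
      using v w vw by (intro selfadj_diff selfadj_add proj_selfadj)
    show "(v + w - (v o\<^sub>L w)) o\<^sub>L (v + w - (v o\<^sub>L w)) = v + w - (v o\<^sub>L w)"
      using 1 c proj_idem[OF v] proj_idem[OF w] proj_idem[OF vw] by (simp add: compose_simps)
  qed
  have "proj_op (w - (v o\<^sub>L w))" "proj_op (v - (v o\<^sub>L w))"
    using 1 v w vw by (auto intro: proj_diff)
  then show "pos_op (v + w - (v o\<^sub>L w) - v)" "pos_op (v + w - (v o\<^sub>L w) - w)"
    using proj_pos by (simp_all add: algebra_simps)
  show "pos_op (v o\<^sub>L w)" using proj_pos[OF vw] .
qed

context duplicated_algebra
begin

text \<open>\<open>E\<close> is the complement of the largest projection that \<open>\<mu>\<close> annihilates; it plays the role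
  of the indicator function of the diagonal.\<close>

lemma exists_diagonal:
  obtains E where "E \<in> M" "pos_op E" "pos_op (id_blinfun - E)" "\<mu> E = id_blinfun"
    and "\<And>v. v \<in> M \<Longrightarrow> proj_op v \<Longrightarrow> \<mu> v = 0 \<Longrightarrow> E o\<^sub>L v = 0"
proof -
  define D where "D = {v \<in> M. proj_op v \<and> \<mu> v = 0}"
  have D: "D \<subseteq> M" "\<And>d. d \<in> D \<Longrightarrow> selfadj_op d" "D \<noteq> {}"
    using vn_zero[OF vnM] by (auto simp: D_def proj_selfadj intro!: exI[of _ 0])
  have dir: "\<exists>c\<in>D. pos_op (c - v) \<and> pos_op (c - w)" if "v \<in> D" "w \<in> D" for v w
  proof -
    have v: "v \<in> M" "proj_op v" "\<mu> v = 0" and w: "w \<in> M" "proj_op w" "\<mu> w = 0"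
      using that by (auto simp: D_def)
    let ?c = "v + w - (v o\<^sub>L w)"
    have vw: "v o\<^sub>L w \<in> M" using v w vn_compose[OF vnM] by auto
    have c: "?c \<in> M" using v w vw by (intro vn_diff[OF vnM] vn_add[OF vnM])
    note s = proj_sup[OF v(2) w(2) commutativeM[OF v(1) w(1)]]
    \<comment> \<open>Both \<open>?c\<close> and \<open>v o\<^sub>L w\<close> are projections, so
      \<open>\<mu> ?c\<close> and its negative are positive, which leaves only 0.\<close>
    have "\<mu> ?c = - \<mu> (v o\<^sub>L w)"
      using v w vw by (simp add: mu_diff mu_add vn_add[OF vnM])
    moreover have "pos_op (\<mu> ?c)" "pos_op (\<mu> (v o\<^sub>L w))"
      using s c vw proj_pos by (auto intro!: mu_pos)
    ultimately have "\<mu> ?c = 0"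
      using pos_antisym[of "\<mu> ?c"] by simp
    then have "?c \<in> D" using c s by (simp add: D_def)
    then show ?thesis using s by blast
  qed
  have ub: "pos_op (id_blinfun - d)" if "d \<in> D" for d
    using that by (auto simp: D_def intro: proj_pos proj_compl)
  show thesis
  proof (rule vn_directed_sup[OF vnM, of D id_blinfun])
    fix S assume S: "S \<in> M" "selfadj_op S" "sup_alg (op_algebra M) D S"
    \<comment> \<open>Normality enters here: the image of the family is \<open>{0}\<close>, so the
      supremum is annihilated too.\<close>
    have "sup_alg (op_algebra A) (\<mu> ` D) (\<mu> S)" by (rule mu_normal[OF D dir S(3)])
    moreover have "\<mu> ` D = {0}" using D(3) by (auto simp: D_def)
    moreover have "sup_alg (op_algebra A) {0} 0"
      using vn_zero[OF vn] by (auto simp: sup_alg_def upper_bound_op_algebra[OF vn] le_op_algebra[OF vn])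
    ultimately have muS: "\<mu> S = 0"
      using sup_op_algebra_unique[OF vn, of "{0}"] vn_zero[OF vn] by auto
    have upper: "pos_op (S - d)" if "d \<in> D" for d
      using S D that by (auto simp: sup_alg_def upper_bound_op_algebra[OF vnM])
    have le: "pos_op (id_blinfun - S)"
      using S D ub vn_id[OF vnM]
      by (auto simp: sup_alg_def upper_bound_op_algebra[OF vnM] le_op_algebra[OF vnM])
    have "0 \<in> D" using vn_zero[OF vnM] by (simp add: D_def)
    then have posS: "pos_op S" using upper by force
    have "(id_blinfun - S) o\<^sub>L v = 0" if v: "v \<in> M" "proj_op v" "\<mu> v = 0" for v
    proof (rule blinfun_eqI)
      fix z
      have "pos_op (S - v)" using v by (intro upper) (simp add: D_def)
      \<comment> \<open>On the range of \<open>v\<close> the form of \<open>S\<close> is at least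
        the squared norm, which leaves no positive value to the form of
        \<open>1 - S\<close>.\<close>
      then have "qform v (v z) \<le> qform S (v z)" by (rule pos_diff_qform)
      then have "qform (id_blinfun - S) (v z) \<le> 0"
        using v(2) by (simp add: qform_diff proj_qform)
      then have "qform (id_blinfun - S) (v z) = 0"
        using pos_qform[OF le, of "v z"] by simp
      then show "((id_blinfun - S) o\<^sub>L v) z = blinfun_apply 0 z"
        using pos_qform_zero[OF le] by simp
    qed
    moreover have "id_blinfun - S \<in> M" using S vn_diff[OF vnM] vn_id[OF vnM] by auto
    moreover have "\<mu> (id_blinfun - S) = id_blinfun"
      using S muS by (simp add: mu_diff mu_id vn_id[OF vnM])
    ultimately show thesis using le posS by (intro that[of "id_blinfun - S"]) auto
  qed (use D dir ub in auto)
qed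

text \<open>The elementary inclusion of the commutation theorem for tensor products: tensors of
  commutant elements commute with the tensor square.\<close>

lemma tensor_commutant_commute:
  assumes T: "T \<in> M" and c: "c \<in> commutant A" "d \<in> commutant A"
  shows "blinfun_apply T (blinfun_apply (tensor_op t c d) z) = blinfun_apply (tensor_op t c d) (blinfun_apply T z)"
proof (rule spatial_tensor_commute[OF t T])
  have cd: "c \<in> bounded_ops" "d \<in> bounded_ops" using c commutant_bounded by auto
  then show "tensor_op t c d \<in> bounded_ops" by (rule tensor_op_bounded[OF t])
  fix a b z assume ab: "a \<in> A" "b \<in> A"
  have "c o\<^sub>L a = a o\<^sub>L c" "d o\<^sub>L b = b o\<^sub>L d"
    using c ab by (auto simp: commutant_def)
  then have "tensor_op t c d o\<^sub>L tensor_op t a b = tensor_op t a b o\<^sub>L tensor_op t c d"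
    using cd ab memA by (simp add: tensor_op_compose[OF t])
  then show "tensor_op t c d (tensor_op t a b z) = tensor_op t a b (tensor_op t c d z)"
    by (metis blinfun_apply_blinfun_compose)
qed

text \<open>If \<open>E (x \<otimes> x) = 0\<close>, then \<open>E\<close> vanishes on \<open>p \<otimes> r\<close> for projections \<open>p, r \<in> A\<close> that fix \<open>x\<close>,
  so that \<open>1 = \<mu> E \<le> 1 - p r\<close> although \<open>p r\<close> fixes \<open>x\<close>.\<close>

lemma diagonal_nonzero:
  assumes E: "E \<in> M" "pos_op E" "pos_op (id_blinfun - E)" "\<mu> E = id_blinfun" and x: "x \<noteq> 0"
  shows "blinfun_apply E (t x x) \<noteq> 0"
proof
  assume E0: "E (t x x) = 0"
  have EB: "E \<in> bounded_ops" using memM E(1) .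
  have com_id: "id_blinfun \<in> commutant A"
    using memA by (intro commutantI) auto
  have comB: "c \<in> bounded_ops" if "c \<in> commutant A" for c
    using that commutant_bounded by auto
  have E_left: "E (t (c y) z) = 0" if "c \<in> commutant A" "E (t y z) = 0" for c y z
    using tensor_commutant_commute[OF E(1) that(1) com_id, of "t y z"] that
    by (simp add: tensor_op_apply[OF t] comB blinfun.zero_right)
  have E_right: "E (t y (c z)) = 0" if "c \<in> commutant A" "E (t y z) = 0" for c y z
    using tensor_commutant_commute[OF E(1) com_id that(1), of "t y z"] that
    by (simp add: tensor_op_apply[OF t] comB blinfun.zero_right)
  have clE: "closed {y. E (t y z) = 0}" "closed {y. E (t z y) = 0}" for z
    by (intro closed_Collect_eq continuous_intros
        bounded_bilinear.continuous_on[OF bounded_bilinear_tensor[OF t]])+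
  \<comment> \<open>By \<open>E_left\<close>, \<open>V\<close> is invariant under the commutant, so
    its projection \<open>p\<close> lies in \<open>A\<close>; the assumption puts \<open>x\<close>
    into \<open>V\<close>.\<close>
  define V where "V = {y. E (t y x) = 0}"
  have "csubspace V" "closed V"
    using clE by (auto simp: V_def csubspace_def subspace_def tensor_add_left[OF t] tensor_scaleR_left[OF t]
        tensor_scaleC_left[OF t] tensor_zero_left[OF t] blinfun.bilinear_simps bounded_opsD[OF EB])
  then obtain p where p: "proj_op p" "\<And>y. p y \<in> V" "\<And>y. y \<in> V \<Longrightarrow> p y = y"
    using exists_projection by blast
  have pV: "p y = y \<longleftrightarrow> y \<in> V" for y using p by metis
  have pA: "p \<in> A"
    by (rule vn_proj_memI[OF vn p(1)]) (simp add: pV V_def E_left)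
  have px: "p x = x" using E0 by (simp add: pV V_def)
  \<comment> \<open>The second factor is enlarged against the whole range of \<open>p\<close>, not
    only against \<open>x\<close>, so that \<open>E\<close> vanishes on all of
    \<open>p \<otimes> r\<close>.\<close>
  define W where "W = {y. \<forall>z. E (t (p z) y) = 0}"
  have "closed W"
    unfolding W_def by (intro closed_Collect_all clE)
  moreover have "csubspace W"
    by (auto simp: W_def csubspace_def subspace_def tensor_add_right[OF t] tensor_scaleR_right[OF t]
        tensor_scaleC_right[OF t] tensor_zero_right[OF t] blinfun.bilinear_simps bounded_opsD[OF EB])
  ultimately obtain r where r: "proj_op r" "\<And>y. r y \<in> W" "\<And>y. y \<in> W \<Longrightarrow> r y = y"
    using exists_projection by blast
  have rW: "r y = y \<longleftrightarrow> y \<in> W" for y using r by metis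
  have rA: "r \<in> A"
    by (rule vn_proj_memI[OF vn r(1)]) (simp add: rW W_def E_right)
  have rx: "r x = x" using p(2) by (simp add: rW W_def V_def)
  define Q where "Q = tensor_op t p r"
  have QM: "Q \<in> M" and pQ: "proj_op Q"
    unfolding Q_def by (auto intro: tensor_memM pA rA proj_tensor_op[OF t] p r)
  have EQ: "E o\<^sub>L Q = 0"
    by (rule tensor_op_ext[OF t])
      (use r(2) memA pA rA in \<open>simp add: Q_def tensor_op_apply[OF t] W_def\<close>)
  have QE: "Q o\<^sub>L E = 0" using EQ commutativeM[OF QM E(1)] by simp
  \<comment> \<open>A product of commuting positive operators, hence positive:
    \<open>Q + E \<le> 1\<close>. Applying \<open>\<mu>\<close> gives
    \<open>p r \<le> 0\<close>.\<close>
  have "(id_blinfun - E) o\<^sub>L (id_blinfun - Q) = id_blinfun - Q - E"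
    using EQ by (simp add: compose_simps)
  moreover have "pos_op ((id_blinfun - E) o\<^sub>L (id_blinfun - Q))"
    using E QM pQ by (intro proj_commuting_cut_pos proj_compl commutativeM vn_diff[OF vnM] vn_id[OF vnM])
  ultimately have "pos_op (\<mu> (id_blinfun - Q - E))"
    using E QM by (intro mu_pos) (auto intro: vn_diff[OF vnM] vn_id[OF vnM])
  also have "\<mu> (id_blinfun - Q - E) = - (p o\<^sub>L r)"
    using E QM mu_proj[OF pA p(1) rA]
    by (simp add: mu_diff mu_id vn_diff[OF vnM] vn_id[OF vnM]) (simp add: Q_def)
  finally have "0 \<le> qform (- (p o\<^sub>L r)) x" by (rule pos_qform)
  also have "qform (- (p o\<^sub>L r)) x = - (norm x)\<^sup>2"
    using px rx by (simp add: qform_def blinfun.minus_left Re_cinner_self)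
  finally show False using x by simp
qed

text \<open>Passing to complements turns the decreasing chain into an increasing directed set with a
  supremum. Idempotence survives the strong limit because both sides of
  \<open>\<langle>r y, r x\<rangle> = \<langle>y, r x\<rangle>\<close> converge.\<close>

lemma chain_projection_limit:
  assumes C: "C \<subseteq> A" "\<And>r. r \<in> C \<Longrightarrow> proj_op r" "C \<noteq> {}"
    and chain: "\<And>r r'. r \<in> C \<Longrightarrow> r' \<in> C \<Longrightarrow> r o\<^sub>L r' = r' \<or> r' o\<^sub>L r = r"
  obtains F u where "F \<noteq> bot" "\<forall>\<^sub>F r in F. r \<in> C"
    "\<And>x. ((\<lambda>r. blinfun_apply r x) \<longlongrightarrow> blinfun_apply u x) F"
    "u \<in> A" "proj_op u" "\<And>r. r \<in> C \<Longrightarrow> r o\<^sub>L u = u"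
proof -
  have CA: "r \<in> A" if "r \<in> C" for r using that C by auto
  have below: "pos_op (r - r')" if "r \<in> C" "r' \<in> C" "r o\<^sub>L r' = r'" for r r'
    using that C(2) commutative[OF CA CA, of r r'] by (intro proj_pos proj_diff) auto
  define D where "D = (\<lambda>r. id_blinfun - r) ` C"
  have D: "D \<subseteq> A" "\<And>d. d \<in> D \<Longrightarrow> selfadj_op d" "D \<noteq> {}"
    using C CA by (auto simp: D_def proj_selfadj selfadj_diff intro: vn_diff[OF vn] vn_id[OF vn])
  have self: "pos_op (r - r)" for r :: "'h \<Rightarrow>\<^sub>L 'h" by simp
  have dir: "\<exists>c\<in>D. pos_op (c - a) \<and> pos_op (c - b)" if ab: "a \<in> D" "b \<in> D" for a b
  proof -
    obtain r r' where r: "a = id_blinfun - r" "b = id_blinfun - r'" "r \<in> C" "r' \<in> C"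
      using ab by (auto simp: D_def)
    consider "r o\<^sub>L r' = r'" | "r' o\<^sub>L r = r" using chain r by blast
    then show ?thesis
    proof cases
      case 1
      then show ?thesis using below[of r r'] r ab(2) self by (intro bexI[of _ b]) auto
    next
      case 2
      then show ?thesis using below[of r' r] r ab(1) self by (intro bexI[of _ a]) auto
    qed
  qed
  have ub: "pos_op (id_blinfun - d)" if "d \<in> D" for d
    using that C(2) by (auto simp: D_def proj_pos)
  show thesis
  proof (rule vn_directed_sup[OF vn, of D id_blinfun])
    fix F S
    assume F: "F \<noteq> bot" and ev: "\<And>d. d \<in> D \<Longrightarrow> \<forall>\<^sub>F d' in F. d' \<in> D \<and> pos_op (d' - d)"
      and lim: "\<And>x. ((\<lambda>d. blinfun_apply d x) \<longlongrightarrow> blinfun_apply S x) F" and S: "S \<in> A" "selfadj_op S"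
    define G where "G = filtermap (\<lambda>d. id_blinfun - d) F"
    define u where "u = id_blinfun - S"
    have G: "G \<noteq> bot" using F by (simp add: G_def filtermap_bot_iff)
    have limG: "((\<lambda>r. blinfun_apply r x) \<longlongrightarrow> blinfun_apply u x) G" for x
      unfolding G_def u_def using lim[of x]
      by (auto simp: filterlim_filtermap blinfun.diff_left intro!: tendsto_diff)
    obtain r0 where r0: "r0 \<in> C" using C(3) by blast
    have evG: "\<forall>\<^sub>F r' in G. r' \<in> C \<and> pos_op (r - r')" if "r \<in> C" for r
    proof -
      have "id_blinfun - r \<in> D" using that by (auto simp: D_def)
      from ev[OF this] show ?thesis
        unfolding G_def eventually_filtermap by eventually_elim (auto simp: D_def algebra_simps)
    qed
    have uA: "u \<in> A" using S by (auto simp: u_def intro: vn_diff[OF vn] vn_id[OF vn])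
    have saU: "selfadj_op u" using S by (simp add: u_def selfadj_diff)
    have "u o\<^sub>L u = u"
    proof (rule blinfun_eqI, rule cinner_ext)
      fix x y
      have "((\<lambda>r. cinner (blinfun_apply r y) (blinfun_apply r x)) \<longlongrightarrow> cinner (u y) (u x)) G"
        by (intro tendsto_cinner limG)
      moreover have "\<forall>\<^sub>F r in G. cinner (blinfun_apply r y) (blinfun_apply r x) = cinner y (blinfun_apply r x)"
        using evG[OF r0] by eventually_elim (use C(2) in \<open>auto simp: selfadjD[OF proj_selfadj]\<close>)
      ultimately have "((\<lambda>r. cinner y (blinfun_apply r x)) \<longlongrightarrow> cinner (u y) (u x)) G"
        by (simp add: tendsto_cong)
      moreover have "((\<lambda>r. cinner y (blinfun_apply r x)) \<longlongrightarrow> cinner y (u x)) G"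
        by (intro tendsto_cinner tendsto_const limG)
      ultimately have "cinner (u y) (u x) = cinner y (u x)" using tendsto_unique[OF G] by blast
      then show "cinner y ((u o\<^sub>L u) x) = cinner y (u x)" by (simp add: selfadjD[OF saU])
    qed
    moreover have "r o\<^sub>L u = u" if r: "r \<in> C" for r
    proof (rule blinfun_eqI)
      fix x
      have "((\<lambda>r'. r (blinfun_apply r' x)) \<longlongrightarrow> r (u x)) G"
        by (intro blinfun.tendsto tendsto_const limG)
      moreover have "\<forall>\<^sub>F r' in G. r (blinfun_apply r' x) = blinfun_apply r' x"
        using evG[OF r]
      proof eventually_elim
        case (elim r')
        then have "r' o\<^sub>L r = r'" "r o\<^sub>L r' = r'"
          using pos_below_proj[of r r' 1] C(2) r proj_pos by auto
        then show ?case by (metis blinfun_apply_blinfun_compose)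
      qed
      ultimately have "((\<lambda>r'. blinfun_apply r' x) \<longlongrightarrow> r (u x)) G"
        by (simp add: tendsto_cong)
      then have "r (u x) = u x" by (rule tendsto_unique[OF G _ limG])
      then show "(r o\<^sub>L u) x = u x" by simp
    qed
    ultimately show thesis
      using that[of G u] G evG[OF r0] limG uA saU by (simp add: proj_op_def eventually_conj_iff)
  qed (use D dir ub in auto)
qed

text \<open>\<open>G r = \<langle>x \<otimes> x, E (r x \<otimes> x)\<rangle>\<close> is additive in the projection \<open>r\<close> and at most \<open>\<parallel>r x\<parallel>\<^sup>4\<close>.
  Zorn's lemma yields a minimal \<open>r\<close> with \<open>G r \<ge> \<epsilon> \<parallel>r x\<parallel>\<^sup>2 > 0\<close>: since this forces
  \<open>\<parallel>r x\<parallel>\<^sup>2 \<ge> \<epsilon>\<close>, the condition passes to limits of chains, and if it holds for \<open>r\<close> it holds for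
  one of any two complementary parts of \<open>r\<close>.\<close>

lemma exists_minimal_projection:
  assumes x: "x \<noteq> 0"
  shows "\<exists>q. minimal_projection A q \<and> blinfun_apply q x \<noteq> 0"
proof -
  obtain E where E: "E \<in> M" "pos_op E" "pos_op (id_blinfun - E)" "\<mu> E = id_blinfun"
    and kill: "\<And>v. v \<in> M \<Longrightarrow> proj_op v \<Longrightarrow> \<mu> v = 0 \<Longrightarrow> E o\<^sub>L v = 0"
    using exists_diagonal by blast
  define m where "m r = (norm (blinfun_apply r x))\<^sup>2" for r :: "'h \<Rightarrow>\<^sub>L 'h"
  \<comment> \<open>The projection occurs only once, which makes additivity immediate. That
    \<open>G\<close> is the form of \<open>E\<close> at \<open>r x \<otimes> r x\<close> is a
    separate fact: \<open>E\<close> kills \<open>r \<otimes> (1 - r)\<close> because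
    \<open>\<mu>\<close> sends it to \<open>r (1 - r) = 0\<close>.\<close>
  define G where "G r = Re (cinner (t x x) (E (t (blinfun_apply r x) x)))" for r
  have G_qform: "G r = qform E (t (r x) (r x))" if r: "r \<in> A" "proj_op r" for r
  proof -
    define s where "s = id_blinfun - r"
    have s: "s \<in> A" "proj_op s" using r by (auto simp: s_def proj_compl vn_diff[OF vn] vn_id[OF vn])
    have "\<mu> (tensor_op t r s) = 0"
      using mu_proj[OF r s(1)] proj_idem[OF r(2)] by (simp add: s_def compose_simps)
    then have "E o\<^sub>L tensor_op t r s = 0"
      using r s by (intro kill tensor_memM proj_tensor_op[OF t])
    then have "(E o\<^sub>L tensor_op t r s) (t x x) = 0" by simp
    then have "E (t (r x) x) = E (t (r x) (r x))"
      using memA r s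
      by (simp add: tensor_op_apply[OF t] s_def blinfun.bilinear_simps tensor_diff_right[OF t])
    moreover define R where "R = tensor_op t r r"
    have R: "R \<in> M" "proj_op R" "R (t x x) = t (r x) (r x)"
      using r memA by (auto simp: R_def tensor_memM proj_tensor_op[OF t] tensor_op_apply[OF t])
    have "E (R (R (t x x))) = R (E (R (t x x)))"
      using commutativeM[OF E(1) R(1)] by (metis blinfun_apply_blinfun_compose)
    then have "cinner (t x x) (E (R (t x x))) = cinner (R (t x x)) (E (R (t x x)))"
      using R(2) selfadjD[OF proj_selfadj[OF R(2)]] by simp
    ultimately show ?thesis
      by (simp add: G_def qform_def R(3))
  qed
  have G_nonneg: "0 \<le> G r" if "r \<in> A" "proj_op r" for r
    using G_qform[OF that] pos_qform[OF E(2)] by simp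
  have G_le: "G r \<le> (m r)\<^sup>2" if "r \<in> A" "proj_op r" for r
    using G_qform[OF that] pos_diff_qform[OF E(3), of "t (r x) (r x)"]
    by (simp add: m_def norm_tensor[OF t] power2_eq_square)
  have G_add: "G (r + s) = G r + G s" for r s
    by (simp add: G_def blinfun.bilinear_simps tensor_add_left[OF t] cinner_simps)
  have m_add: "m (r + s) = m r + m s" if "proj_op r" "proj_op s" "proj_op (r + s)" for r s
    using that by (simp add: m_def qform_add flip: proj_qform)
  have m_id: "m id_blinfun > 0" using x by (simp add: m_def)
  have G_id: "G id_blinfun > 0"
  proof -
    have "G id_blinfun \<noteq> 0"
      using G_qform[OF vn_id[OF vn] proj_id] diagonal_nonzero[OF E x] pos_qform_zero[OF E(2)] by auto
    then show ?thesis using G_nonneg[OF vn_id[OF vn] proj_id] by simp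
  qed
  \<comment> \<open>The ratio at the identity, so that the identity is a good projection to start
    from.\<close>
  define \<epsilon> where "\<epsilon> = G id_blinfun / m id_blinfun"
  have \<epsilon>: "\<epsilon> > 0" using G_id m_id by (simp add: \<epsilon>_def)
  define good where "good = {r \<in> A. proj_op r \<and> m r > 0 \<and> \<epsilon> * m r \<le> G r}"
  have good_m: "\<epsilon> \<le> m r" if "r \<in> good" for r
  proof -
    have r: "m r > 0" "\<epsilon> * m r \<le> G r" "G r \<le> m r * m r"
      using that G_le[of r] unfolding good_def power2_eq_square by blast+
    show ?thesis by (rule mult_right_le_imp_le[OF order_trans[OF r(2,3)] r(1)])
  qed
  have id_good: "id_blinfun \<in> good"
    using m_id vn_id[OF vn] by (auto simp: good_def \<epsilon>_def)
  \<comment> \<open>The order is reversed: \<open>r'\<close> lies below \<open>r\<close>, and the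
    maximal element delivered by Zorn's lemma is a smallest good projection.\<close>
  define P where "P r r' \<longleftrightarrow> r o\<^sub>L r' = r'" for r r' :: "'h \<Rightarrow>\<^sub>L 'h"
  have po: "partial_order_on good (relation_of P good)"
  proof (rule partial_order_on_relation_ofI)
    show "P a a" if "a \<in> good" for a using that by (simp add: P_def good_def proj_idem)
    show "P a c" if "P a b" "P b c" for a b c
      using that unfolding P_def by (metis blinfun_compose_assoc)
    show "a = b" if "a \<in> good" "b \<in> good" "P a b" "P b a" for a b
      using that commutative[of a b] by (simp add: P_def good_def)
  qed
  have "\<exists>u\<in>good. \<forall>a\<in>C. P a u" if C: "C \<in> Chains (relation_of P good)" for C
  proof (cases "C = {}")
    case True
    then show ?thesis using id_good by auto
  next
    case False
    have Cgood: "C \<subseteq> good" and ch: "\<And>a b. a \<in> C \<Longrightarrow> b \<in> C \<Longrightarrow> a o\<^sub>L b = b \<or> b o\<^sub>L a = a"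
      using C by (auto simp: Chains_def relation_of_def P_def)
    have C': "C \<subseteq> A" "\<And>r. r \<in> C \<Longrightarrow> proj_op r" using Cgood by (auto simp: good_def)
    show ?thesis
    proof (rule chain_projection_limit[of C])
      fix F u
      assume F: "F \<noteq> bot" "\<forall>\<^sub>F r in F. r \<in> C" and lim: "\<And>x. ((\<lambda>r. blinfun_apply r x) \<longlongrightarrow> blinfun_apply u x) F"
        and u: "u \<in> A" "proj_op u" and below: "\<And>r. r \<in> C \<Longrightarrow> r o\<^sub>L u = u"
      have limm: "(m \<longlongrightarrow> m u) F"
        unfolding m_def by (intro tendsto_intros lim)
      have limG: "(G \<longlongrightarrow> G u) F"
        unfolding G_def
        by (intro tendsto_Re tendsto_cinner tendsto_const blinfun.tendsto lim
            bounded_bilinear.tendsto[OF bounded_bilinear_tensor[OF t]])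
      have "\<epsilon> \<le> m u"
        by (rule tendsto_lowerbound[OF limm _ F(1)])
          (use F(2) Cgood good_m in \<open>auto elim!: eventually_mono\<close>)
      moreover have "\<epsilon> * m u \<le> G u"
        by (rule tendsto_le[OF F(1) limG tendsto_mult[OF tendsto_const limm]])
          (use F(2) Cgood in \<open>auto elim!: eventually_mono simp: good_def\<close>)
      ultimately have "u \<in> good" using u \<epsilon> by (simp add: good_def)
      then show ?thesis using below by (auto simp: P_def)
    qed (use C' False ch in auto)
  qed
  then obtain q where q: "q \<in> good" and qmin: "\<And>r. r \<in> good \<Longrightarrow> q o\<^sub>L r = r \<Longrightarrow> r = q"
  proof -
    have "\<exists>q\<in>good. \<forall>r\<in>good. P q r \<longrightarrow> r = q"
      by (rule predicate_Zorn[OF po]) fact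
    then show ?thesis using that unfolding P_def by blast
  qed
  have q': "q \<in> A" "proj_op q" "m q > 0" "\<epsilon> * m q \<le> G q" using q by (auto simp: good_def)
  have "r = 0 \<or> r = q" if r: "r \<in> A" "proj_op r" "q o\<^sub>L r = r" for r
  proof -
    define s where "s = q - r"
    have rq: "r o\<^sub>L q = r" using commutative[OF q'(1) r(1)] r(3) by simp
    have s: "s \<in> A" "proj_op s" "q o\<^sub>L s = s"
      using q' r rq by (auto simp: s_def vn_diff[OF vn] proj_diff compose_simps proj_idem)
    have Gq: "G q = G r + G s" and mq: "m q = m r + m s"
      using G_add[of r s] m_add[OF r(2) s(2)] q'(2) by (simp_all add: s_def)
    have nn: "0 \<le> m r" "0 \<le> m s" by (simp_all add: m_def)
    have zero: "G p = 0" if "p \<in> A" "proj_op p" "m p = 0" for p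
      using G_le[OF that(1,2)] G_nonneg[OF that(1,2)] that(3) by simp
    \<comment> \<open>Otherwise \<open>G \<le> \<epsilon> * m\<close> on both parts, with equality
      only for mass 0. Adding up and comparing with \<open>q\<close> forces equality twice, so
      \<open>q\<close> would have mass 0.\<close>
    have "r \<in> good \<or> s \<in> good"
    proof (rule ccontr)
      assume "\<not> (r \<in> good \<or> s \<in> good)"
      then have *: "m r = 0 \<or> G r < \<epsilon> * m r" "m s = 0 \<or> G s < \<epsilon> * m s"
        using r s nn by (auto simp: good_def)
      have "G r \<le> \<epsilon> * m r" "G s \<le> \<epsilon> * m s"
        using * zero[OF r(1,2)] zero[OF s(1,2)] by auto
      moreover have "\<epsilon> * m q = \<epsilon> * m r + \<epsilon> * m s" by (simp add: mq distrib_left)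
      ultimately have "G r = \<epsilon> * m r" "G s = \<epsilon> * m s"
        using q'(4) Gq by linarith+
      then have "m r = 0" "m s = 0" using * by auto
      then show False using mq q'(3) by simp
    qed
    then have "r = q \<or> s = q" using qmin r(3) s(3) by blast
    then show ?thesis by (auto simp: s_def)
  qed
  moreover have "q x \<noteq> 0" using q'(3) by (auto simp: m_def)
  moreover from this have "q \<noteq> 0" by auto
  ultimately show ?thesis
    using q' unfolding minimal_projection_def by blast
qed

end

lemma minimal_projectionD:
  assumes "minimal_projection A q"
  shows "q \<in> A" "proj_op q" "q \<noteq> 0"
    and "\<And>r. r \<in> A \<Longrightarrow> proj_op r \<Longrightarrow> q o\<^sub>L r = r \<Longrightarrow> r = 0 \<or> r = q"
  using assms by (auto simp: minimal_projection_def)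

lemma proj_unit_vector:
  assumes q: "proj_op q" "q \<noteq> 0"
  shows "\<exists>\<xi>. blinfun_apply q \<xi> = \<xi> \<and> norm \<xi> = 1"
proof -
  obtain y where y: "q y \<noteq> 0" using q(2) by (metis blinfun_eqI blinfun.zero_left)
  have "q ((1 / norm (q y)) *\<^sub>R q y) = (1 / norm (q y)) *\<^sub>R q y"
    using q(1) by (simp add: blinfun.scaleR_right)
  then show ?thesis using y by (intro exI[of _ "(1 / norm (q y)) *\<^sub>R q y"]) auto
qed

context duplicated_algebra
begin

text \<open>A projection of \<open>A\<close> either annihilates the range of \<open>q\<close> or
  contains it, so it acts there as 0 or 1; linearity and density give a scalar for every element.
  The range may have any positive dimension, and \<open>\<xi>\<close> only serves to read off the
  scalar.\<close>

lemma minimal_projection_eigenvalue: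
  assumes q: "minimal_projection A q" and \<xi>: "blinfun_apply q \<xi> = \<xi>" "norm \<xi> = 1" and a: "a \<in> A"
  shows "blinfun_apply a (blinfun_apply q y) = cinner \<xi> (blinfun_apply a \<xi>) *\<^sub>C blinfun_apply q y"
  using a
proof (induction arbitrary: y rule: vn_selfadj_induct[OF vn, consumes 1, case_names selfadj add scale])
  case (selfadj a)
  let ?W = "{a. \<forall>y. blinfun_apply a (q y) = cinner \<xi> (blinfun_apply a \<xi>) *\<^sub>C q y}"
  note q' = minimal_projectionD[OF q]
  have "a \<in> ?W"
  proof (rule spectral_induct[OF vn])
    have "continuous_on UNIV (\<lambda>c. c *\<^sub>C z)" for z :: 'h
    proof (rule linear_continuous_on, rule bounded_linear_intro[where K = "norm z"])
      show "(r *\<^sub>R c) *\<^sub>C z = r *\<^sub>R (c *\<^sub>C z)" for r c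
        by (simp add: scaleR_eq_scaleC[of r "c *\<^sub>C z"] scaleC_scaleC scaleR_conv_of_real)
    qed (simp_all add: scaleC_add_left norm_scaleC)
    moreover have "continuous_on UNIV (\<lambda>a. cinner \<xi> (blinfun_apply a \<xi>))"
      by (intro continuous_on_cinner continuous_intros)
    ultimately have "continuous_on UNIV (\<lambda>a. cinner \<xi> (blinfun_apply a \<xi>) *\<^sub>C z)" for z :: 'h
      by (rule continuous_on_compose2[OF _ _ subset_UNIV])
    then have "closed {a. blinfun_apply a (q y) = cinner \<xi> (blinfun_apply a \<xi>) *\<^sub>C q y}" for y
      by (intro closed_Collect_eq continuous_intros)
    then show "closed ?W" by (rule closed_Collect_all)
    show "subspace ?W"
      by (auto simp: subspace_def blinfun.bilinear_simps cinner_simps scaleC_add_left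
          scaleR_eq_scaleC scaleC_scaleC scaleR_conv_of_real)
    fix p assume p: "p \<in> A" "proj_op p"
    have pq: "p o\<^sub>L q = q o\<^sub>L p" using commutative p(1) q'(1) .
    have "q o\<^sub>L (p o\<^sub>L q) = p o\<^sub>L q"
      using pq proj_idem[OF q'(2)] by (metis blinfun_compose_assoc)
    then have "p o\<^sub>L q = 0 \<or> p o\<^sub>L q = q"
      using q'(4) vn_compose[OF vn p(1) q'(1)] proj_compose[OF p(2) q'(2) pq] by blast
    then show "p \<in> ?W"
    proof
      assume "p o\<^sub>L q = 0"
      then have *: "p (q y) = 0" for y by (metis blinfun_apply_blinfun_compose blinfun.zero_left)
      then have "p \<xi> = 0" using *[of \<xi>] \<xi>(1) by simp
      then show ?thesis using * by simp
    next
      assume "p o\<^sub>L q = q"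
      then have *: "p (q y) = q y" for y by (metis blinfun_apply_blinfun_compose)
      then have "p \<xi> = \<xi>" using *[of \<xi>] \<xi>(1) by simp
      then have "cinner \<xi> (p \<xi>) = 1" using \<xi>(2) by (simp add: cinner_self_eq)
      then show ?thesis using * by simp
    qed
  qed (use selfadj in auto)
  then show ?case by simp
next
  case (add a b)
  then show ?case by (simp add: blinfun.add_left cinner_simps scaleC_add_left)
next
  case (scale z a)
  then show ?case by (simp add: cinner_simps scaleC_scaleC)
qed

section \<open>Minimal projections as the points of the algebra\<close>

lemma minimal_projections_separate:
  assumes "\<And>q y. minimal_projection A q \<Longrightarrow> blinfun_apply a (blinfun_apply q y) = blinfun_apply b (blinfun_apply q y)"
    and a: "a \<in> A" "b \<in> A"
  shows "a = b"
proof (rule blinfun_eqI, rule ccontr)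
  fix y assume "a y \<noteq> b y"
  then have "a y - b y \<noteq> 0" by simp
  then obtain q where q: "minimal_projection A q" "q (a y - b y) \<noteq> 0"
    using exists_minimal_projection by blast
  have "q (a y) = q (b y)"
    using assms(1)[OF q(1)] commutative_apply[OF minimal_projectionD(1)[OF q(1)]] a by simp
  then show False using q(2) by (simp add: blinfun.diff_right)
qed

text \<open>The product is a subprojection of both factors, so minimality makes it 0 or equal to
  both.\<close>

lemma minimal_projections_orthogonal:
  assumes "minimal_projection A q" "minimal_projection A r" "q \<noteq> r"
  shows "q o\<^sub>L r = 0"
proof -
  note q = minimal_projectionD[OF assms(1)] and r = minimal_projectionD[OF assms(2)]
  have c: "q o\<^sub>L r = r o\<^sub>L q" using commutative q(1) r(1) .
  have qr: "q o\<^sub>L r \<in> A" "proj_op (q o\<^sub>L r)"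
    using vn_compose[OF vn q(1) r(1)] proj_compose[OF q(2) r(2) c] .
  have "q o\<^sub>L (q o\<^sub>L r) = q o\<^sub>L r"
    using proj_idem[OF q(2)] by (simp add: blinfun_compose_assoc[symmetric])
  moreover have "r o\<^sub>L (q o\<^sub>L r) = q o\<^sub>L r"
    unfolding c using proj_idem[OF r(2)] by (simp add: blinfun_compose_assoc[symmetric])
  ultimately have "q o\<^sub>L r = 0 \<or> q o\<^sub>L r = q" "q o\<^sub>L r = 0 \<or> q o\<^sub>L r = r"
    using q(4)[OF qr] r(4)[OF qr] by blast+
  then show ?thesis using assms(3) by auto
qed

lemma sum_minimal_projections:
  assumes "finite Q" "\<And>q. q \<in> Q \<Longrightarrow> minimal_projection A q"
  shows "proj_op (\<Sum>Q)"
  using assms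
proof (induction Q rule: finite_induct)
  case (insert q Q)
  then have p: "proj_op q" "proj_op (\<Sum>Q)" using minimal_projectionD(2)[of A q] by auto
  have "q o\<^sub>L (\<Sum>Q) = (\<Sum>r\<in>Q. q o\<^sub>L r)" "(\<Sum>Q) o\<^sub>L q = (\<Sum>r\<in>Q. r o\<^sub>L q)"
    by (simp_all add: bounded_bilinear.sum_right[OF bounded_bilinear_blinfun_compose]
        bounded_bilinear.sum_left[OF bounded_bilinear_blinfun_compose])
  then have "q o\<^sub>L (\<Sum>Q) = 0" "(\<Sum>Q) o\<^sub>L q = 0"
    using insert minimal_projections_orthogonal by (auto intro!: sum.neutral)
  then have "proj_op (q + \<Sum>Q)"
    using p by (simp add: proj_op_def selfadj_add compose_simps)
  then show ?case using insert by simp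
qed simp


subsection \<open>Uniqueness of the duplicator\<close>

text \<open>The right-hand side does not mention \<open>\<mu>\<close>, which is the whole point: the
  value at each minimal projection is prescribed.\<close>

lemma mu_minimal_projection:
  assumes q: "minimal_projection A q" and \<xi>: "blinfun_apply q \<xi> = \<xi>" "norm \<xi> = 1"
    and T: "T \<in> M" "pos_op T"
  shows "\<mu> T o\<^sub>L q = scale_op (cinner (t \<xi> \<xi>) (blinfun_apply T (t \<xi> \<xi>))) q"
proof -
  note q' = minimal_projectionD[OF q]
  define Q where "Q = tensor_op t q q"
  define \<zeta> where "\<zeta> = t \<xi> \<xi>"
  have QM: "Q \<in> M" and pQ: "proj_op Q"
    using q' by (auto simp: Q_def tensor_memM proj_tensor_op[OF t])
  have QB: "Q \<in> bounded_ops" using pQ by (rule proj_bounded)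
  have muQ: "\<mu> Q = q"
    using mu_proj[OF q'(1,2,1)] proj_idem[OF q'(2)] by (simp add: Q_def)
  have \<zeta>: "Q \<zeta> = \<zeta>" "cinner \<zeta> \<zeta> = 1"
    using \<xi> proj_bounded[OF q'(2)] cinner_self_eq[of \<xi>]
    by (simp_all add: \<zeta>_def Q_def tensor_op_apply[OF t] cinner_tensor[OF t])
  define e where "e a = cinner \<xi> (blinfun_apply a \<xi>)" for a
  have eig: "tensor_op t a b (Q z) = (e a * e b) *\<^sub>C Q z" if ab: "a \<in> A" "b \<in> A" for a b z
  proof -
    have "tensor_op t a b o\<^sub>L Q = scale_op (e a * e b) Q"
      using memA ab q'(1)
      by (intro tensor_op_ext[OF t]) (simp add: Q_def tensor_op_apply[OF t] e_def
          minimal_projection_eigenvalue[OF q \<xi>] tensor_scaleC_left[OF t] tensor_scaleC_right[OF t] scaleC_scaleC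
          mult.commute)
    then have "(tensor_op t a b o\<^sub>L Q) z = scale_op (e a * e b) Q z" by simp
    then show ?thesis by simp
  qed
  \<comment> \<open>The rank-one operators \<open>w \<mapsto> \<langle>\<zeta>, w\<rangle> \<eta>\<close> with \<open>\<eta>\<close> in the range of \<open>Q\<close> commute with \<open>M\<close>.\<close>
  have TQ: "T (Q z) = cinner \<zeta> (T \<zeta>) *\<^sub>C Q z" for z
  proof -
    have bl: "bounded_linear (\<lambda>w. cinner \<zeta> w *\<^sub>C Q z)"
    proof (rule bounded_linear_intro[where K = "norm \<zeta> * norm (Q z)"])
      show "cinner \<zeta> (r *\<^sub>R w) *\<^sub>C Q z = r *\<^sub>R (cinner \<zeta> w *\<^sub>C Q z)" for r w
        by (simp add: cinner_simps scaleR_eq_scaleC[of r "cinner \<zeta> w *\<^sub>C Q z"] scaleC_scaleC scaleR_conv_of_real)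
      show "norm (cinner \<zeta> w *\<^sub>C Q z) \<le> norm w * (norm \<zeta> * norm (Q z))" for w
        using mult_right_mono[OF cinner_Cauchy_Schwarz[of \<zeta> w], of "norm (Q z)"]
        by (simp add: norm_scaleC algebra_simps)
    qed (simp add: cinner_simps scaleC_add_left)
    define V where "V = Blinfun (\<lambda>w. cinner \<zeta> w *\<^sub>C Q z)"
    have V: "V w = cinner \<zeta> w *\<^sub>C Q z" for w
      by (simp add: V_def bounded_linear_Blinfun_apply[OF bl])
    \<comment> \<open>Evaluated at \<open>\<zeta>\<close>, commutation with the rank-one operator
      says that \<open>T\<close> multiplies \<open>Q z\<close> by
      \<open>cinner \<zeta> (T \<zeta>)\<close>.\<close>
    have "T (V \<zeta>) = V (T \<zeta>)"
    proof (rule spatial_tensor_commute[OF t T(1)])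
      show "V \<in> bounded_ops" by (simp add: bounded_ops_def V cinner_simps scaleC_scaleC)
      fix a b w assume ab: "a \<in> A" "b \<in> A"
      let ?S = "tensor_op t a b"
      have S: "?S \<in> bounded_ops" "?S \<in> M" using ab memA by (auto intro: tensor_op_bounded[OF t] tensor_memM)
      have "cinner \<zeta> (?S w) = cinner \<zeta> (Q (?S w))"
        using \<zeta>(1) selfadjD[OF proj_selfadj[OF pQ], of \<zeta> "?S w"] by simp
      also have "Q (?S w) = ?S (Q w)"
        using commutativeM[OF QM S(2)] by (metis blinfun_apply_blinfun_compose)
      also have "cinner \<zeta> (?S (Q w)) = (e a * e b) * cinner \<zeta> w"
        using \<zeta>(1) selfadjD[OF proj_selfadj[OF pQ], of \<zeta> w] by (simp add: eig[OF ab] cinner_simps)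
      finally show "V (?S w) = ?S (V w)"
        using ab bounded_opsD[OF S(1)] by (simp add: V eig scaleC_scaleC mult.commute)
    qed
    then show ?thesis using \<zeta>(2) by (simp add: V)
  qed
  have "T o\<^sub>L Q = scale_op (cinner \<zeta> (T \<zeta>)) Q"
    by (rule blinfun_eqI) (simp add: TQ)
  then have "\<mu> (T o\<^sub>L Q) = scale_op (cinner \<zeta> (T \<zeta>)) q"
    using mu_scale[OF QM] muQ by simp
  \<comment> \<open>As \<open>\<mu> Q = q\<close>, the corner \<open>T o\<^sub>L Q\<close> alone
    decides \<open>\<mu> T o\<^sub>L q\<close>.\<close>
  then show ?thesis
    using mu_cut[OF T QM pQ] q'(2) by (simp add: muQ scale_compose proj_idem \<zeta>_def)
qed

end

text \<open>Minimal projections depend on \<open>A\<close> only, so both duplicators are compared at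
  the same points, and these separate the elements of \<open>A\<close>.\<close>

lemma duplicator_unique:
  assumes A: "von_neumann_algebra A" and t: "hilbert_tensor_product t"
    and dup: "duplicator t A \<mu>" "duplicator t A \<nu>" and T: "T \<in> spatial_tensor t A A"
  shows "\<mu> T = \<nu> T"
proof -
  interpret m: duplicated_algebra t A \<mu> by unfold_locales fact+
  interpret n: duplicated_algebra t A \<nu> by unfold_locales fact+
  show ?thesis
    using T
  proof (induction rule: vn_pos_induct[OF m.vnM, consumes 1, case_names pos add scale])
    case (pos T)
    show ?case
    proof (rule m.minimal_projections_separate)
      fix q y assume q: "minimal_projection A q"
      obtain \<xi> where \<xi>: "q \<xi> = \<xi>" "norm \<xi> = 1"
        using proj_unit_vector minimal_projectionD[OF q] by blast
      have "\<mu> T o\<^sub>L q = \<nu> T o\<^sub>L q"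
        using m.mu_minimal_projection[OF q \<xi> pos] n.mu_minimal_projection[OF q \<xi> pos] by simp
      then show "\<mu> T (q y) = \<nu> T (q y)" by (metis blinfun_apply_blinfun_compose)
    qed (use pos m.mu_mem n.mu_mem in auto)
  qed (simp_all add: m.mu_add n.mu_add m.mu_scale n.mu_scale)
qed


subsection \<open>A duplicable algebra consists of bounded functions\<close>

lemma linf_sel:
  "carr (linf X) = {f. bounded (f ` X) \<and> (\<forall>x. x \<notin> X \<longrightarrow> f x = 0)}"
  "add (linf X) f g = (\<lambda>x. f x + g x)" "mul (linf X) f g = (\<lambda>x. f x * g x)"
  "unit (linf X) = (\<lambda>x. if x \<in> X then 1 else 0)" "scale (linf X) c f = (\<lambda>x. c * f x)"
  "star (linf X) f = (\<lambda>x. cnj (f x))" "pos (linf X) = {f \<in> carr (linf X). \<forall>x\<in>X. f x \<in> \<real>\<^sub>\<ge>\<^sub>0}"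
  by (simp_all add: linf_def)

lemma linf_memI:
  "(\<And>x. x \<in> X \<Longrightarrow> cmod (f x) \<le> B) \<Longrightarrow> (\<And>x. x \<notin> X \<Longrightarrow> f x = 0) \<Longrightarrow> f \<in> carr (linf X)"
  by (auto simp: linf_sel bounded_iff)

lemma linf_memD:
  assumes "f \<in> carr (linf X)"
  obtains B where "\<And>x. cmod (f x) \<le> B" "0 \<le> B"
proof -
  obtain B where B: "\<And>x. x \<in> X \<Longrightarrow> cmod (f x) \<le> B"
    using assms by (auto simp: linf_sel bounded_iff)
  have "cmod (f x) \<le> max B 0" for x
    using B[of x] assms by (cases "x \<in> X") (auto simp: linf_sel)
  then show ?thesis using that[of "max B 0"] by simp
qed

lemma linf_off: "f \<in> carr (linf X) \<Longrightarrow> x \<notin> X \<Longrightarrow> f x = 0"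
  by (simp add: linf_sel)

lemma linf_diff:
  assumes "f \<in> carr (linf X)" "g \<in> carr (linf X)"
  shows "(\<lambda>x. f x - g x) \<in> carr (linf X)"
proof -
  obtain B C where "\<And>x. cmod (f x) \<le> B" "\<And>x. cmod (g x) \<le> C"
    using linf_memD assms by metis
  then have "cmod (f x - g x) \<le> B + C" for x
    by (meson add_mono norm_triangle_ineq4 order_trans)
  then show ?thesis using assms by (intro linf_memI) (auto simp: linf_off)
qed

lemma le_linf:
  assumes "f \<in> carr (linf X)" "g \<in> carr (linf X)"
  shows "le_alg (linf X) f g \<longleftrightarrow> (\<forall>x. g x - f x \<in> \<real>\<^sub>\<ge>\<^sub>0)"
proof
  assume "le_alg (linf X) f g"
  then obtain p where "p \<in> pos (linf X)" "g = (\<lambda>x. f x + p x)" by (auto simp: le_alg_def linf_sel)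
  then show "\<forall>x. g x - f x \<in> \<real>\<^sub>\<ge>\<^sub>0"
    using linf_off[of p X] by (auto simp: linf_sel(7))
next
  assume "\<forall>x. g x - f x \<in> \<real>\<^sub>\<ge>\<^sub>0"
  then show "le_alg (linf X) f g"
    using linf_diff[OF assms(2,1)] unfolding le_alg_def
    by (intro bexI[of _ "\<lambda>x. g x - f x"]) (auto simp: linf_sel(2,7))
qed

context duplicated_algebra
begin

text \<open>The map \<open>f\<close> is the Gelfand transform: \<open>f a q\<close> is the scalar by
  which \<open>a\<close> acts on the range of \<open>q\<close>.\<close>

lemma isomorphic_linf:
  "isomorphic_alg (op_algebra A) (linf {q. minimal_projection A q})"
proof -
  define X where "X = {q. minimal_projection A q}"
  have "\<forall>q\<in>X. \<exists>\<xi>. q \<xi> = \<xi> \<and> norm \<xi> = 1"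
    using proj_unit_vector minimal_projectionD(2,3) unfolding X_def by blast
  then obtain \<xi> where \<xi>: "\<And>q. q \<in> X \<Longrightarrow> q (\<xi> q) = \<xi> q" "\<And>q. q \<in> X \<Longrightarrow> norm (\<xi> q) = 1"
    by metis
  have self: "cinner (\<xi> q) (\<xi> q) = 1" if "q \<in> X" for q using \<xi>(2)[OF that] by (simp add: cinner_self_eq)
  define f where "f a q = (if q \<in> X then cinner (\<xi> q) (blinfun_apply a (\<xi> q)) else 0)" for a q
  have eig: "a (q y) = f a q *\<^sub>C q y" if "a \<in> A" "q \<in> X" for a q y
    using minimal_projection_eigenvalue[of q "\<xi> q" a y] that \<xi>[OF that(2)] by (simp add: f_def X_def)
  have eig\<xi>: "a (\<xi> q) = f a q *\<^sub>C \<xi> q" if "a \<in> A" "q \<in> X" for a q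
    using eig[OF that, of "\<xi> q"] \<xi>(1)[OF that(2)] by simp
  have f_mem: "f a \<in> carr (linf X)" for a
  proof (rule linf_memI)
    fix q assume q: "q \<in> X"
    have "cmod (f a q) \<le> norm (\<xi> q) * norm (a (\<xi> q))"
      using q by (simp add: f_def cinner_Cauchy_Schwarz)
    also have "\<dots> \<le> norm a" using norm_blinfun[of a "\<xi> q"] \<xi>(2)[OF q] by simp
    finally show "cmod (f a q) \<le> norm a" .
  qed (simp add: f_def)
  have f_add: "f (a + b) = (\<lambda>q. f a q + f b q)" and f_diff: "f (a - b) = (\<lambda>q. f a q - f b q)"
    and f_scale: "f (scale_op c a) = (\<lambda>q. c * f a q)" and f_scaleR: "f (r *\<^sub>R a) = (\<lambda>q. r *\<^sub>R f a q)"
    and f_id: "f id_blinfun = (\<lambda>q. if q \<in> X then 1 else 0)" for a b c r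
    by (auto simp: f_def blinfun.bilinear_simps cinner_simps self)
  have f_mul: "f (a o\<^sub>L b) = (\<lambda>q. f a q * f b q)" if "a \<in> A" "b \<in> A" for a b
  proof
    fix q
    show "f (a o\<^sub>L b) q = f a q * f b q"
    proof (cases "q \<in> X")
      case True
      then have "f (a o\<^sub>L b) q = cinner (\<xi> q) (f b q *\<^sub>C (f a q *\<^sub>C \<xi> q))"
        using that memA by (simp add: f_def[of "a o\<^sub>L b"] eig\<xi> bounded_opsD)
      then show ?thesis using True self by (simp add: cinner_simps)
    qed (simp add: f_def)
  qed
  have f_adj: "f (adj_op a) = (\<lambda>q. cnj (f a q))" if "a \<in> A" for a
    by (rule ext) (auto simp: f_def cinner_adj_right[OF memA[OF that]] intro: cinner_commute)
  have f_pos: "f a q \<in> \<real>\<^sub>\<ge>\<^sub>0" if "pos_op a" for a q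
    using that by (simp add: f_def pos_op_def)
  have f_qform: "f a q = complex_of_real (qform a (\<xi> q))" if "selfadj_op a" "q \<in> X" for a q
    using that by (simp add: f_def selfadj_qform)
  have inj: "inj_on f A"
  proof (rule inj_onI)
    fix a b assume ab: "a \<in> A" "b \<in> A" "f a = f b"
    show "a = b"
    proof (rule minimal_projections_separate[OF _ ab(1,2)])
      fix q y assume "minimal_projection A q"
      then have "q \<in> X" by (simp add: X_def)
      then show "a (q y) = b (q y)" by (simp only: eig ab)
    qed
  qed
  \<comment> \<open>The preimage of a nonnegative bounded function is the supremum of the finite
    sums of \<open>g q *\<^sub>R q\<close>, so existence of directed suprema supplies
    surjectivity.\<close>
  have surj_nonneg: "\<exists>a\<in>A. f a = (\<lambda>q. complex_of_real (g q))"
    if g: "\<And>q. 0 \<le> g q" "\<And>q. g q \<le> B" "\<And>q. q \<notin> X \<Longrightarrow> g q = 0" for g B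
  proof -
    define s where "s Q = (\<Sum>q\<in>Q. g q *\<^sub>R q)" for Q
    define D where "D = s ` {Q. finite Q \<and> Q \<subseteq> X}"
    have XA: "q \<in> A" "proj_op q" if "q \<in> X" for q
      using that minimal_projectionD by (auto simp: X_def)
    have sA: "s Q \<in> A" and sp: "pos_op (s Q)" if "finite Q" "Q \<subseteq> X" for Q
      using that
    proof (induction Q rule: finite_induct)
      case empty
      { case 1 show ?case using vn_zero[OF vn] by (simp add: s_def) }
      { case 2 show ?case by (simp add: s_def) }
    next
      case (insert q Q)
      then have e: "s (insert q Q) = g q *\<^sub>R q + s Q" by (simp add: s_def)
      { case 1 then show ?case using insert XA unfolding e by (auto intro!: vn_add[OF vn] vn_scaleR[OF vn]) }
      { case 2 then show ?case using insert XA g(1) proj_pos unfolding e by (auto intro!: pos_add pos_scaleR) }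
    qed
    have mono: "pos_op (s Q' - s Q)" if "finite Q'" "Q' \<subseteq> X" "Q \<subseteq> Q'" for Q Q'
    proof -
      have "s Q' = s (Q' - Q) + s Q"
        using that by (simp add: s_def sum.subset_diff)
      then show ?thesis using sp[of "Q' - Q"] that by auto
    qed
    have D: "D \<subseteq> A" "\<And>d. d \<in> D \<Longrightarrow> selfadj_op d" "D \<noteq> {}"
      using sA sp pos_selfadj by (auto simp: D_def)
    have dir: "\<exists>c\<in>D. pos_op (c - a) \<and> pos_op (c - b)" if ab: "a \<in> D" "b \<in> D" for a b
    proof -
      obtain Q R where QR: "a = s Q" "b = s R" "finite Q" "finite R" "Q \<subseteq> X" "R \<subseteq> X"
        using ab by (auto simp: D_def)
      then show ?thesis
        using mono[of "Q \<union> R" Q] mono[of "Q \<union> R" R]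
        by (intro bexI[of _ "s (Q \<union> R)"]) (auto simp: D_def)
    qed
    have B: "0 \<le> B" using g(1,2) order_trans by blast
    \<comment> \<open>The difference is \<open>B (1 - \<Sum>Q)\<close> plus the sum of the operators
      \<open>(B - g q) q\<close>; orthogonality makes \<open>\<Sum>Q\<close> a projection, so both
      terms are positive.\<close>
    have ub: "pos_op (B *\<^sub>R id_blinfun - d)" if d: "d \<in> D" for d
    proof -
      obtain Q where Q: "d = s Q" "finite Q" "Q \<subseteq> X" using d by (auto simp: D_def)
      have "proj_op (\<Sum>Q)" using Q by (intro sum_minimal_projections) (auto simp: X_def)
      then have "pos_op (B *\<^sub>R (id_blinfun - \<Sum>Q))" using B by (intro pos_scaleR proj_pos proj_compl)
      moreover have "pos_op (\<Sum>q\<in>Q. (B - g q) *\<^sub>R q)"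
        using Q(2,3)
      proof (induction Q rule: finite_induct)
        case (insert q Q)
        then show ?case using proj_pos[OF XA(2)] g(2) by (auto intro!: pos_add pos_scaleR)
      qed simp
      ultimately have "pos_op (B *\<^sub>R (id_blinfun - \<Sum>Q) + (\<Sum>q\<in>Q. (B - g q) *\<^sub>R q))" by (rule pos_add)
      then show ?thesis
        by (simp add: Q(1) s_def scaleR_diff_right scaleR_diff_left sum_subtractf scaleR_sum_right)
    qed
    have qf: "qform (s Q) (\<xi> r) = (if r \<in> Q then g r else 0)" if Q: "finite Q" "Q \<subseteq> X" and r: "r \<in> X" for Q r
    proof -
      have "qform (s Q) (\<xi> r) = (\<Sum>q\<in>Q. g q * qform q (\<xi> r))"
        using Q(1) by (induction Q rule: finite_induct) (simp_all add: s_def qform_add qform_scaleR)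
      also have "\<dots> = (\<Sum>q\<in>Q. if q = r then g r else 0)"
      proof (rule sum.cong[OF refl])
        fix q assume q: "q \<in> Q"
        show "g q * qform q (\<xi> r) = (if q = r then g r else 0)"
        proof (cases "q = r")
          case True
          then show ?thesis using \<xi>[OF r] XA(2)[OF r] by (simp add: proj_qform)
        next
          case False
          then have "q o\<^sub>L r = 0"
            using q Q r by (intro minimal_projections_orthogonal) (auto simp: X_def)
          then have "q (r (\<xi> r)) = 0" by (metis blinfun_apply_blinfun_compose blinfun.zero_left)
          then show ?thesis using False \<xi>(1)[OF r] by (simp add: qform_def)
        qed
      qed
      finally show ?thesis using Q(1) by simp
    qed
    show ?thesis
    proof (rule vn_directed_sup[OF vn, of D "B *\<^sub>R id_blinfun"])
      fix F S
      assume F: "F \<noteq> bot" and ev: "\<And>d. d \<in> D \<Longrightarrow> \<forall>\<^sub>F d' in F. d' \<in> D \<and> pos_op (d' - d)"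
        and lim: "\<And>x. ((\<lambda>d. blinfun_apply d x) \<longlongrightarrow> blinfun_apply S x) F" and S: "S \<in> A" "selfadj_op S"
      have "qform S (\<xi> r) = g r" if r: "r \<in> X" for r
      proof (rule antisym)
        have sr: "s {r} \<in> D" using r by (auto simp: D_def)
        show "qform S (\<xi> r) \<le> g r"
        proof (rule tendsto_upperbound[OF tendsto_qform[OF lim] _ F])
          show "\<forall>\<^sub>F d in F. qform d (\<xi> r) \<le> g r"
            using ev[OF sr] by eventually_elim (use qf r g(1) in \<open>auto simp: D_def\<close>)
        qed
        show "g r \<le> qform S (\<xi> r)"
        proof (rule tendsto_lowerbound[OF tendsto_qform[OF lim] _ F])
          show "\<forall>\<^sub>F d in F. g r \<le> qform d (\<xi> r)"
            using ev[OF sr]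
          proof eventually_elim
            case (elim d)
            then have "qform (s {r}) (\<xi> r) \<le> qform d (\<xi> r)" by (intro pos_diff_qform) auto
            then show ?case using qf[of "{r}" r] r by simp
          qed
        qed
      qed
      then have "f S = (\<lambda>q. complex_of_real (g q))"
        using f_qform[OF S(2)] g(3) by (auto simp: f_def)
      then show ?thesis using S(1) by blast
    qed (use D dir ub in auto)
  qed
  have surj: "\<exists>a\<in>A. f a = h" if h: "h \<in> carr (linf X)" for h
  proof -
    obtain B where B: "\<And>x. cmod (h x) \<le> B" "0 \<le> B" using linf_memD[OF h] by blast
    have part: "\<exists>a\<in>A. f a = (\<lambda>q. complex_of_real (u q))"
      if u: "\<And>q. \<bar>u q\<bar> \<le> B" "\<And>q. q \<notin> X \<Longrightarrow> u q = 0" for u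
    proof -
      \<comment> \<open>Adding \<open>B\<close> on \<open>X\<close> makes the function nonnegative
        with bound \<open>2 * B\<close>; the shift is undone by subtracting \<open>B\<close> times
        the identity.\<close>
      have "\<exists>a\<in>A. f a = (\<lambda>q. complex_of_real (if q \<in> X then u q + B else 0))"
      proof (rule surj_nonneg[of _ "2 * B"])
        show "0 \<le> (if q \<in> X then u q + B else 0)" "(if q \<in> X then u q + B else 0) \<le> 2 * B" for q
          using u(1)[of q] B(2) by (auto simp: abs_le_iff)
      qed simp
      then obtain a where a: "a \<in> A" "f a = (\<lambda>q. complex_of_real (if q \<in> X then u q + B else 0))" by blast
      have "f (a - B *\<^sub>R id_blinfun) = (\<lambda>q. complex_of_real (u q))"
        using u(2) by (auto simp: f_diff f_scaleR f_id a(2) scaleR_conv_of_real)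
      then show ?thesis using vn_diff[OF vn a(1) vn_scaleR[OF vn vn_id[OF vn]]] by blast
    qed
    have off: "h q = 0" if "q \<notin> X" for q using h that by (rule linf_off)
    have "\<exists>a\<in>A. f a = (\<lambda>q. complex_of_real (Re (h q)))"
      by (rule part) (use abs_Re_le_cmod B(1) order_trans off in \<open>auto, blast\<close>)
    then obtain a where a: "a \<in> A" "f a = (\<lambda>q. complex_of_real (Re (h q)))" by blast
    have "\<exists>b\<in>A. f b = (\<lambda>q. complex_of_real (Im (h q)))"
      by (rule part) (use abs_Im_le_cmod B(1) order_trans off in \<open>auto, blast\<close>)
    then obtain b where b: "b \<in> A" "f b = (\<lambda>q. complex_of_real (Im (h q)))" by blast
    have "f (a + scale_op \<i> b) = h"
      by (simp add: f_add f_scale a b complex_eq[symmetric])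
    then show ?thesis using vn_add[OF vn a(1) vn_scale[OF vn b(1)]] by blast
  qed
  have "vn_iso (op_algebra A) (linf X) f"
    unfolding vn_iso_def
  proof (intro conjI)
    show "bij_betw f (carr (op_algebra A)) (carr (linf X))"
      unfolding bij_betw_def op_algebra_sel
    proof (intro conjI inj equalityI subsetI)
      show "h \<in> carr (linf X)" if "h \<in> f ` A" for h using that f_mem by blast
      show "h \<in> f ` A" if "h \<in> carr (linf X)" for h using surj[OF that] by blast
    qed
    show "linear_alg (op_algebra A) (linf X) f"
      using f_mem by (auto simp: linear_alg_def op_algebra_sel linf_sel(2,5) f_add f_scale)
    show "\<forall>a\<in>carr (op_algebra A). \<forall>b\<in>carr (op_algebra A).
        f (mul (op_algebra A) a b) = mul (linf X) (f a) (f b)"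
      by (simp add: op_algebra_sel linf_sel(3) f_mul)
    show "\<forall>a\<in>carr (op_algebra A). f (star (op_algebra A) a) = star (linf X) (f a)"
      by (simp add: op_algebra_sel linf_sel(6) f_adj)
    show "unital_alg (op_algebra A) (linf X) f"
      by (simp add: unital_alg_def op_algebra_sel linf_sel(4) f_id)
    show "normal_alg (op_algebra A) (linf X) f"
      unfolding normal_alg_def
    proof (intro conjI allI impI; (elim conjE)?)
      show "positive_alg (op_algebra A) (linf X) f"
        using f_mem f_pos by (auto simp: positive_alg_def pos_op_algebra[OF vn] linf_sel(7))
      fix D s
      assume D: "D \<subseteq> self_adj (op_algebra A)" "directed_alg (op_algebra A) D"
        and s: "sup_alg (op_algebra A) D s"
      have DA: "D \<subseteq> A" "\<And>d. d \<in> D \<Longrightarrow> selfadj_op d" "D \<noteq> {}"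
        using D by (auto simp: self_adj_op_algebra[OF vn] directed_alg_def)
      have s': "s \<in> A" "selfadj_op s" "\<And>d. d \<in> D \<Longrightarrow> pos_op (s - d)"
        using s DA by (auto simp: sup_alg_def upper_bound_op_algebra[OF vn])
      show "sup_alg (linf X) (f ` D) (f s)"
        unfolding sup_alg_def
      proof (intro conjI allI impI)
        have "f s \<in> self_adj (linf X)"
          using f_mem f_adj[OF s'(1)] s'(2) by (simp add: self_adj_def linf_sel(6) selfadj_iff_adj)
        moreover have "le_alg (linf X) (f d) (f s)" if "d \<in> D" for d
          using f_pos[OF s'(3)[OF that]] by (simp add: le_linf f_mem f_diff)
        ultimately show "upper_bound_alg (linf X) (f ` D) (f s)"
          by (auto simp: upper_bound_alg_def)
        fix u assume u: "upper_bound_alg (linf X) (f ` D) u"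
        have um: "u \<in> carr (linf X)" "(\<lambda>x. cnj (u x)) = u"
          using u by (auto simp: upper_bound_alg_def self_adj_def linf_sel(6))
        have real_u: "u q = complex_of_real (Re (u q))" for q
          using fun_cong[OF um(2), of q] by (metis Reals_cnj_iff of_real_Re)
        have le: "qform d (\<xi> q) \<le> Re (u q)" if "d \<in> D" "q \<in> X" for d q
        proof -
          have "u q - f d q \<in> \<real>\<^sub>\<ge>\<^sub>0"
            using u that um by (auto simp: upper_bound_alg_def le_linf f_mem)
          then show ?thesis
            using DA(2) that by (simp add: f_qform complex_nonneg_Reals_iff)
        qed
        show "le_alg (linf X) (f s) u"
          unfolding le_linf[OF f_mem um(1)]
        proof
          fix q
          show "u q - f s q \<in> \<real>\<^sub>\<ge>\<^sub>0"
          proof (cases "q \<in> X")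
            case True
            obtain d0 where d0: "d0 \<in> D" using DA(3) by blast
            \<comment> \<open>As the strong limit of \<open>D\<close>, the supremum \<open>s\<close>
              takes at \<open>\<xi> q\<close> the limit of values that are all at most
              \<open>u q\<close>; suprema are thus computed pointwise.\<close>
            have "qform s (\<xi> q) \<le> Re (u q)"
            proof (rule sup_op_algebra_strong_limit[OF vn D s])
              fix F
              assume F: "F \<noteq> bot" and ev: "\<And>d. d \<in> D \<Longrightarrow> \<forall>\<^sub>F d' in F. d' \<in> D \<and> pos_op (d' - d)"
                and lim: "\<And>x. ((\<lambda>d. blinfun_apply d x) \<longlongrightarrow> blinfun_apply s x) F"
              show ?thesis
              proof (rule tendsto_upperbound[OF tendsto_qform[OF lim] _ F])
                show "\<forall>\<^sub>F d in F. qform d (\<xi> q) \<le> Re (u q)"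
                  using ev[OF d0] by eventually_elim (use le True in auto)
              qed
            qed
            then show ?thesis
              using f_qform[OF s'(2) True] real_u[of q]
              by (metis (no_types, lifting) diff_ge_0_iff_ge nonneg_Reals_of_real_iff of_real_diff)
          qed (simp add: f_def linf_off[OF um(1)])
        qed
      qed
    qed
  qed
  then show ?thesis unfolding isomorphic_alg_def X_def by blast
qed

end

subsection \<open>An algebra of bounded functions has a duplicator\<close>

text \<open>Under the isomorphism, \<open>\<mu>\<close> restricts functions on \<open>X \<times> X\<close> to the diagonal: if \<open>\<xi> x\<close> is a
  unit vector in the range of the atom at \<open>x\<close>, then \<open>\<mu> T\<close> corresponds to
  \<open>x \<mapsto> \<langle>\<xi> x \<otimes> \<xi> x, T (\<xi> x \<otimes> \<xi> x)\<rangle>\<close>.\<close>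

lemma isomorphic_linf_imp_duplicator:
  fixes A :: "('h::complex_hilbert \<Rightarrow>\<^sub>L 'h) set" and t :: "'h \<Rightarrow> 'h \<Rightarrow> 'k::complex_hilbert"
    and X :: "'x set"
  assumes vn: "von_neumann_algebra A" and t: "hilbert_tensor_product t"
    and iso: "isomorphic_alg (op_algebra A) (linf X)"
  shows "\<exists>\<mu>. duplicator t A \<mu>"
proof -
  define M where "M = spatial_tensor t A A"
  have vnM: "von_neumann_algebra M"
    unfolding M_def by (rule von_neumann_spatial_tensor[OF t vn vn])
  note memA = vn_bounded[OF vn]
  obtain \<phi> where \<phi>: "vn_iso (op_algebra A) (linf X) \<phi>" using iso by (auto simp: isomorphic_alg_def)
  have bij: "bij_betw \<phi> A (carr (linf X))"
    and \<phi>_add: "\<And>a b. a \<in> A \<Longrightarrow> b \<in> A \<Longrightarrow> \<phi> (a + b) = (\<lambda>x. \<phi> a x + \<phi> b x)"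
    and \<phi>_scale: "\<And>c a. a \<in> A \<Longrightarrow> \<phi> (scale_op c a) = (\<lambda>x. c * \<phi> a x)"
    and \<phi>_mul: "\<And>a b. a \<in> A \<Longrightarrow> b \<in> A \<Longrightarrow> \<phi> (a o\<^sub>L b) = (\<lambda>x. \<phi> a x * \<phi> b x)"
    and \<phi>_star: "\<And>a. a \<in> A \<Longrightarrow> \<phi> (adj_op a) = (\<lambda>x. cnj (\<phi> a x))"
    and \<phi>_id: "\<phi> id_blinfun = (\<lambda>x. if x \<in> X then 1 else 0)"
    and \<phi>_pos: "\<And>a. a \<in> A \<Longrightarrow> pos_op a \<Longrightarrow> \<phi> a \<in> pos (linf X)"
    using \<phi> unfolding vn_iso_def linear_alg_def unital_alg_def normal_alg_def positive_alg_def
      pos_op_algebra[OF vn] op_algebra_sel linf_sel(2-6)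
    by (simp_all add: image_subset_iff)
  have inj: "a = b" if "a \<in> A" "b \<in> A" "\<phi> a = \<phi> b" for a b
    using bij that by (auto simp: bij_betw_def inj_on_def)
  have \<phi>_mem: "\<phi> a \<in> carr (linf X)" if "a \<in> A" for a
    using bij that by (auto simp: bij_betw_def)
  have \<phi>_diff: "\<phi> (a - b) = (\<lambda>x. \<phi> a x - \<phi> b x)" if "a \<in> A" "b \<in> A" for a b
  proof
    fix x
    have "\<phi> a = \<phi> ((a - b) + b)" by simp
    then show "\<phi> (a - b) x = \<phi> a x - \<phi> b x"
      using \<phi>_add[of "a - b" b] that vn_diff[OF vn that] by simp
  qed
  define \<psi> where "\<psi> = inv_into A \<phi>"
  have \<psi>_mem: "\<psi> g \<in> A" and \<phi>\<psi>: "\<phi> (\<psi> g) = g" if "g \<in> carr (linf X)" for g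
  proof -
    have "g \<in> \<phi> ` A" using bij that by (auto simp: bij_betw_def)
    then show "\<psi> g \<in> A" "\<phi> (\<psi> g) = g"
      unfolding \<psi>_def by (auto intro: inv_into_into f_inv_into_f)
  qed
  have pos_iff: "pos_op a" if a: "a \<in> A" and nn: "\<And>x. \<phi> a x \<in> \<real>\<^sub>\<ge>\<^sub>0" for a
  proof -
    obtain B where B: "\<And>x. cmod (\<phi> a x) \<le> B" "0 \<le> B" using linf_memD[OF \<phi>_mem[OF a]] by blast
    \<comment> \<open>The pointwise square root writes \<open>a\<close> as
      \<open>adj_op b o\<^sub>L b\<close> with \<open>b = \<psi> g\<close>, so \<open>\<phi>\<close>
      reflects positivity.\<close>
    define g where "g x = complex_of_real (sqrt (Re (\<phi> a x)))" for x
    have gg: "cnj (g x) * g x = \<phi> a x" for x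
    proof -
      obtain r where r: "\<phi> a x = complex_of_real r" "0 \<le> r" using nn[of x] by (auto elim: nonneg_Reals_cases)
      then show ?thesis by (simp add: g_def flip: of_real_mult)
    qed
    have "g \<in> carr (linf X)"
    proof (rule linf_memI)
      fix x
      have "(cmod (g x))\<^sup>2 = cmod (\<phi> a x)"
        using gg[of x] by (metis complex_mod_cnj norm_mult power2_eq_square)
      also have "\<dots> \<le> (sqrt B)\<^sup>2" using B by simp
      finally show "cmod (g x) \<le> sqrt B" by (rule power2_le_imp_le) (use B in simp)
    qed (simp add: g_def linf_off[OF \<phi>_mem[OF a]])
    then have b: "\<psi> g \<in> A" "\<phi> (\<psi> g) = g" using \<psi>_mem \<phi>\<psi> by auto
    have "\<phi> (adj_op (\<psi> g) o\<^sub>L \<psi> g) = \<phi> a"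
      using b vn_adj[OF vn b(1)] by (simp add: \<phi>_mul \<phi>_star gg)
    then have "adj_op (\<psi> g) o\<^sub>L \<psi> g = a"
      using b a by (intro inj vn_compose[OF vn] vn_adj[OF vn])
    then show ?thesis using pos_adj_compose[OF memA[OF b(1)]] by simp
  qed
  have "\<exists>\<xi>. norm \<xi> = 1 \<and> (\<forall>a\<in>A. blinfun_apply a \<xi> = \<phi> a x *\<^sub>C \<xi>)" if x: "x \<in> X" for x
  proof -
    \<comment> \<open>The preimage of this indicator function is the atom at \<open>x\<close>.
      Multiplication by \<open>\<delta>\<close> keeps only the value at \<open>x\<close>, so every
      \<open>a\<close> acts on the range of the atom as the scalar
      \<open>\<phi> a x\<close>.\<close>
    define \<delta> where "\<delta> y = (if y = x then 1 else 0 :: complex)" for y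
    have "\<delta> \<in> carr (linf X)" using x by (intro linf_memI[of _ _ 1]) (auto simp: \<delta>_def)
    then have e: "\<psi> \<delta> \<in> A" "\<phi> (\<psi> \<delta>) = \<delta>" using \<psi>_mem \<phi>\<psi> by auto
    have "\<psi> \<delta> \<noteq> 0"
    proof
      assume "\<psi> \<delta> = 0"
      then have "\<phi> (0 - 0) = \<delta>" using e by simp
      then have "\<delta> x = 0" using \<phi>_diff[OF vn_zero[OF vn] vn_zero[OF vn]] by simp
      then show False by (simp add: \<delta>_def)
    qed
    then obtain y where y: "\<psi> \<delta> y \<noteq> 0" by (metis blinfun_eqI blinfun.zero_left)
    have eig: "blinfun_apply a (\<psi> \<delta> y) = \<phi> a x *\<^sub>C \<psi> \<delta> y" if a: "a \<in> A" for a
    proof -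
      have "\<phi> (a o\<^sub>L \<psi> \<delta>) = \<phi> (scale_op (\<phi> a x) (\<psi> \<delta>))"
        using a e by (auto simp: \<phi>_mul \<phi>_scale \<delta>_def)
      then have "a o\<^sub>L \<psi> \<delta> = scale_op (\<phi> a x) (\<psi> \<delta>)"
        using a e by (intro inj vn_compose[OF vn] vn_scale[OF vn])
      then have "(a o\<^sub>L \<psi> \<delta>) y = scale_op (\<phi> a x) (\<psi> \<delta>) y" by simp
      then show ?thesis by simp
    qed
    show ?thesis
      using y eig
      by (intro exI[of _ "(1 / norm (\<psi> \<delta> y)) *\<^sub>R \<psi> \<delta> y"]) (simp add: blinfun.scaleR_right scaleC_scaleR)
  qed
  then obtain \<xi> where \<xi>: "\<And>x. x \<in> X \<Longrightarrow> norm (\<xi> x) = 1"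
    "\<And>x a. x \<in> X \<Longrightarrow> a \<in> A \<Longrightarrow> blinfun_apply a (\<xi> x) = \<phi> a x *\<^sub>C \<xi> x"
    by metis
  have self: "cinner (\<xi> x) (\<xi> x) = 1" if "x \<in> X" for x using \<xi>(1)[OF that] by (simp add: cinner_self_eq)
  define \<zeta> where "\<zeta> x = t (\<xi> x) (\<xi> x)" for x
  define g where "g T x = (if x \<in> X then cinner (\<zeta> x) (blinfun_apply T (\<zeta> x)) else 0)" for T x
  define \<mu> where "\<mu> T = \<psi> (g T)" for T
  have g_mem: "g T \<in> carr (linf X)" for T
  proof (rule linf_memI)
    fix x assume x: "x \<in> X"
    have n: "norm (\<zeta> x) = 1" using \<xi>(1)[OF x] by (simp add: \<zeta>_def norm_tensor[OF t])
    have "cmod (g T x) \<le> norm (\<zeta> x) * norm (T (\<zeta> x))"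
      using x by (simp add: g_def cinner_Cauchy_Schwarz)
    also have "\<dots> \<le> norm T" using norm_blinfun[of T "\<zeta> x"] n by simp
    finally show "cmod (g T x) \<le> norm T" .
  qed (simp add: g_def)
  have \<mu>_mem: "\<mu> T \<in> A" and \<phi>\<mu>: "\<phi> (\<mu> T) = g T" for T
    unfolding \<mu>_def using \<psi>_mem \<phi>\<psi> g_mem by auto
  have g_pos: "g T x \<in> \<real>\<^sub>\<ge>\<^sub>0" if "pos_op T" for T x
    using that by (simp add: g_def pos_op_def)
  have g_diff: "g (S - T) x = g S x - g T x" for S T x
    by (simp add: g_def blinfun.bilinear_simps cinner_simps)
  have \<mu>_diff_pos: "pos_op (\<mu> S - \<mu> T)" if "pos_op (S - T)" for S T
    using g_pos[OF that] by (intro pos_iff vn_diff[OF vn] \<mu>_mem) (simp add: \<phi>_diff \<mu>_mem \<phi>\<mu> g_diff)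
  have g_tensor: "g (tensor_op t a b) = (\<lambda>x. \<phi> a x * \<phi> b x)" if ab: "a \<in> A" "b \<in> A" for a b
  proof
    fix x
    show "g (tensor_op t a b) x = \<phi> a x * \<phi> b x"
    proof (cases "x \<in> X")
      case True
      then show ?thesis
        using ab memA by (simp add: g_def \<zeta>_def tensor_op_apply[OF t] cinner_tensor[OF t] \<xi>(2) cinner_simps self)
    qed (simp add: g_def linf_off[OF \<phi>_mem[OF ab(1)]])
  qed
  \<comment> \<open>On simple tensors \<open>\<mu>\<close> is multiplication, so the unit laws and
    associativity of a duplicator become those of composition.\<close>
  have \<mu>_tensor: "\<mu> (tensor_op t a b) = a o\<^sub>L b" if "a \<in> A" "b \<in> A" for a b
    using that by (intro inj \<mu>_mem vn_compose[OF vn]) (simp_all add: \<phi>\<mu> g_tensor \<phi>_mul)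
  have "linear_alg (op_algebra M) (op_algebra A) \<mu>"
    unfolding linear_alg_def op_algebra_sel
  proof (intro conjI ballI allI)
    show "\<mu> \<in> M \<rightarrow> A" using \<mu>_mem by auto
    show "\<mu> (S + T) = \<mu> S + \<mu> T" for S T
      by (intro inj \<mu>_mem vn_add[OF vn])
        (simp add: \<phi>_add \<mu>_mem \<phi>\<mu>, auto simp: g_def blinfun.bilinear_simps cinner_simps)
    show "\<mu> (scale_op c T) = scale_op c (\<mu> T)" for c T
      by (intro inj \<mu>_mem vn_scale[OF vn])
        (simp add: \<phi>_scale \<mu>_mem \<phi>\<mu>, auto simp: g_def cinner_simps)
  qed
  moreover have positive: "positive_alg (op_algebra M) (op_algebra A) \<mu>"
    using g_pos \<mu>_mem
    by (auto simp: positive_alg_def pos_op_algebra[OF vn] pos_op_algebra[OF vnM] \<phi>\<mu> intro!: pos_iff)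
  moreover have "unital_alg (op_algebra M) (op_algebra A) \<mu>"
    using \<mu>_tensor[OF vn_id[OF vn] vn_id[OF vn]]
    by (simp add: unital_alg_def op_algebra_sel tensor_op_id[OF t])
  moreover have "normal_alg (op_algebra M) (op_algebra A) \<mu>"
    unfolding normal_alg_def
  proof (intro conjI allI impI positive; elim conjE)
    fix D s
    assume D: "D \<subseteq> self_adj (op_algebra M)" "directed_alg (op_algebra M) D"
      and s: "sup_alg (op_algebra M) D s"
    have DM: "D \<subseteq> M" "D \<noteq> {}" using D by (auto simp: self_adj_op_algebra[OF vnM] directed_alg_def)
    have s': "s \<in> M" "selfadj_op s" "\<And>d. d \<in> D \<Longrightarrow> pos_op (s - d)"
      using s DM by (auto simp: sup_alg_def upper_bound_op_algebra[OF vnM])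
    have g_real: "g T x = complex_of_real (Re (g T x))" if "selfadj_op T" for T x
      using that by (simp add: g_def selfadj_qform)
    have "selfadj_op (\<mu> s)"
    proof -
      have "adj_op (\<mu> s) = \<mu> s"
      proof (intro inj vn_adj[OF vn] \<mu>_mem ext)
        fix x
        have "cnj (g s x) = g s x" using g_real[OF s'(2), of x] by (metis complex_cnj_complex_of_real)
        then show "\<phi> (adj_op (\<mu> s)) x = \<phi> (\<mu> s) x" by (simp add: \<phi>_star \<mu>_mem \<phi>\<mu>)
      qed
      then show ?thesis using memA[OF \<mu>_mem] by (simp add: selfadj_iff_adj)
    qed
    moreover have "pos_op (u - \<mu> s)"
      if u: "u \<in> A" "selfadj_op u" "\<And>d. d \<in> D \<Longrightarrow> pos_op (u - \<mu> d)" for u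
    proof (rule pos_iff)
      show "u - \<mu> s \<in> A" using u \<mu>_mem by (intro vn_diff[OF vn])
      fix x
      show "\<phi> (u - \<mu> s) x \<in> \<real>\<^sub>\<ge>\<^sub>0"
      proof (cases "x \<in> X")
        case True
        have "((\<lambda>x. cnj (\<phi> u x)) = \<phi> u)" using \<phi>_star[OF u(1)] u(2) by (simp add: selfadj_iff_adj)
        then have u_real: "\<phi> u x = complex_of_real (Re (\<phi> u x))"
          by (metis Reals_cnj_iff of_real_Re)
        have le: "qform d (\<zeta> x) \<le> Re (\<phi> u x)" if d: "d \<in> D" for d
        proof -
          have "\<phi> (u - \<mu> d) \<in> pos (linf X)" using u d \<mu>_mem by (intro \<phi>_pos vn_diff[OF vn])
          then have "\<phi> u x - g d x \<in> \<real>\<^sub>\<ge>\<^sub>0"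
            using True u(1) by (simp add: linf_sel(7) \<phi>_diff \<mu>_mem \<phi>\<mu>)
          then show ?thesis using True by (simp add: g_def qform_def complex_nonneg_Reals_iff)
        qed
        obtain d0 where d0: "d0 \<in> D" using DM(2) by blast
        \<comment> \<open>The coordinate of \<open>\<mu> T\<close> at \<open>x\<close> is a vector
          functional of \<open>T\<close>, so it is continuous along the strong limit that realises
          the supremum \<open>s\<close>.\<close>
        have "qform s (\<zeta> x) \<le> Re (\<phi> u x)"
        proof (rule sup_op_algebra_strong_limit[OF vnM D s])
          fix F
          assume F: "F \<noteq> bot" and ev: "\<And>d. d \<in> D \<Longrightarrow> \<forall>\<^sub>F d' in F. d' \<in> D \<and> pos_op (d' - d)"
            and lim: "\<And>x. ((\<lambda>d. blinfun_apply d x) \<longlongrightarrow> blinfun_apply s x) F"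
          show ?thesis
          proof (rule tendsto_upperbound[OF tendsto_qform[OF lim] _ F])
            show "\<forall>\<^sub>F d in F. qform d (\<zeta> x) \<le> Re (\<phi> u x)"
              using ev[OF d0] by eventually_elim (use le in auto)
          qed
        qed
        moreover have "g s x = complex_of_real (qform s (\<zeta> x))"
          using True s'(2) by (simp add: g_def selfadj_qform)
        ultimately show ?thesis
          using u_real u(1) by (simp add: \<phi>_diff \<mu>_mem \<phi>\<mu> complex_nonneg_Reals_iff complex_eq_iff)
      next
        case False
        then show ?thesis using u(1) by (simp add: \<phi>_diff \<mu>_mem \<phi>\<mu> g_def linf_off[OF \<phi>_mem])
      qed
    qed
    moreover have "\<mu> ` D \<subseteq> A" using \<mu>_mem by auto
    ultimately show "sup_alg (op_algebra A) (\<mu> ` D) (\<mu> s)"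
      using s'(3) \<mu>_mem \<mu>_diff_pos
      unfolding sup_alg_def upper_bound_op_algebra[OF vn \<open>\<mu> ` D \<subseteq> A\<close>]
      by (auto simp: le_op_algebra[OF vn])
  qed
  ultimately have "duplicator t A \<mu>"
    unfolding duplicator_def Let_def M_def[symmetric]
    using vn_id[OF vn] by (simp add: \<mu>_tensor \<mu>_mem vn_compose[OF vn] blinfun_compose_assoc)
  then show ?thesis by blast
qed

text \<open>The index set can be taken to consist of minimal projections, so the existential lives
  at the operator type; the converse is stated over an arbitrary type because types cannot be
  quantified inside the formula. Duplicators are total functions here, so uniqueness means agreement
  on the tensor square.\<close>

theorem theorem5p12:
  fixes A :: "('h::complex_hilbert \<Rightarrow>\<^sub>L 'h) set"
    and t :: "'h \<Rightarrow> 'h \<Rightarrow> 'k::complex_hilbert"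
  assumes "von_neumann_algebra A"
    and "hilbert_tensor_product t"
  shows "((\<exists>\<mu>. duplicator t A \<mu>) \<longleftrightarrow>
           (\<exists>X :: ('h \<Rightarrow>\<^sub>L 'h) set. isomorphic_alg (op_algebra A) (linf X)))
       \<and> (\<forall>X :: 'x set. isomorphic_alg (op_algebra A) (linf X) \<longrightarrow> (\<exists>\<mu>. duplicator t A \<mu>))
       \<and> (\<forall>\<mu> \<nu>. duplicator t A \<mu> \<and> duplicator t A \<nu> \<longrightarrow>
           (\<forall>T\<in>spatial_tensor t A A. \<mu> T = \<nu> T))"
proof (intro conjI allI impI iffI ballI; (elim exE conjE)?)
  fix \<mu> assume dup: "duplicator t A \<mu>"
  interpret duplicated_algebra t A \<mu> by unfold_locales (fact assms dup)+
  show "\<exists>X :: ('h \<Rightarrow>\<^sub>L 'h) set. isomorphic_alg (op_algebra A) (linf X)"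
    using isomorphic_linf by blast
qed (rule isomorphic_linf_imp_duplicator[OF assms] duplicator_unique[OF assms]; assumption)+

end
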